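(* Let $\mathcal{M}$ be any tiling of the plane by the four labelled metatiles $T,H,P,F$ (rotated and translated but not reflected) obeying the matching rules. Then, after bisecting the $P$ and $F$ metatiles into their upper and lower halves, the tiles fit together to form larger supertiles that are combinatorially equivalent to the metatiles, thereby forming a substitution system, and the tiling by the supertiles has the same symmetries as $\mathcal{M}$. That is: (1) the $T$ and $H$ metatiles of $\mathcal{M}$ and the upper and lower halves of the $P$ and $F$ metatiles of $\mathcal{M}$ can be partitioned into groups, each of which is the image of one of the supertiles $T',H',P',F'$ under an orientation-preserving isometry; (2) in the resulting tiling of the plane by supertiles, every labelled boundary arc of every supertile coincides with a labelled boundary arc of an adjacent supertile, with $A^+_2$ meeting $A^-_2$, $B^+_2$ meeting $B^-_2$, $X^+_2$ meeting $X^-_2$, $F^+_2$ meeting $F^-_2$, and $L_2$ meeting $L_2$; (3) under the correspondence $T'\leftrightarrow T$, $H'\leftrightarrow H$, $P'\leftrightarrow P$, $F'\leftrightarrow F$ (matching marked points and labelled arcs $Z_2\leftrightarrow Z$), the same combinations of supertiles fit together at vertices as combinations of metatiles: for any cyclic sequence of marked points of supertiles in which consecutive arcs have matching labels, the sum of the interior angles of the supertiles at these marked points equals the sum of the interior angles of the corresponding metatiles at the corresponding marked points; (4) an isometry of the plane is a symmetry of $\mathcal{M}$ if and only if it is a symmetry of the tiling by labelled supertiles.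
   Context: Write $[x,y]:=x\,e_1+y\,e_2$ with $e_1=(\sqrt3/2,1/2)$, $e_2=(0,1)$. Let $R$ be rotation by $60^\circ$ counterclockwise about the origin, $R[x,y]=[-y,x+y]$. For a figure $M$, write $M\langle k;x,y\rangle:=R^k(M)+[x,y]$. Metatiles. These are convex polygons whose boundaries are divided into labelled segments by marked points, listed in counterclockwise order with the label of the segment between consecutive marked points. $T$: $[0,0]\ \overset{A^-}{-}\ [3,0]\ \overset{A^-}{-}\ [0,3]\ \overset{B^+}{-}\ [0,0]$. $H$: $[0,0]\ \overset{X^+}{-}\ [1,-1]\ \overset{B^-}{-}\ [4,-1]\ \overset{X^-}{-}\ [5,-1]\ \overset{X^+}{-}\ [5,0]\ \overset{B^-}{-}\ [2,3]\ \overset{X^-}{-}\ [1,4]\ \overset{X^+}{-}\ [0,4]\ \overset{A^+}{-}\ [0,1]\ \overset{X^-}{-}\ [0,0]$. $P$: $[0,0]\ \overset{L}{-}\ [1,-1]\ \overset{X^-}{-}\ [2,-2]\ \overset{X^+}{-}\ [3,-2]\ \overset{A^-}{-}\ [6,-2]\ \overset{L}{-}\ [5,-1]\ \overset{X^-}{-}\ [4,0]\ \overset{X^+}{-}\ [3,0]\ \overset{B^+}{-}\ [0,0]$. $F$: $[0,0]\ \overset{L}{-}\ [1,-1]\ \overset{X^-}{-}\ [2,-2]\ \overset{X^+}{-}\ [3,-2]\ \overset{L}{-}\ [4,-2]\ \overset{X^-}{-}\ [5,-2]\ \overset{F^+}{-}\ [5,-1]\ \overset{F^-}{-}\ [4,0]\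 \overset{X^+}{-}\ [3,0]\ \overset{B^+}{-}\ [0,0]$. Matching rules. Copies of the metatiles may be rotated and translated but not reflected, and every labelled segment of every copy must coincide with a labelled segment of an adjacent copy on its other side, with $A^+$ meeting $A^-$, $B^+$ meeting $B^-$, $X^+$ meeting $X^-$, $F^+$ meeting $F^-$, and $L$ meeting $L$. Bisection. The segment from $[1,-1]$ to $[5,-1]$ cuts $P$ into an upper half $P^u$ (containing the $B^+$ segment) and a lower half $P^l$. The same segment cuts $F$ into an upper half $F^u$ (containing the $B^+$ segment) and a lower half $F^l$. These halves are taken in the same position as in $P$ and $F$ above. Supertiles. Each is the union of the listed pieces. Its boundary is divided by marked points into labelled polygonal arcs; the marked points are listed in counterclockwise order with the label of the boundary arc between consecutive ones. $T'$: pieces $H\langle0;0,0\rangle$, $P^l\langle1;-2,0\rangle$, $P^u\langle2;5,0\rangle$, $P^u\langle0;1,-1\rangle$. Boundary: $[1,-1]\ \overset{A^-_2}{-}\ [5,0]\ \overset{A^-_2}{-}\ [0,4]\ \overset{B^+_2}{-}\ [1,-1]$. These marked points correspond in order to $[0,0],[3,0],[0,3]$ of $T$. $H'$: pieces $T\langle0;0,0\rangle$, $H\langle5;-1,0\rangle$, $H\langle1;4,-1\rangle$, $H\langle1;-1,0\rangle$, $P^u\langle1;4,-5\rangle$, $P^u\langle3;4,4\rangle$, $P^l\langle2;-1,-2\rangle$, $F^u\langle1;5,-1\rangle$, $F^l\langle5;2,8\rangle$, $F^u\langle3;-1,5\rangle$, $F^l\langle1;-7,2\rangle$, $F^u\langle5;-1,-1\rangle$,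 $F^l\langle3;8,-7\rangle$. Boundary: $[-6,2]\ \overset{A^+_2}{-}\ [-1,-2]\ \overset{X^-_2}{-}\ [3,-6]\ \overset{X^+_2}{-}\ [7,-6]\ \overset{B^-_2}{-}\ [6,-1]\ \overset{X^-_2}{-}\ [6,3]\ \overset{X^+_2}{-}\ [2,7]\ \overset{B^-_2}{-}\ [-2,6]\ \overset{X^-_2}{-}\ [-6,6]\ \overset{X^+_2}{-}\ [-6,2]$. These marked points correspond in order to those of $H$ starting at $[0,4]$. $P'$: pieces $H\langle0;0,0\rangle$, both halves of $P\langle1;-2,0\rangle$, $F^u\langle2;5,0\rangle$, $P^u\langle0;1,-1\rangle$, $F^l\langle0;-4,6\rangle$, $F^l\langle3;2,-2\rangle$, $F^u\langle5;-7,4\rangle$, $H\langle5;-7,5\rangle$, $P^l\langle0;-9,7\rangle$. Boundary: $[-7,4]\ \overset{L_2}{-}\ [-7,3]\ \overset{X^-_2}{-}\ [-3,-1]\ \overset{X^+_2}{-}\ [1,-1]\ \overset{A^-_2}{-}\ [5,0]\ \overset{L_2}{-}\ [5,1]\ \overset{X^-_2}{-}\ [1,5]\ \overset{X^+_2}{-}\ [-3,5]\ \overset{B^+_2}{-}\ [-7,4]$. These marked points correspond in order to those of $P$ starting at $[0,0]$. $F'$: pieces $H\langle0;0,0\rangle$, both halves of $P\langle1;-2,0\rangle$, $F^u\langle2;5,0\rangle$, $F^u\langle0;1,-1\rangle$, $F^l\langle4;7,2\rangle$, $F^l\langle0;-4,6\rangle$, $F^l\langle3;2,-2\rangle$, $F^u\langle5;-7,4\rangle$,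 $H\langle5;-7,5\rangle$, $P^l\langle0;-9,7\rangle$. Boundary: $[-7,4]\ \overset{L_2}{-}\ [-7,3]\ \overset{X^-_2}{-}\ [-3,-1]\ \overset{X^+_2}{-}\ [1,-1]\ \overset{L_2}{-}\ [2,-2]\ \overset{X^-_2}{-}\ [6,-2]\ \overset{F^+_2}{-}\ [5,2]\ \overset{F^-_2}{-}\ [1,5]\ \overset{X^+_2}{-}\ [-3,5]\ \overset{B^+_2}{-}\ [-7,4]$. These marked points correspond in order to those of $F$ starting at $[0,0]$. In (3), a cyclic sequence of marked points $v_1,\dots,v_n$ of supertiles $S_1,\dots,S_n$ has consecutive matching labels if, for each $j$ (cyclically), the label of the arc of $S_j$ ending at $v_j$ (counterclockwise around $S_j$) and the label of the arc of $S_{j+1}$ starting at $v_{j+1}$ form a matching pair as in (2). A symmetry of a tiling by labelled tiles is an isometry permuting the tiles and preserving the labels. *)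

theory Defs
  imports "HOL-Analysis.Analysis"
begin

section \<open>The plane and its isometries\<close>

text \<open>The plane is the type of complex numbers; \<open>pt x y\<close> is the point written \<open>[x,y]\<close>,
  i.e. \<open>x e1 + y e2\<close> with \<open>e1 = (sqrt 3 / 2, 1 / 2)\<close> and \<open>e2 = (0, 1)\<close>.\<close>

definition pt :: "real \<Rightarrow> real \<Rightarrow> complex" where
  "pt x y = of_real x * Complex (sqrt 3 / 2) (1 / 2) + of_real y * Complex 0 1"

definition rot60 :: "complex \<Rightarrow> complex" where
  "rot60 z = cis (pi / 3) * z"

text \<open>\<open>M\<langle>k;x,y\<rangle>\<close> is the image of \<open>M\<close> under \<open>place k x y\<close>.\<close>

definition place :: "nat \<Rightarrow> real \<Rightarrow> real \<Rightarrow> complex \<Rightarrow> complex" where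
  "place k x y = (\<lambda>z. (rot60 ^^ k) z + pt x y)"

definition isometry :: "(complex \<Rightarrow> complex) \<Rightarrow> bool" where
  "isometry g \<longleftrightarrow> (\<forall>z w. dist (g z) (g w) = dist z w)"

definition direct_isometry :: "(complex \<Rightarrow> complex) \<Rightarrow> bool" where
  "direct_isometry g \<longleftrightarrow> (\<exists>a b. norm a = 1 \<and> g = (\<lambda>z. a * z + b))"

section \<open>Labelled shapes\<close>

datatype label = A_plus | A_minus | B_plus | B_minus | X_plus | X_minus | F_plus | F_minus | L_label

fun opposite :: "label \<Rightarrow> label" where
  "opposite A_plus = A_minus" | "opposite A_minus = A_plus"
| "opposite B_plus = B_minus" | "opposite B_minus = B_plus"
| "opposite X_plus = X_minus" | "opposite X_minus = X_plus"
| "opposite F_plus = F_minus" | "opposite F_minus = F_plus"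
| "opposite L_label = L_label"

text \<open>The arcs are listed counterclockwise. Arc \<open>j\<close> runs from marked point \<open>j\<close> to the next
  marked point and is given by the list of vertices of a polygonal path.\<close>

record shape =
  region :: "complex set"
  arcs :: "(complex list \<times> label) list"

definition polyline :: "complex list \<Rightarrow> complex set" where
  "polyline vs = (\<Union>i<length vs - 1. closed_segment (vs ! i) (vs ! Suc i))"

definition outgoing_arc :: "shape \<Rightarrow> nat \<Rightarrow> complex list \<times> label" where
  "outgoing_arc s j = arcs s ! j"

definition incoming_arc :: "shape \<Rightarrow> nat \<Rightarrow> complex list \<times> label" where
  "incoming_arc s j = arcs s ! ((j + length (arcs s) - 1) mod length (arcs s))"

text \<open>The interior angle at marked point \<open>j\<close> is swept counterclockwise from the first edge of the
  outgoing arc to the last edge of the incoming arc.\<close>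

definition interior_angle :: "shape \<Rightarrow> nat \<Rightarrow> real" where
  "interior_angle s j =
     (let vs = fst (outgoing_arc s j); us = fst (incoming_arc s j); v = hd vs
      in Arg2pi ((last (butlast us) - v) / (vs ! 1 - v)))"

section \<open>Metatiles\<close>

text \<open>The type \<open>metatile\<close> also indexes the four supertiles.\<close>

datatype metatile = T_tile | H_tile | P_tile | F_tile

text \<open>Each marked point is paired with the label of the segment that starts there.\<close>

fun metatile_marks :: "metatile \<Rightarrow> (complex \<times> label) list" where
  "metatile_marks T_tile =
     [(pt 0 0, A_minus), (pt 3 0, A_minus), (pt 0 3, B_plus)]"
| "metatile_marks H_tile =
     [(pt 0 0, X_plus), (pt 1 (-1), B_minus), (pt 4 (-1), X_minus), (pt 5 (-1), X_plus),
      (pt 5 0, B_minus), (pt 2 3, X_minus), (pt 1 4, X_plus), (pt 0 4, A_plus),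
      (pt 0 1, X_minus)]"
| "metatile_marks P_tile =
     [(pt 0 0, L_label), (pt 1 (-1), X_minus), (pt 2 (-2), X_plus), (pt 3 (-2), A_minus),
      (pt 6 (-2), L_label), (pt 5 (-1), X_minus), (pt 4 0, X_plus), (pt 3 0, B_plus)]"
| "metatile_marks F_tile =
     [(pt 0 0, L_label), (pt 1 (-1), X_minus), (pt 2 (-2), X_plus), (pt 3 (-2), L_label),
      (pt 4 (-2), X_minus), (pt 5 (-2), F_plus), (pt 5 (-1), F_minus), (pt 4 0, X_plus),
      (pt 3 0, B_plus)]"

definition metatile_shape :: "metatile \<Rightarrow> shape" where
  "metatile_shape k =
     (let ms = metatile_marks k in
      \<lparr> region = convex hull (fst ` set ms),
        arcs = map2 (\<lambda>(v, l) (w, _). ([v, w], l)) ms (rotate1 ms) \<rparr>)"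

section \<open>Bisection\<close>

datatype piece = T_piece | H_piece | P_upper | P_lower | F_upper | F_lower

fun pieces_of :: "metatile \<Rightarrow> piece set" where
  "pieces_of T_tile = {T_piece}"
| "pieces_of H_tile = {H_piece}"
| "pieces_of P_tile = {P_upper, P_lower}"
| "pieces_of F_tile = {F_upper, F_lower}"

text \<open>The bisecting segment from \<open>[1,-1]\<close> to \<open>[5,-1]\<close> lies on the line \<open>y = -1\<close> in these
  coordinates and joins two boundary points.\<close>

fun piece_region :: "piece \<Rightarrow> complex set" where
  "piece_region T_piece = region (metatile_shape T_tile)"
| "piece_region H_piece = region (metatile_shape H_tile)"
| "piece_region P_upper = region (metatile_shape P_tile) \<inter> {pt x y | x y. y \<ge> -1}"
| "piece_region P_lower = region (metatile_shape P_tile) \<inter> {pt x y | x y. y \<le> -1}"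
| "piece_region F_upper = region (metatile_shape F_tile) \<inter> {pt x y | x y. y \<ge> -1}"
| "piece_region F_lower = region (metatile_shape F_tile) \<inter> {pt x y | x y. y \<le> -1}"

text \<open>A placed tile or piece is a pair of its kind and the isometry that carries the standard copy
  into position. Keeping the kind is essential for pieces: the halves \<open>P_upper\<close>, \<open>P_lower\<close> and
  \<open>F_upper\<close> are congruent as unlabelled regions.\<close>

definition bisect :: "(metatile \<times> (complex \<Rightarrow> complex)) set \<Rightarrow> (piece \<times> (complex \<Rightarrow> complex)) set" where
  "bisect M = {(q, f) | q f k. (k, f) \<in> M \<and> q \<in> pieces_of k}"

section \<open>Supertiles\<close>

fun supertile_pieces :: "metatile \<Rightarrow> (piece \<times> (complex \<Rightarrow> complex)) set" where
  "supertile_pieces T_tile =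
     {(H_piece, place 0 0 0), (P_lower, place 1 (-2) 0), (P_upper, place 2 5 0),
      (P_upper, place 0 1 (-1))}"
| "supertile_pieces H_tile =
     {(T_piece, place 0 0 0), (H_piece, place 5 (-1) 0), (H_piece, place 1 4 (-1)),
      (H_piece, place 1 (-1) 0), (P_upper, place 1 4 (-5)), (P_upper, place 3 4 4),
      (P_lower, place 2 (-1) (-2)), (F_upper, place 1 5 (-1)), (F_lower, place 5 2 8),
      (F_upper, place 3 (-1) 5), (F_lower, place 1 (-7) 2), (F_upper, place 5 (-1) (-1)),
      (F_lower, place 3 8 (-7))}"
| "supertile_pieces P_tile =
     {(H_piece, place 0 0 0), (P_upper, place 1 (-2) 0), (P_lower, place 1 (-2) 0),
      (F_upper, place 2 5 0), (P_upper, place 0 1 (-1)), (F_lower, place 0 (-4) 6),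
      (F_lower, place 3 2 (-2)), (F_upper, place 5 (-7) 4), (H_piece, place 5 (-7) 5),
      (P_lower, place 0 (-9) 7)}"
| "supertile_pieces F_tile =
     {(H_piece, place 0 0 0), (P_upper, place 1 (-2) 0), (P_lower, place 1 (-2) 0),
      (F_upper, place 2 5 0), (F_upper, place 0 1 (-1)), (F_lower, place 4 7 2),
      (F_lower, place 0 (-4) 6), (F_lower, place 3 2 (-2)), (F_upper, place 5 (-7) 4),
      (H_piece, place 5 (-7) 5), (P_lower, place 0 (-9) 7)}"

fun supertile_marks :: "metatile \<Rightarrow> (complex \<times> label) list" where
  "supertile_marks T_tile =
     [(pt 1 (-1), A_minus), (pt 5 0, A_minus), (pt 0 4, B_plus)]"
| "supertile_marks H_tile =
     [(pt (-6) 2, A_plus), (pt (-1) (-2), X_minus), (pt 3 (-6), X_plus), (pt 7 (-6), B_minus),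
      (pt 6 (-1), X_minus), (pt 6 3, X_plus), (pt 2 7, B_minus), (pt (-2) 6, X_minus),
      (pt (-6) 6, X_plus)]"
| "supertile_marks P_tile =
     [(pt (-7) 4, L_label), (pt (-7) 3, X_minus), (pt (-3) (-1), X_plus), (pt 1 (-1), A_minus),
      (pt 5 0, L_label), (pt 5 1, X_minus), (pt 1 5, X_plus), (pt (-3) 5, B_plus)]"
| "supertile_marks F_tile =
     [(pt (-7) 4, L_label), (pt (-7) 3, X_minus), (pt (-3) (-1), X_plus), (pt 1 (-1), L_label),
      (pt 2 (-2), X_minus), (pt 6 (-2), F_plus), (pt 5 2, F_minus), (pt 1 5, X_plus),
      (pt (-3) 5, B_plus)]"

definition supertile_region :: "metatile \<Rightarrow> complex set" where
  "supertile_region k = (\<Union>(q, f)\<in>supertile_pieces k. f ` piece_region q)"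

text \<open>The supertiles are unions of unit triangles of the lattice spanned by \<open>e1\<close> and \<open>e2\<close>, so a
  boundary arc starting at a lattice point is a path of unit lattice edges. A directed edge is a
  counterclockwise boundary edge of \<open>M\<close> if \<open>M\<close> lies immediately to its left and not
  immediately to its right.\<close>

definition boundary_edge :: "complex set \<Rightarrow> complex \<Rightarrow> complex \<Rightarrow> bool" where
  "boundary_edge M a b \<longleftrightarrow>
     (\<exists>k. b - a = (rot60 ^^ k) (pt 1 0)) \<and>
     (\<forall>z\<in>open_segment a b. eventually (\<lambda>\<epsilon>.
        z + of_real \<epsilon> * \<i> * (b - a) \<in> M \<and> z - of_real \<epsilon> * \<i> * (b - a) \<notin> M) (at_right 0))"

definition boundary_path :: "complex set \<Rightarrow> complex \<Rightarrow> complex \<Rightarrow> complex list" where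
  "boundary_path M v w =
     (THE vs. vs \<noteq> [] \<and> hd vs = v \<and> last vs = w \<and> distinct vs \<and> successively (boundary_edge M) vs)"

definition supertile_shape :: "metatile \<Rightarrow> shape" where
  "supertile_shape k =
     (let ms = supertile_marks k in
      \<lparr> region = supertile_region k,
        arcs = map2 (\<lambda>(v, l) (w, _). (boundary_path (supertile_region k) v w, l)) ms (rotate1 ms) \<rparr>)"

text \<open>The marked points of the supertile \<open>H'\<close> are listed from the one that corresponds to
  \<open>[0,4]\<close>, which has index 7 in \<open>metatile_marks H_tile\<close>.\<close>

definition corresponding_mark :: "metatile \<Rightarrow> nat \<Rightarrow> nat" where
  "corresponding_mark k j = (if k = H_tile then (j + 7) mod 9 else j)"

section \<open>Tilings by labelled shapes\<close>

text \<open>In this section \<open>G\<close> is \<open>metatile_shape\<close> or \<open>supertile_shape\<close>.\<close>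

definition is_tiling :: "(metatile \<Rightarrow> shape) \<Rightarrow> (metatile \<times> (complex \<Rightarrow> complex)) set \<Rightarrow> bool" where
  "is_tiling G M \<longleftrightarrow>
     (\<forall>(k, f)\<in>M. direct_isometry f) \<and>
     (\<Union>(k, f)\<in>M. f ` region (G k)) = UNIV \<and>
     (\<forall>(k, f)\<in>M. \<forall>(k', f')\<in>M. (k, f) \<noteq> (k', f') \<longrightarrow>
        interior (f ` region (G k)) \<inter> interior (f' ` region (G k')) = {})"

definition obeys_matching_rules ::
    "(metatile \<Rightarrow> shape) \<Rightarrow> (metatile \<times> (complex \<Rightarrow> complex)) set \<Rightarrow> bool" where
  "obeys_matching_rules G M \<longleftrightarrow>
     (\<forall>(k, f)\<in>M. \<forall>(vs, l)\<in>set (arcs (G k)).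
        \<exists>(k', f')\<in>M. (k', f') \<noteq> (k, f) \<and>
          (\<exists>(vs', l')\<in>set (arcs (G k')). f' ` polyline vs' = f ` polyline vs \<and> l' = opposite l))"

type_synonym figure = "complex set \<times> (complex set \<times> label) set"

definition figure_of :: "(metatile \<Rightarrow> shape) \<Rightarrow> metatile \<times> (complex \<Rightarrow> complex) \<Rightarrow> figure" where
  "figure_of G = (\<lambda>(k, f).
     (f ` region (G k), (\<lambda>(vs, l). (f ` polyline vs, l)) ` set (arcs (G k))))"

definition map_figure :: "(complex \<Rightarrow> complex) \<Rightarrow> figure \<Rightarrow> figure" where
  "map_figure g = (\<lambda>(A, B). (g ` A, (\<lambda>(C, l). (g ` C, l)) ` B))"

definition is_symmetry ::
    "(metatile \<Rightarrow> shape) \<Rightarrow> (metatile \<times> (complex \<Rightarrow> complex)) set \<Rightarrow> (complex \<Rightarrow> complex) \<Rightarrow> bool" where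
  "is_symmetry G M g \<longleftrightarrow> isometry g \<and> map_figure g ` figure_of G ` M = figure_of G ` M"

text \<open>The pieces of the placed supertile \<open>(k, h)\<close>.\<close>

definition group_of :: "metatile \<times> (complex \<Rightarrow> complex) \<Rightarrow> (piece \<times> (complex \<Rightarrow> complex)) set" where
  "group_of = (\<lambda>(k, h). (\<lambda>(q, f). (q, h \<circ> f)) ` supertile_pieces k)"

definition consecutive_labels_match :: "(metatile \<times> nat) list \<Rightarrow> bool" where
  "consecutive_labels_match cs \<longleftrightarrow>
     (\<forall>j<length cs.
        let (k, i) = cs ! j; (k', i') = cs ! (Suc j mod length cs) in
        snd (outgoing_arc (supertile_shape k') i') = opposite (snd (incoming_arc (supertile_shape k) i)))"

end

(* In coordinates with respect to e1, e2 every tile, half tile and supertile piece is a hexagon given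
   by integer bounds on x, y and x + y. Seen from the frame of one of its tiles, the part of the tiling
   reached by crossing segments lies on the lattice, because a segment determines the placement of the
   tile on its other side, and two distinct tiles cannot have overlapping hexagons. So the local
   structure is a finite search problem: crossing suitable segments and discarding overlaps, one finds
   that every piece lies in a group of pieces forming a supertile, and that across each arc of such a
   supertile lies the matching arc of another one; two groups sharing a piece overlap unless they are
   equal. The searches are recorded as certificates and replayed by a verified checker.

   The supertiles are therefore all placed supertiles whose pieces belong to the bisected tiling. This
   description is invariant under symmetries, and direct symmetries correspond because a labelled
   figure determines its placement. Reflections are excluded by the label pattern of H and by the
   shape of the A and B arcs of the supertiles. The angle sums agree because the change of angle at a
   marked point is a difference of two weights depending only on the adjacent labels. *)

theory Submission
  imports Defs
begin

text \<open>The rules say only that matching segments coincide as point sets, and tiles are placed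
  by arbitrary direct isometries. No common lattice for all of \<open>M\<close> is established: each
  argument pulls \<open>M\<close> back along the placement of one tile or supertile and looks only
  at the tiles on the lattice of that frame (\<open>local_tiles\<close>). The bounds are put on x, y
  and x + y because rotation by 60 degrees permutes these three up to sign, so that placing and
  comparing tiles is integer arithmetic. Not every tile that fits along a segment occurs in a
  tiling. Admitting all of them would feed hopeless cases into every later search, so they are
  removed beforehand by refutations that build on one another. Supertile arcs are given by a
  definite description; to evaluate it, exactly one boundary edge must leave each vertex of an arc
  before its end. A symmetry acts on figures, which forget the placement, and the figure of
  \<open>T_tile\<close> has a mirror symmetry. Hence a chiral tile must be exhibited before a
  symmetry of \<open>M\<close> is known to be direct.\<close>

section \<open>Integer data: placements, marked points, pieces and arcs\<close>

type_synonym placement = "nat \<times> int \<times> int"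
type_synonym tile = "metatile \<times> placement"

fun turn :: "nat \<Rightarrow> int \<times> int \<Rightarrow> int \<times> int" where
  "turn 0 p = p"
| "turn (Suc k) (x, y) = turn k (- y, x + y)"

fun move :: "placement \<Rightarrow> int \<times> int \<Rightarrow> int \<times> int" where
  "move (r, x, y) p = (case turn r p of (u, v) \<Rightarrow> (u + x, v + y))"

text \<open>The rotation number is kept below 6, so that a placement is determined by the map it
  describes (\<open>placed_inj\<close>) and equality of placed tiles can be decided on the
  data.\<close>

fun composite :: "placement \<Rightarrow> placement \<Rightarrow> placement" where
  "composite (r, x, y) (s, p) = (if r + s < 6 then r + s else r + s - 6, move (r, x, y) p)"

fun mark_list :: "metatile \<Rightarrow> ((int \<times> int) \<times> label) list" where
  "mark_list T_tile =
    [((0, 0), A_minus), ((3, 0), A_minus), ((0, 3), B_plus)]"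
| "mark_list H_tile =
    [((0, 0), X_plus), ((1, -1), B_minus), ((4, -1), X_minus), ((5, -1), X_plus), ((5, 0),
    B_minus), ((2, 3), X_minus), ((1, 4), X_plus), ((0, 4), A_plus), ((0, 1), X_minus)]"
| "mark_list P_tile =
    [((0, 0), L_label), ((1, -1), X_minus), ((2, -2), X_plus), ((3, -2), A_minus), ((6, -2),
    L_label), ((5, -1), X_minus), ((4, 0), X_plus), ((3, 0), B_plus)]"
| "mark_list F_tile =
    [((0, 0), L_label), ((1, -1), X_minus), ((2, -2), X_plus), ((3, -2), L_label), ((4, -2),
    X_minus), ((5, -2), F_plus), ((5, -1), F_minus), ((4, 0), X_plus), ((3, 0), B_plus)]"

fun piece_list :: "metatile \<Rightarrow> (piece \<times> placement) list" where
  "piece_list T_tile =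
    [(H_piece, 0, 0, 0), (P_lower, 1, -2, 0), (P_upper, 2, 5, 0), (P_upper, 0, 1, -1)]"
| "piece_list H_tile =
    [(T_piece, 0, 0, 0), (H_piece, 5, -1, 0), (H_piece, 1, 4, -1), (H_piece, 1, -1, 0), (P_upper,
    1, 4, -5), (P_upper, 3, 4, 4), (P_lower, 2, -1, -2), (F_upper, 1, 5, -1), (F_lower, 5, 2, 8),
    (F_upper, 3, -1, 5), (F_lower, 1, -7, 2), (F_upper, 5, -1, -1), (F_lower, 3, 8, -7)]"
| "piece_list P_tile =
    [(H_piece, 0, 0, 0), (P_upper, 1, -2, 0), (P_lower, 1, -2, 0), (F_upper, 2, 5, 0), (P_upper,
    0, 1, -1), (F_lower, 0, -4, 6), (F_lower, 3, 2, -2), (F_upper, 5, -7, 4), (H_piece, 5, -7, 5),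
    (P_lower, 0, -9, 7)]"
| "piece_list F_tile =
    [(H_piece, 0, 0, 0), (P_upper, 1, -2, 0), (P_lower, 1, -2, 0), (F_upper, 2, 5, 0), (F_upper,
    0, 1, -1), (F_lower, 4, 7, 2), (F_lower, 0, -4, 6), (F_lower, 3, 2, -2), (F_upper, 5, -7, 4),
    (H_piece, 5, -7, 5), (P_lower, 0, -9, 7)]"

text \<open>The vertices are supplied as data; \<open>check_boundary\<close> confirms that they are
  the paths selected by \<open>boundary_path\<close>.\<close>

fun arc_list :: "metatile \<Rightarrow> ((int \<times> int) list \<times> label) list" where
  "arc_list T_tile =
    [([(1, -1), (2, -2), (3, -2), (4, -2), (5, -2), (6, -2), (5, -1), (5, 0)], A_minus), ([(5, 0),
    (5, 1), (4, 2), (3, 3), (2, 4), (1, 5), (1, 4), (0, 4)], A_minus), ([(0, 4), (-1, 4), (-1, 3),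
    (-1, 2), (-1, 1), (-1, 0), (0, 0), (1, -1)], B_plus)]"
| "arc_list H_tile =
    [([(-6, 2), (-5, 2), (-5, 3), (-4, 2), (-3, 1), (-2, 0), (-1, -1), (-1, -2)], A_plus), ([(-1,
    -2), (0, -3), (1, -4), (2, -5), (3, -6)], X_minus), ([(3, -6), (4, -6), (5, -6), (6, -6), (7,
    -6)], X_plus), ([(7, -6), (6, -5), (5, -5), (5, -4), (5, -3), (5, -2), (5, -1), (6, -1)],
    B_minus), ([(6, -1), (6, 0), (6, 1), (6, 2), (6, 3)], X_minus), ([(6, 3), (5, 4), (4, 5), (3,
    6), (2, 7)], X_plus), ([(2, 7), (2, 6), (3, 5), (2, 5), (1, 5), (0, 5), (-1, 5), (-2, 6)],
    B_minus), ([(-2, 6), (-3, 6), (-4, 6), (-5, 6), (-6, 6)], X_minus), ([(-6, 6), (-6, 5), (-6,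
    4), (-6, 3), (-6, 2)], X_plus)]"
| "arc_list P_tile =
    [([(-7, 4), (-7, 3)], L_label), ([(-7, 3), (-6, 2), (-5, 1), (-4, 0), (-3, -1)], X_minus),
    ([(-3, -1), (-2, -1), (-1, -1), (0, -1), (1, -1)], X_plus), ([(1, -1), (2, -2), (3, -2), (4,
    -2), (5, -2), (6, -2), (5, -1), (5, 0)], A_minus), ([(5, 0), (5, 1)], L_label), ([(5, 1), (4,
    2), (3, 3), (2, 4), (1, 5)], X_minus), ([(1, 5), (0, 5), (-1, 5), (-2, 5), (-3, 5)], X_plus),
    ([(-3, 5), (-4, 6), (-5, 6), (-6, 6), (-7, 6), (-8, 6), (-7, 5), (-7, 4)], B_plus)]"
| "arc_list F_tile =
    [([(-7, 4), (-7, 3)], L_label), ([(-7, 3), (-6, 2), (-5, 1), (-4, 0), (-3, -1)], X_minus),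
    ([(-3, -1), (-2, -1), (-1, -1), (0, -1), (1, -1)], X_plus), ([(1, -1), (2, -2)], L_label),
    ([(2, -2), (3, -2), (4, -2), (5, -2), (6, -2)], X_minus), ([(6, -2), (6, -1), (6, 0), (6, 1),
    (6, 2), (5, 2)], F_plus), ([(5, 2), (5, 1), (4, 2), (3, 3), (2, 4), (1, 5)], F_minus), ([(1,
    5), (0, 5), (-1, 5), (-2, 5), (-3, 5)], X_plus), ([(-3, 5), (-4, 6), (-5, 6), (-6, 6), (-7,
    6), (-8, 6), (-7, 5), (-7, 4)], B_plus)]"

fun tile_of :: "piece \<Rightarrow> metatile" where
  "tile_of T_piece = T_tile"
| "tile_of H_piece = H_tile"
| "tile_of P_upper = P_tile"
| "tile_of P_lower = P_tile"
| "tile_of F_upper = F_tile"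
| "tile_of F_lower = F_tile"

text \<open>A half belongs to the bisected tiling exactly when its whole metatile belongs to the
  tiling. So the presence of a group can be tested on whole tiles, and the searches never handle
  halves.\<close>

definition group_tiles :: "tile \<Rightarrow> tile list" where
  "group_tiles = (\<lambda>(k, a). map (\<lambda>(q, b). (tile_of q, composite a b)) (piece_list k))"

section \<open>Integer hexagons and their overlap\<close>

type_synonym hexagon = "int \<times> int \<times> int \<times> int \<times> int \<times> int"

text \<open>The numbers are alternately lower and upper bounds of the coordinates \<open>x\<close>, \<open>y\<close> and \<open>x + y\<close>.\<close>

fun tile_hexagon :: "metatile \<Rightarrow> hexagon" where
  "tile_hexagon T_tile = (0, 3, 0, 3, 0, 3)"
| "tile_hexagon H_tile = (0, 5, -1, 4, 0, 5)"
| "tile_hexagon P_tile = (0, 6, -2, 0, 0, 4)"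
| "tile_hexagon F_tile = (0, 5, -2, 0, 0, 4)"

fun piece_hexagon :: "piece \<Rightarrow> hexagon" where
  "piece_hexagon T_piece = (0, 3, 0, 3, 0, 3)"
| "piece_hexagon H_piece = (0, 5, -1, 4, 0, 5)"
| "piece_hexagon P_upper = (0, 6, -1, 0, 0, 4)"
| "piece_hexagon P_lower = (0, 6, -2, -1, 0, 4)"
| "piece_hexagon F_upper = (0, 5, -1, 0, 0, 4)"
| "piece_hexagon F_lower = (0, 5, -2, -1, 0, 4)"

text \<open>Rotation by 60 degrees turns the coordinates x, y, x + y into -y, x + y, x, so a hexagon
  stays a hexagon and its bounds are permuted, one pair with a change of sign.\<close>

fun turn_hexagon :: "nat \<Rightarrow> hexagon \<Rightarrow> hexagon" where
  "turn_hexagon 0 b = b"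
| "turn_hexagon (Suc k) (a, a', b, b', c, c') = turn_hexagon k (- b', - b, c, c', a, a')"

fun move_hexagon :: "placement \<Rightarrow> hexagon \<Rightarrow> hexagon" where
  "move_hexagon (r, x, y) h = (case turn_hexagon r h of (a, a', b, b', c, c') \<Rightarrow>
     (a + x, a' + x, b + y, b' + y, c + (x + y), c' + (x + y)))"

text \<open>Beyond the three interval conditions, some value of x + y must agree both with its own
  bounds and with those of x and y; the last two inequalities express this. All are strict, so tiles
  that merely touch do not overlap.\<close>

fun overlap :: "hexagon \<Rightarrow> hexagon \<Rightarrow> bool" where
  "overlap (a1, a2, b1, b2, c1, c2) (a1', a2', b1', b2', c1', c2') =
     (let p = max a1 a1'; p' = min a2 a2'; q = max b1 b1'; q' = min b2 b2';
          r = max c1 c1'; r' = min c2 c2'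
      in p < p' \<and> q < q' \<and> r < r' \<and> p + q < r' \<and> r < p' + q')"

definition clash :: "tile \<Rightarrow> tile \<Rightarrow> bool" where
  "clash = (\<lambda>(k, a) (l, b). (k, a) \<noteq> (l, b) \<and>
     overlap (move_hexagon a (tile_hexagon k)) (move_hexagon b (tile_hexagon l)))"

section \<open>Certificates for case analyses on neighbourhoods\<close>

text \<open>A configuration is the list of the tiles known to be present, the most recent one first.
  \<open>Split n i\<close> distinguishes the possible neighbours of tile number \<open>n\<close> across its segment \<open>i\<close>.
  \<open>Clash n\<close> refutes the newest tile by its overlap with tile \<open>n\<close>, and \<open>Dead n i m\<close> refutes the
  configuration because every possible neighbour of tile \<open>n\<close> across segment \<open>i\<close> overlaps tile \<open>m\<close>.
  \<open>Leaf s\<close> names a supertile all of whose tiles are present.\<close>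

datatype certificate =
  Leaf tile | Clash nat | Dead nat nat nat | Split nat nat "certificate list"

definition neighbours_of :: "(metatile \<Rightarrow> nat \<Rightarrow> tile list) \<Rightarrow> tile \<Rightarrow> nat \<Rightarrow> tile list" where
  "neighbours_of A t i = (case t of (k, a) \<Rightarrow> map (\<lambda>(l, b). (l, composite a b)) (A k i))"

definition is_side :: "tile list \<Rightarrow> nat \<Rightarrow> nat \<Rightarrow> bool" where
  "is_side C n i \<longleftrightarrow> n < length C \<and> i < length (mark_list (fst (C ! n)))"

text \<open>The predicate \<open>g\<close> decides which supertiles are acceptable at a leaf. With a
  constantly false \<open>g\<close> no leaf is acceptable and the certificate becomes a
  refutation.\<close>

fun check :: "(metatile \<Rightarrow> nat \<Rightarrow> tile list) \<Rightarrow> (tile \<Rightarrow> bool) \<Rightarrow> tile list \<Rightarrow> certificate \<Rightarrow> bool"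
  and check_all :: "(metatile \<Rightarrow> nat \<Rightarrow> tile list) \<Rightarrow> (tile \<Rightarrow> bool) \<Rightarrow> tile list \<Rightarrow> tile list \<Rightarrow>
    certificate list \<Rightarrow> bool" where
  "check A g C (Leaf s) \<longleftrightarrow> g s \<and> list_all (\<lambda>t. List.member C t) (group_tiles s)"
| "check A g C (Clash n) \<longleftrightarrow> n < length C \<and> clash (hd C) (C ! n)"
| "check A g C (Dead n i m) \<longleftrightarrow> is_side C n i \<and> m < length C \<and>
     list_all (\<lambda>u. clash u (C ! m)) (neighbours_of A (C ! n) i)"
| "check A g C (Split n i cs) \<longleftrightarrow> is_side C n i \<and> check_all A g C (neighbours_of A (C ! n) i) cs"
| "check_all A g C [] cs \<longleftrightarrow> True"
| "check_all A g C (u # us) (c # cs) \<longleftrightarrow> check A g (u # C) c \<and> check_all A g C us cs"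
| "check_all A g C (u # us) [] \<longleftrightarrow> False"

text \<open>The interface between geometry and search: soundness of certificates uses nothing else
  about the tiling.\<close>

definition consistent :: "(metatile \<Rightarrow> nat \<Rightarrow> tile list) \<Rightarrow> tile set \<Rightarrow> bool" where
  "consistent A N \<longleftrightarrow>
     (\<forall>t\<in>N. \<forall>i<length (mark_list (fst t)). \<exists>u\<in>set (neighbours_of A t i). u \<in> N) \<and>
     (\<forall>t\<in>N. \<forall>u\<in>N. \<not> clash t u)"

lemma consistent_neighbour:
  assumes "consistent A N" "t \<in> N" "i < length (mark_list (fst t))"
  obtains u where "u \<in> set (neighbours_of A t i)" "u \<in> N"
  using assms unfolding consistent_def by blast

lemma consistent_no_clash: "consistent A N \<Longrightarrow> t \<in> N \<Longrightarrow> u \<in> N \<Longrightarrow> \<not> clash t u"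
  unfolding consistent_def by blast

text \<open>At every split some listed neighbour really belongs to \<open>N\<close>, and following
  it keeps the configuration inside \<open>N\<close>. Such a branch can end neither in a clash nor
  at a dead segment, so it ends at an accepted leaf.\<close>

lemma check_sound:
  shows "consistent A N \<Longrightarrow> set C \<subseteq> N \<Longrightarrow> check A g C c \<Longrightarrow> \<exists>s. g s \<and> set (group_tiles s) \<subseteq> N"
    and "consistent A N \<Longrightarrow> set C \<subseteq> N \<Longrightarrow> check_all A g C us cs \<Longrightarrow> \<exists>u\<in>set us. u \<in> N \<Longrightarrow>
      \<exists>s. g s \<and> set (group_tiles s) \<subseteq> N"
proof (induction A g C c and A g C us cs rule: check_check_all.induct)
  case (1 A g C s)
  then have "set (group_tiles s) \<subseteq> N" by (auto simp: list_all_iff)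
  then show ?case using 1 by (meson check.simps(1))
next
  case (2 A g C n)
  then have "C \<noteq> []" by auto
  then have "hd C \<in> N" "C ! n \<in> N" using 2 by auto
  then show ?case using 2 consistent_no_clash[OF 2(1)] by simp
next
  case (3 A g C n i m)
  then have "is_side C n i" "C ! n \<in> N" "C ! m \<in> N" by (auto simp: is_side_def)
  then obtain u where u: "u \<in> set (neighbours_of A (C ! n) i)" "u \<in> N"
    using consistent_neighbour[OF 3(1)] unfolding is_side_def by metis
  then have "\<not> clash u (C ! m)"
    using consistent_no_clash[OF 3(1)] \<open>C ! m \<in> N\<close> by blast
  then show ?case using 3(3) u unfolding check.simps list_all_iff by blast
next
  case (4 A g C n i cs)
  then have "is_side C n i" "C ! n \<in> N" by (auto simp: is_side_def)
  then have "\<exists>u\<in>set (neighbours_of A (C ! n) i). u \<in> N"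
    using consistent_neighbour[OF 4(2)] unfolding is_side_def by metis
  then show ?case using 4 by simp
next
  case (6 A g C u us c cs)
  show ?case
  proof (cases "u \<in> N")
    case True
    then show ?thesis using 6 by simp
  next
    case False
    then show ?thesis using 6 by simp
  qed
qed simp_all

section \<open>Possible neighbours\<close>

text \<open>Entry \<open>i\<close> lists the placements, relative to a standard tile, of the tiles that can lie across its
  segment \<open>i\<close>. Further candidates fit along the segment; they are refuted one by one below.\<close>

fun neighbour_table :: "metatile \<Rightarrow> tile list list" where
  "neighbour_table T_tile =
    [[(H_tile, 5, -1, 0)], [(H_tile, 1, 4, -1)], [(H_tile, 1, -1, 0)]]"
| "neighbour_table H_tile =
    [[(H_tile, 4, 0, 0), (P_tile, 3, 2, -2), (P_tile, 0, -4, 0), (F_tile, 3, 2, -2)], [(T_tile, 5,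
    1, -1), (P_tile, 0, 1, -1), (F_tile, 0, 1, -1)], [(H_tile, 0, 4, -5), (P_tile, 0, 1, -1),
    (F_tile, 0, 1, -1)], [(P_tile, 2, 9, -5), (F_tile, 5, 5, 1), (F_tile, 4, 7, 2)], [(P_tile, 2,
    5, 0), (F_tile, 2, 5, 0)], [(P_tile, 2, 5, 0), (F_tile, 2, 5, 0)], [(H_tile, 0, -4, 5),
    (H_tile, 2, 1, 4), (F_tile, 1, -1, 4), (F_tile, 0, -4, 6)], [(T_tile, 1, 0, 1), (T_tile, 5,
    -3, 4), (P_tile, 1, -2, 0)], [(H_tile, 2, 0, 0), (H_tile, 4, -4, 5), (P_tile, 1, -2, 0)]]"
| "neighbour_table P_tile =
    [[(F_tile, 3, 1, -1), (F_tile, 2, 2, -4)], [(H_tile, 3, 2, -2), (F_tile, 2, 2, -4)], [(H_tile,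
    5, 2, -2)], [(H_tile, 5, 2, -2)], [(F_tile, 0, 5, -1), (F_tile, 5, 4, 2)], [(H_tile, 0, 4, 0),
    (H_tile, 4, 5, 4), (F_tile, 5, 4, 2)], [(H_tile, 0, -1, 1), (H_tile, 4, 0, 5)], [(H_tile, 0,
    -1, 1), (H_tile, 4, 0, 5)]]"
| "neighbour_table F_tile =
    [[(P_tile, 3, 1, -1), (P_tile, 0, -5, 1), (F_tile, 3, 1, -1), (F_tile, 2, 2, -4)], [(H_tile,
    3, 2, -2), (H_tile, 1, 1, -6), (H_tile, 5, -3, -1), (F_tile, 2, 2, -4)], [(P_tile, 4, 4, -2),
    (P_tile, 1, 2, -6), (F_tile, 4, 4, -2)], [(P_tile, 4, 4, -2), (P_tile, 1, 2, -6), (F_tile, 4,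
    4, -2)], [(H_tile, 2, 9, -7), (H_tile, 0, 4, -6)], [(F_tile, 2, 9, -6)], [(F_tile, 4, 6, 3)],
    [(H_tile, 0, -1, 1), (H_tile, 4, 0, 5)], [(H_tile, 0, -1, 1), (H_tile, 4, 0, 5)]]"

definition neighbours :: "metatile \<Rightarrow> nat \<Rightarrow> tile list" where
  "neighbours k i = neighbour_table k ! i"

text \<open>The order matters: while an entry is being refuted, it and the entries after it still
  count as possible neighbours, whereas those before it are already gone. The deepest case tree
  therefore stands last.\<close>

definition excluded_neighbours :: "(metatile \<times> nat \<times> tile \<times> certificate) list" where
  "excluded_neighbours =
    [(H_tile, 0, (H_tile, 2, 4, -5), Split 1 1 [Dead 0 0 1, Dead 0 3 1, Dead 0 3 1]), (H_tile, 0,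
    (H_tile, 0, -1, -4), Split 1 1 [Dead 0 0 1, Dead 0 3 1, Dead 0 3 1]), (H_tile, 0, (F_tile, 2,
    3, -5), Split 1 7 [Dead 1 5 0, Dead 1 5 0, Dead 0 1 1]), (H_tile, 2, (H_tile, 4, 5, -1), Dead
    0 0 1), (H_tile, 2, (H_tile, 2, 9, -6), Split 1 1 [Dead 0 1 1, Clash 1, Clash 1]), (H_tile, 2,
    (P_tile, 3, 7, -3), Dead 0 3 1), (H_tile, 2, (F_tile, 3, 7, -3), Dead 0 5 1), (H_tile, 3,
    (H_tile, 4, 6, 3), Dead 0 2 1), (H_tile, 3, (H_tile, 2, 10, -2), Split 1 4 [Dead 0 3 1, Dead 0
    3 1, Dead 0 0 1]), (H_tile, 3, (P_tile, 5, 5, 1), Split 1 2 [Dead 0 4 1, Dead 0 4 1, Dead 0 6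
    1]), (H_tile, 5, (H_tile, 0, 1, 4), Dead 0 0 1), (H_tile, 5, (H_tile, 4, 2, 8), Dead 0 3 1),
    (H_tile, 5, (P_tile, 5, 1, 6), Dead 0 3 1), (H_tile, 5, (F_tile, 5, 1, 6), Dead 0 5 1),
    (H_tile, 6, (P_tile, 1, -1, 4), Split 1 5 [Dead 0 4 1, Dead 0 6 1, Dead 0 5 1]), (H_tile, 8,
    (P_tile, 4, 0, 4), Dead 0 7 1), (H_tile, 8, (F_tile, 1, -2, 0), Dead 0 5 1), (H_tile, 8,
    (F_tile, 4, 0, 4), Dead 0 8 1), (P_tile, 0, (P_tile, 0, -5, 1), Split 1 1 [Dead 0 2 1, Clash
    1, Dead 0 3 2, Dead 0 6 2, Dead 0 3 2, Dead 0 7 2, Dead 0 8 2]), (P_tile, 1, (H_tile, 1, 1,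
    -6), Dead 0 3 1), (P_tile, 1, (H_tile, 5, -3, -1), Dead 0 6 1), (P_tile, 1, (P_tile, 2, 2,
    -4), Dead 0 3 1), (P_tile, 1, (P_tile, 5, -2, 2), Dead 0 7 1), (P_tile, 1, (F_tile, 5, -2, 2),
    Dead 0 8 1), (P_tile, 2, (H_tile, 3, 7, -3), Dead 0 2 1), (P_tile, 2, (H_tile, 1, 6, -7), Dead
    0 5 1), (P_tile, 2, (P_tile, 4, 4, -2), Dead 0 1 1), (P_tile, 2, (P_tile, 1, 2, -6), Dead 0 4
    1), (P_tile, 2, (F_tile, 4, 4, -2), Dead 0 0 1), (P_tile, 2, (F_tile, 3, 7, -4), Dead 0 3 1),
    (P_tile, 4, (P_tile, 0, 5, -1), Dead 0 0 1), (P_tile, 5, (P_tile, 5, 4, 2), Dead 0 3 1),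
    (P_tile, 5, (P_tile, 2, 8, -4), Dead 0 7 1), (P_tile, 5, (F_tile, 2, 8, -4), Dead 0 8 1),
    (P_tile, 6, (H_tile, 2, 4, 0), Dead 0 8 1), (P_tile, 6, (P_tile, 1, 2, 0), Dead 0 1 1),
    (P_tile, 6, (P_tile, 4, 4, 4), Dead 0 5 1), (P_tile, 6, (F_tile, 1, 2, 0), Dead 0 0 1),
    (P_tile, 6, (F_tile, 0, -1, 2), Dead 0 3 1), (F_tile, 1, (P_tile, 2, 2, -4), Dead 0 3 1),
    (F_tile, 1, (P_tile, 5, -2, 2), Dead 0 7 1), (F_tile, 1, (F_tile, 5, -2, 2), Dead 0 8 1),
    (F_tile, 2, (H_tile, 3, 7, -3), Dead 0 2 1), (F_tile, 2, (H_tile, 1, 6, -7), Dead 0 5 1),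
    (F_tile, 2, (H_tile, 5, 2, -2), Dead 0 8 1), (F_tile, 2, (F_tile, 3, 7, -4), Split 1 0 [Dead 1
    5 0, Dead 1 5 0, Dead 1 5 0, Dead 0 1 1]), (F_tile, 3, (F_tile, 3, 7, -4), Dead 0 2 1),
    (F_tile, 4, (H_tile, 4, 5, -2), Dead 0 0 1), (F_tile, 4, (P_tile, 3, 7, -4), Dead 0 3 1),
    (F_tile, 4, (P_tile, 0, 1, -2), Dead 0 7 1), (F_tile, 4, (F_tile, 3, 7, -4), Dead 0 3 1),
    (F_tile, 4, (F_tile, 0, 1, -2), Dead 0 8 1), (F_tile, 7, (H_tile, 2, 4, 0), Dead 0 8 1),
    (F_tile, 7, (P_tile, 1, 2, 0), Dead 0 1 1), (F_tile, 7, (P_tile, 4, 4, 4), Dead 0 5 1),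
    (F_tile, 7, (F_tile, 1, 2, 0), Dead 0 1 1), (F_tile, 7, (F_tile, 0, -1, 2), Dead 0 4 1),
    (T_tile, 2, (H_tile, 5, -5, 5), Split 1 0 [Split 1 2 [Dead 0 5 1, Split 0 2 [Split 1 1 [Split
    3 1 [Dead 0 0 3, Dead 0 0 3, Split 2 1 [Split 3 4 [Split 4 3 [Dead 0 4 1, Dead 0 4 4, Dead 0 5
    2, Dead 3 4 0], Dead 0 6 6, Dead 2 4 0], Dead 0 3 2, Dead 0 3 2]], Dead 0 4 4]], Dead 0 6
    1]]), (H_tile, 3, (H_tile, 0, 5, -1), Split 1 4 [Dead 0 3 1, Dead 0 3 1, Dead 0 2 2]),
    (H_tile, 4, (T_tile, 1, 5, 0), Dead 0 2 1), (H_tile, 5, (H_tile, 2, 6, 3), Dead 1 4 0),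
    (H_tile, 6, (H_tile, 4, -3, 9), Dead 0 5 1), (H_tile, 6, (P_tile, 4, 1, 8), Split 1 4 [Dead 0
    5 1, Dead 0 6 1]), (H_tile, 8, (H_tile, 0, -5, 1), Dead 0 3 1), (P_tile, 4, (P_tile, 3, 11,
    -3), Split 1 2 [Dead 0 6 1]), (P_tile, 5, (H_tile, 2, 9, -1), Dead 0 6 1), (P_tile, 0,
    (P_tile, 3, 1, -1), Split 1 1 [Split 2 2 [Split 2 5 [Dead 0 8 2, Dead 0 2 2, Split 2 7 [Split
    3 6 [Dead 0 0 3, Split 4 4 [Split 3 7 [Split 1 2 [Split 1 7 [Split 1 4 [Split 2 3 [Dead 0 4 1,
    Dead 0 4 4, Dead 0 5 2], Dead 0 6 5], Dead 0 0 1, Dead 0 1 3]], Dead 0 3 1], Dead 0 6 1], Dead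
    0 0 1, Dead 0 3 3], Dead 0 0 2, Dead 0 1 5]]], Clash 1])]"

definition with_excluded ::
    "(metatile \<times> nat \<times> tile \<times> certificate) list \<Rightarrow> metatile \<Rightarrow> nat \<Rightarrow> tile list" where
  "with_excluded es k i =
     neighbours k i @ concat (map (\<lambda>(l, j, u, c). if l = k \<and> j = i then [u] else []) es)"

fun check_excluded :: "(metatile \<times> nat \<times> tile \<times> certificate) list \<Rightarrow> bool" where
  "check_excluded [] \<longleftrightarrow> True"
| "check_excluded ((k, i, u, c) # es) \<longleftrightarrow>
     check (with_excluded ((k, i, u, c) # es)) (\<lambda>_. False) [u, (k, 0, 0, 0)] c \<and>
     check_excluded es"

lemma check_excluded_neighbours: "check_excluded excluded_neighbours"
  by code_simp

section \<open>Supertiles\<close>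

text \<open>With the given piece in standard position, the placement of its supertile must undo the
  placement of the piece inside the supertile.\<close>

definition covers :: "piece \<Rightarrow> tile \<Rightarrow> bool" where
  "covers q = (\<lambda>(k, a). list_ex (\<lambda>(q', b). q' = q \<and> composite a b = (0, 0, 0)) (piece_list k))"

text \<open>Counterclockwise boundaries run along a common arc in opposite directions, hence
  \<open>rev\<close>. Agreement of the vertex lists is enough for agreement of the point
  sets.\<close>

definition meets_arc :: "metatile \<Rightarrow> nat \<Rightarrow> tile \<Rightarrow> bool" where
  "meets_arc k j = (\<lambda>(l, a). (l, a) \<noteq> (k, 0, 0, 0) \<and> fst a < 6 \<and>
     (case arc_list k ! j of (p, z) \<Rightarrow>
       list_ex (\<lambda>(p', z'). z' = opposite z \<and> map (move a) p' = rev p) (arc_list l)))"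

fun cover_certificate :: "piece \<Rightarrow> certificate" where
  "cover_certificate T_piece =
    Split 0 1 [Split 1 2 [Split 1 4 [Split 3 0 [Split 3 0 [Dead 0 0 1, Dead 0 3 1, Split 4 1 [Dead
    0 0 1, Dead 0 0 1, Split 4 4 [Dead 0 0 4, Split 6 3 [Dead 0 4 5, Dead 0 3 2, Split 6 6 [Dead 0
    3 2, Dead 0 0 2, Dead 0 3 2, Split 7 7 [Dead 0 1 1, Dead 0 2 1, Split 6 1 [Dead 0 0 1, Dead 0
    0 1, Split 7 3 [Dead 0 4 7, Dead 0 3 1, Leaf (H_tile, 0, 0, 0)]]]]]]], Dead 0 4 5]], Dead 0 6
    1]]]"
| "cover_certificate H_piece =
    Split 0 4 [Split 0 2 [Split 2 3 [Dead 0 4 2, Split 3 1 [Dead 1 4 0, Split 4 0 [Dead 2 4 0,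
    Dead 0 0 1, Dead 0 4 1, Split 5 7 [Dead 1 4 0, Dead 1 4 0, Leaf (T_tile, 0, 0, 0)]], Dead 0 6
    1], Split 3 1 [Dead 1 5 0, Dead 0 5 1, Split 3 4 [Split 0 6 [Split 6 6 [Split 7 7 [Dead 0 1 1,
    Split 8 8 [Dead 0 2 2, Split 9 0 [Dead 0 7 6, Dead 0 3 1, Split 4 2 [Dead 0 7 4, Split 2 1
    [Dead 0 0 1, Dead 0 0 1, Split 3 3 [Dead 0 4 3, Dead 0 3 1, Leaf (H_tile, 5, -3, 4)]], Dead 0
    8 4], Dead 0 4 3], Dead 0 7 2], Dead 0 7 1], Split 7 7 [Split 8 8 [Split 9 0 [Dead 0 7 6,
    Split 4 2 [Split 2 4 [Dead 0 0 1, Split 3 6 [Dead 0 1 3, Dead 0 7 3, Dead 0 3 1, Leaf (H_tile,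
    1, 0, 1)]], Dead 0 3 4, Dead 0 6 2], Dead 0 7 1, Dead 0 4 3], Dead 0 7 1, Dead 0 7 2], Dead 0
    2 1, Dead 0 7 1], Clash 2, Dead 0 6 6]], Split 5 7 [Dead 0 1 1, Dead 0 2 1, Split 4 4 [Dead 0
    5 2, Split 5 1 [Dead 0 0 5, Leaf (P_tile, 1, 5, 2), Split 6 3 [Dead 0 7 1, Dead 0 3 1, Leaf
    (F_tile, 1, 5, 2)]]]]]]]], Split 1 6 [Dead 0 3 1, Dead 0 0 1, Dead 0 3 1, Split 2 7 [Dead 0 1
    1, Dead 0 2 1, Split 3 0 [Split 4 1 [Split 5 3 [Split 6 2 [Split 4 0 [Split 4 4 [Split 2 1
    [Dead 0 0 1, Dead 0 0 1, Split 4 0 [Dead 0 3 1, Split 7 3 [Dead 0 7 4, Dead 0 3 4, Leaf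
    (H_tile, 5, 1, -1)]]], Dead 0 6 2], Clash 4], Dead 0 3 3, Dead 0 3 3], Dead 0 4 2, Dead 0 5
    1], Dead 0 3 1, Dead 0 3 1], Dead 0 3 1, Dead 0 7 1, Split 2 1 [Dead 0 8 2, Dead 0 0 1, Split
    3 0 [Dead 0 7 1, Split 2 5 [Split 7 1 [Dead 0 0 4, Leaf (P_tile, 0, 0, 0), Split 8 3 [Dead 0 7
    1, Dead 0 3 1, Leaf (F_tile, 0, 0, 0)]]], Dead 0 8 1, Dead 0 1 3], Dead 0 1 2]]]]]"
| "cover_certificate P_upper =
    Split 0 2 [Split 1 6 [Split 2 0 [Split 1 7 [Dead 1 4 0, Dead 1 4 0, Split 1 4 [Split 2 5
    [Split 4 4 [Leaf (T_tile, 0, -1, 1), Split 5 6 [Dead 5 4 0, Dead 5 4 0, Dead 0 3 1, Split 3 7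
    [Dead 0 1 1, Dead 0 2 1, Leaf (P_tile, 0, -1, 1)]]]], Dead 0 8 1]], Dead 0 4 1], Split 2 0
    [Split 1 1 [Dead 1 4 0, Split 4 1 [Split 4 1 [Split 5 3 [Split 6 4 [Dead 0 0 1, Split 8 4
    [Dead 0 3 1, Split 7 7 [Dead 0 1 1, Dead 0 2 1, Leaf (T_tile, 4, 0, 5)]]], Dead 0 4 2, Dead 0
    5 1], Dead 0 3 1, Dead 0 3 1], Clash 2], Dead 0 6 1], Split 1 1 [Dead 1 5 0, Dead 0 5 1, Split
    4 4 [Split 0 6 [Split 6 5 [Split 5 7 [Split 6 8 [Split 7 0 [Dead 0 7 6, Split 4 2 [Split 2 4
    [Dead 0 0 1, Split 3 6 [Dead 0 1 3, Dead 0 7 3, Dead 0 3 1, Leaf (H_tile, 5, 1, 4)]], Dead 0 3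
    4, Dead 0 6 2], Dead 0 7 1, Dead 0 4 3], Dead 0 7 1, Dead 0 7 2], Dead 0 2 1, Dead 0 7 1],
    Split 5 7 [Dead 0 1 1, Split 2 2 [Dead 0 7 2, Split 7 8 [Dead 0 2 3, Split 8 0 [Dead 0 7 7,
    Dead 0 3 1, Split 2 0 [Split 2 3 [Dead 0 4 2, Dead 0 3 1, Leaf (H_tile, 3, 4, 4)], Dead 0 0
    4], Dead 0 4 4], Dead 0 7 3], Dead 0 8 2], Dead 0 7 1], Clash 2]], Split 4 4 [Dead 0 5 1,
    Split 4 7 [Dead 0 1 2, Dead 0 2 2, Split 6 1 [Dead 0 0 5, Leaf (P_tile, 5, 2, -2), Split 7 3
    [Dead 0 7 1, Dead 0 3 1, Leaf (F_tile, 5, 2, -2)]]]]]]]]]"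
| "cover_certificate P_lower =
    Split 0 2 [Split 1 6 [Split 2 5 [Dead 0 8 1, Dead 0 2 1, Split 3 0 [Split 3 4 [Dead 0 5 2,
    Split 5 1 [Split 5 1 [Split 6 3 [Split 7 2 [Split 3 4 [Split 6 6 [Split 2 1 [Dead 0 0 2, Dead
    0 0 2, Split 4 0 [Dead 0 3 1, Leaf (H_tile, 4, 2, -3)]]], Dead 0 6 1], Dead 0 3 3, Dead 0 3
    3], Dead 0 4 2, Dead 0 5 1], Dead 0 3 1, Dead 0 3 1], Dead 0 4 4]], Dead 0 4 2]], Split 2 0
    [Split 3 1 [Split 3 1 [Split 4 3 [Split 5 4 [Dead 0 0 1, Split 7 4 [Dead 0 3 1, Split 7 2
    [Split 5 4 [Split 7 6 [Split 2 1 [Dead 0 0 2, Dead 0 0 2, Split 6 0 [Dead 0 3 1, Leaf (H_tile,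
    4, 2, -3)]]], Dead 0 6 1], Dead 0 3 5, Dead 0 3 5]]], Dead 0 4 2, Dead 0 5 1], Dead 0 3 1,
    Dead 0 3 1], Clash 1], Split 1 1 [Dead 1 5 0, Dead 0 5 1, Split 4 4 [Split 4 4 [Split 1 4
    [Dead 0 5 1, Split 2 5 [Split 7 1 [Dead 0 0 6, Leaf (T_tile, 5, 2, -2), Split 8 3 [Dead 0 4 4,
    Dead 0 3 1, Split 3 1 [Dead 0 0 1, Leaf (P_tile, 0, 9, -7), Split 4 3 [Dead 0 7 1, Dead 0 3 1,
    Leaf (F_tile, 0, 9, -7)]]]]]], Dead 0 6 1], Split 4 4 [Dead 0 5 1, Split 4 7 [Dead 0 1 2, Dead
    0 2 2, Split 6 1 [Dead 0 0 5, Leaf (P_tile, 5, 2, -2), Split 7 3 [Dead 0 7 1, Dead 0 3 1, Leaf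
    (F_tile, 5, 2, -2)]]]]]]]]]"
| "cover_certificate F_upper =
    Split 0 6 [Split 1 7 [Split 1 2 [Split 2 1 [Split 1 4 [Split 0 6 [Split 4 6 [Split 5 7 [Dead 0
    1 1, Split 6 8 [Dead 0 2 2, Split 9 0 [Dead 0 3 1, Split 4 2 [Dead 0 7 4, Split 2 1 [Dead 0 0
    1, Dead 0 0 1, Split 3 3 [Dead 0 4 3, Dead 0 3 1, Leaf (H_tile, 5, -4, 5)]], Dead 0 8 4], Dead
    0 4 3, Dead 0 4 8], Dead 0 7 2], Dead 0 7 1], Split 5 7 [Split 6 8 [Split 9 0 [Split 4 2
    [Split 2 4 [Dead 0 0 1, Split 3 6 [Dead 0 1 3, Dead 0 7 3, Dead 0 3 1, Leaf (H_tile, 1, -1,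
    2)]], Dead 0 3 4, Dead 0 6 2], Dead 0 7 1, Dead 0 4 3, Dead 0 4 8], Dead 0 7 1, Dead 0 7 2],
    Dead 0 2 1, Dead 0 7 1], Clash 2, Dead 0 6 4]], Split 3 7 [Dead 0 1 1, Dead 0 2 1, Split 2 4
    [Dead 0 5 2, Split 6 0 [Leaf (P_tile, 1, 4, 3), Dead 0 3 4, Split 4 3 [Dead 0 7 1, Dead 0 3 1,
    Leaf (F_tile, 1, 4, 3)], Dead 0 1 5]]]], Dead 0 2 1, Dead 0 5 1, Dead 0 1 1], Dead 0 3 1,
    Split 1 6 [Dead 0 3 1, Dead 0 0 1, Dead 0 3 1, Split 2 7 [Dead 0 1 1, Dead 0 2 1, Split 5 0
    [Dead 0 3 1, Dead 0 7 1, Split 2 1 [Dead 0 8 2, Dead 0 0 1, Split 1 5 [Split 4 0 [Dead 0 7 2,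
    Leaf (F_tile, 0, -1, 1), Dead 0 8 2, Dead 0 1 4]], Dead 0 1 2], Dead 0 4 4]]]], Split 1 2
    [Dead 0 7 1, Split 2 1 [Dead 0 8 1, Split 2 0 [Split 3 1 [Split 6 0 [Dead 0 1 5, Split 5 2
    [Split 5 0 [Split 4 4 [Split 2 1 [Dead 0 0 1, Dead 0 0 1, Split 4 0 [Dead 0 3 1, Split 7 3
    [Dead 0 7 4, Dead 0 3 4, Leaf (H_tile, 3, -1, 5)]]], Dead 0 6 2], Dead 0 4 5], Dead 0 3 3,
    Dead 0 3 3], Dead 0 4 2, Dead 0 5 1], Dead 0 3 1, Dead 0 3 1], Dead 0 3 2, Dead 0 7 2, Dead 0
    4 1], Split 3 0 [Dead 0 7 1, Split 3 0 [Split 4 1 [Split 7 0 [Dead 0 1 6, Split 6 2 [Split 6 0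
    [Split 4 4 [Split 2 1 [Dead 0 0 1, Dead 0 0 1, Split 4 0 [Dead 0 3 1, Split 7 3 [Dead 0 7 4,
    Dead 0 3 4, Leaf (H_tile, 3, -1, 5)]]], Dead 0 6 2], Clash 4], Dead 0 3 3, Dead 0 3 3], Dead 0
    4 2, Dead 0 5 1], Dead 0 3 1, Dead 0 3 1], Dead 0 3 3, Dead 0 7 3, Split 2 1 [Dead 1 5 0, Dead
    0 5 1, Split 5 1 [Dead 0 0 2, Leaf (P_tile, 4, 0, 5), Split 8 0 [Dead 0 1 7, Dead 0 7 1, Dead
    0 3 1, Leaf (F_tile, 4, 0, 5)]]]], Dead 0 8 1, Dead 0 1 2], Dead 0 1 1], Dead 0 8 1]]]"
| "cover_certificate F_lower =
    Split 0 5 [Split 1 4 [Split 2 2 [Split 3 1 [Split 4 0 [Split 2 4 [Split 0 6 [Split 5 6 [Split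
    6 7 [Dead 0 1 1, Split 7 8 [Dead 0 2 2, Split 9 0 [Dead 0 3 1, Split 4 2 [Dead 0 7 4, Split 2
    1 [Dead 0 0 1, Dead 0 0 1, Split 3 3 [Dead 0 4 3, Dead 0 3 1, Leaf (H_tile, 1, 8, -10)]], Dead
    0 8 4], Dead 0 4 3, Dead 0 4 9], Dead 0 7 2], Dead 0 7 1], Split 6 7 [Split 7 8 [Split 9 0
    [Split 4 2 [Split 2 4 [Dead 0 0 1, Split 3 6 [Dead 0 1 3, Dead 0 7 3, Dead 0 3 1, Leaf
    (H_tile, 3, 8, -7)]], Dead 0 3 4, Dead 0 6 2], Dead 0 7 1, Dead 0 4 3, Dead 0 4 9], Dead 0 7
    1, Dead 0 7 2], Dead 0 2 1, Dead 0 7 1], Clash 2, Dead 0 6 5]], Split 2 4 [Dead 0 5 1, Split 5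
    7 [Dead 0 1 2, Dead 0 2 2, Leaf (P_tile, 3, 2, -2)]]], Dead 0 3 1, Split 1 3 [Dead 0 7 1, Dead
    0 3 1, Split 3 4 [Split 0 6 [Split 6 6 [Split 7 7 [Dead 0 1 1, Split 8 8 [Dead 0 2 2, Split 10
    0 [Dead 0 3 1, Split 4 2 [Dead 0 7 4, Split 2 1 [Dead 0 0 1, Dead 0 0 1, Split 3 3 [Dead 0 4
    3, Dead 0 3 1, Leaf (H_tile, 1, 8, -10)]], Dead 0 8 4], Dead 0 4 3, Dead 0 4 10], Dead 0 7 2],
    Dead 0 7 1], Split 7 7 [Split 8 8 [Split 10 0 [Split 4 2 [Split 2 4 [Dead 0 0 1, Split 3 6
    [Dead 0 1 3, Dead 0 7 3, Dead 0 3 1, Leaf (H_tile, 3, 8, -7)]], Dead 0 3 4, Dead 0 6 2], Dead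
    0 7 1, Dead 0 4 3, Dead 0 4 10], Dead 0 7 1, Dead 0 7 2], Dead 0 2 1, Dead 0 7 1], Clash 2,
    Dead 0 6 6]], Split 3 4 [Dead 0 5 1, Split 6 7 [Dead 0 1 2, Dead 0 2 2, Leaf (F_tile, 3, 2,
    -2)]]]], Dead 0 1 2], Dead 0 2 1, Dead 0 5 1, Dead 0 1 1], Dead 0 3 1, Split 1 6 [Dead 0 3 1,
    Dead 0 0 1, Dead 0 3 1, Split 2 7 [Dead 0 1 1, Dead 0 2 1, Split 4 0 [Dead 0 3 1, Dead 0 7 1,
    Split 2 1 [Dead 0 8 2, Dead 0 0 1, Split 3 0 [Dead 0 7 1, Split 2 5 [Leaf (F_tile, 2, 9, -7)],
    Dead 0 8 1, Dead 0 1 3], Dead 0 1 2], Dead 0 4 4]]]], Split 2 2 [Dead 0 7 1, Split 3 1 [Dead 0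
    8 1, Split 2 0 [Split 3 1 [Split 3 0 [Split 6 0 [Dead 0 1 6, Split 6 2 [Split 4 4 [Split 1 1
    [Dead 0 0 1, Dead 0 0 1, Split 6 3 [Dead 0 7 5, Dead 0 3 5, Split 4 0 [Dead 0 3 2, Leaf
    (H_tile, 5, 5, -7)]]], Dead 0 6 1], Dead 0 3 4, Dead 0 3 4], Dead 0 4 3, Dead 0 5 2], Dead 0 4
    3], Dead 0 3 1, Dead 0 3 1], Dead 0 3 2, Dead 0 7 2, Dead 0 4 1], Split 4 0 [Dead 0 7 1, Split
    3 0 [Split 4 1 [Split 4 0 [Split 7 0 [Dead 0 1 7, Split 7 2 [Split 4 4 [Split 1 1 [Dead 0 0 1,
    Dead 0 0 1, Split 6 3 [Dead 0 7 5, Dead 0 3 5, Split 4 0 [Dead 0 3 2, Leaf (H_tile, 5, 5,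
    -7)]]], Dead 0 6 1], Dead 0 3 4, Dead 0 3 4], Dead 0 4 3, Dead 0 5 2], Clash 2], Dead 0 3 1,
    Dead 0 3 1], Dead 0 3 3, Dead 0 7 3, Split 2 1 [Dead 1 5 0, Dead 0 5 1, Split 5 1 [Dead 0 0 2,
    Leaf (P_tile, 0, 4, -6), Split 7 0 [Dead 0 1 7, Dead 0 7 1, Dead 0 3 1, Leaf (F_tile, 0, 4,
    -6)]]]], Dead 0 8 1, Dead 0 1 2], Dead 0 1 1], Dead 0 8 1]]]"

text \<open>Entry \<open>j\<close> starts from all tiles of the standard supertile, numbered as in
  \<open>group_tiles\<close>, and each of its leaves is a supertile across arc
  \<open>j\<close>.\<close>

fun arc_certs :: "metatile \<Rightarrow> certificate list" where
  "arc_certs T_tile =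
    [Split 0 0 [Dead 0 7 4, Dead 0 3 2, Dead 0 7 2, Split 4 2 [Split 2 3 [Dead 0 4 5, Split 1 4
    [Dead 0 5 1, Split 7 1 [Split 3 1 [Split 5 6 [Split 5 3 [Split 6 2 [Split 4 4 [Split 1 1 [Dead
    0 0 1, Dead 0 0 1, Split 3 0 [Dead 0 3 1, Leaf (H_tile, 4, 3, -4)]], Dead 0 6 1], Dead 0 3 4,
    Dead 0 3 4], Dead 0 4 3, Dead 0 5 2]], Dead 0 3 1, Dead 0 3 1], Dead 0 4 5]], Dead 0 6 6]]],
    Split 2 2 [Split 1 6 [Dead 0 1 3, Dead 0 7 3, Split 2 3 [Dead 0 4 5, Split 5 1 [Split 3 1
    [Split 4 4 [Dead 0 5 4, Split 5 2 [Split 4 6 [Split 7 3 [Split 5 4 [Split 3 1 [Dead 0 0 1,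
    Dead 0 0 1, Split 4 3 [Dead 0 4 3, Dead 0 3 1, Leaf (H_tile, 0, 6, 2)]], Dead 0 6 3], Dead 0 4
    5, Dead 0 5 4]], Dead 0 3 3, Dead 0 3 3]], Dead 0 3 1, Dead 0 3 1], Dead 0 6 7], Dead 0 6 6],
    Dead 0 6 4]], Split 0 0 [Dead 0 7 4, Dead 0 3 2, Dead 0 7 2, Split 1 6 [Dead 0 1 3, Dead 0 7
    3, Split 3 6 [Dead 0 0 2, Split 2 5 [Split 2 6 [Split 6 5 [Split 3 7 [Split 4 8 [Split 5 0
    [Dead 0 7 5, Split 4 2 [Split 2 4 [Dead 0 0 1, Split 3 6 [Dead 0 1 3, Dead 0 7 3, Dead 0 3 1,
    Leaf (H_tile, 0, -6, 5)]], Dead 0 3 4, Dead 0 6 2], Dead 0 7 1, Dead 0 4 3], Dead 0 7 1, Dead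
    0 7 2], Dead 0 2 1, Dead 0 7 1], Split 3 7 [Dead 0 1 1, Split 4 8 [Dead 0 2 2, Split 5 0 [Dead
    0 7 5, Dead 0 3 1, Split 4 2 [Dead 0 7 4, Split 2 1 [Dead 0 0 1, Dead 0 0 1, Split 3 3 [Dead 0
    4 3, Dead 0 3 1, Leaf (H_tile, 4, -6, 8)]], Dead 0 8 4], Dead 0 4 3], Dead 0 7 2], Dead 0 7
    1], Dead 0 6 8]]]], Dead 0 6 4]]]"
| "arc_certs H_tile =
    [Split 11 5 [Split 7 6 [Split 13 2 [Split 14 4 [Split 14 0 [Leaf (T_tile, 2, -1, -3), Dead 0 3
    3, Split 3 6 [Dead 17 4 0, Dead 17 4 0, Dead 0 3 1, Split 2 7 [Dead 0 1 1, Dead 0 2 1, Leaf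
    (P_tile, 2, -1, -3)]], Dead 0 1 11], Dead 0 8 1], Dead 0 7 1, Dead 0 4 9], Split 13 2 [Dead 0
    3 1, Split 13 0 [Dead 0 7 2, Leaf (T_tile, 0, -6, -2), Dead 0 8 2, Dead 0 1 10], Dead 0 4
    9]]], Split 11 5 [Split 7 6 [Split 13 2 [Split 14 4 [Split 14 0 [Split 3 6 [Dead 17 4 0, Dead
    17 4 0, Split 0 6 [Split 4 5 [Split 4 7 [Split 5 8 [Split 9 0 [Split 4 2 [Split 2 4 [Dead 0 0
    1, Split 3 6 [Dead 0 1 3, Dead 0 7 3, Dead 0 3 1, Leaf (H_tile, 2, 0, -9)]], Dead 0 3 4, Dead
    0 6 2], Dead 0 7 1, Dead 0 4 3, Dead 0 4 7], Dead 0 7 1, Dead 0 7 2], Dead 0 2 1, Dead 0 7 1],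
    Split 4 7 [Dead 0 1 1, Split 5 8 [Dead 0 2 2, Split 9 0 [Dead 0 3 1, Split 4 2 [Dead 0 7 4,
    Split 2 1 [Dead 0 0 1, Dead 0 0 1, Split 3 3 [Dead 0 4 3, Dead 0 3 1, Leaf (H_tile, 0, -3,
    -9)]], Dead 0 8 4], Dead 0 4 3, Dead 0 4 7], Dead 0 7 2], Dead 0 7 1], Dead 0 6 3]], Dead 0 6
    1], Dead 0 3 3, Split 3 6 [Dead 17 4 0, Dead 17 4 0, Dead 0 3 1, Split 2 7 [Dead 0 1 1, Dead 0
    2 1, Leaf (P_tile, 2, -1, -3)]], Dead 0 1 11], Dead 0 8 1], Dead 0 7 1, Dead 0 4 9], Split 13
    2 [Dead 0 3 1, Split 14 4 [Dead 0 5 1, Split 2 0 [Dead 16 4 0, Dead 0 0 2, Dead 0 4 2, Split 2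
    1 [Split 2 1 [Split 6 0 [Dead 0 1 4, Split 4 2 [Split 3 4 [Split 5 6 [Split 2 1 [Dead 0 0 2,
    Dead 0 0 2, Split 4 0 [Dead 0 3 1, Leaf (H_tile, 4, -3, -6)]]], Dead 0 6 1], Dead 0 3 3, Dead
    0 3 3], Dead 0 4 2, Dead 0 5 1], Dead 0 3 1, Dead 0 3 1], Dead 0 4 4]]], Dead 0 4 9]]], Split
    11 5 [Split 5 2 [Split 9 2 [Dead 0 3 1, Split 15 7 [Split 16 0 [Split 1 8 [Split 2 7 [Split 5
    3 [Dead 0 4 5, Split 4 6 [Dead 0 0 3, Split 8 2 [Split 4 4 [Dead 0 5 3, Split 2 1 [Dead 0 0 2,
    Dead 0 0 2, Split 6 3 [Split 4 3 [Dead 0 7 2, Dead 0 3 2, Leaf (H_tile, 4, 9, -9)], Dead 0 4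
    9, Dead 0 5 6]]], Dead 0 3 6, Dead 0 6 1], Dead 0 0 2, Dead 0 3 3], Dead 0 6 3], Dead 0 0 1,
    Dead 0 1 2], Dead 0 5 1, Dead 0 1 1], Dead 0 3 3, Split 1 7 [Dead 1 4 0, Dead 1 4 0, Split 1 4
    [Split 2 5 [Split 7 2 [Split 8 1 [Split 6 6 [Dead 6 4 0, Dead 6 4 0, Split 1 4 [Dead 0 5 1,
    Split 11 0 [Leaf (P_tile, 4, 4, -10), Dead 0 3 3, Split 3 3 [Dead 0 7 1, Dead 0 3 1, Leaf
    (F_tile, 4, 4, -10)], Dead 0 1 4]], Dead 0 6 2], Dead 0 2 1, Dead 0 5 1, Dead 0 1 1], Dead 0 3
    5, Split 5 6 [Dead 5 4 0, Dead 5 4 0, Dead 0 3 1, Split 3 7 [Dead 0 1 1, Dead 0 2 1, Leaf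
    (F_tile, 3, 9, -8)]]]], Dead 0 8 1]], Dead 0 1 9], Split 3 2 [Dead 0 7 1, Split 17 0 [Dead 0 1
    2, Dead 0 3 4, Split 2 1 [Dead 1 4 0, Split 3 0 [Dead 2 4 0, Dead 0 3 3, Dead 0 7 3, Split 7 1
    [Dead 0 8 4, Dead 0 0 1, Split 8 0 [Dead 0 7 1, Split 2 5 [Leaf (P_tile, 1, 8, -12)], Dead 0 8
    1, Dead 0 1 5], Dead 0 1 4]], Dead 0 6 5], Dead 0 1 10], Dead 0 8 1]], Dead 0 4 7]]], Split 4
    2 [Split 8 2 [Dead 0 3 1, Split 9 4 [Dead 0 5 1, Split 10 5 [Split 16 0 [Leaf (T_tile, 0, 6,
    -5), Dead 0 3 4, Split 4 3 [Dead 0 4 4, Dead 0 3 1, Split 3 1 [Dead 0 0 1, Leaf (P_tile, 1,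
    11, -3), Split 4 3 [Dead 0 7 1, Dead 0 3 1, Leaf (F_tile, 1, 11, -3)]]], Dead 0 1 9]]], Dead 0
    4 6]], Split 4 2 [Split 8 2 [Dead 0 3 1, Split 9 4 [Dead 0 5 1, Split 10 5 [Split 16 0 [Split
    4 3 [Dead 0 4 4, Split 4 1 [Split 4 1 [Split 5 3 [Split 6 2 [Split 3 4 [Split 5 6 [Split 2 1
    [Dead 0 0 2, Dead 0 0 2, Split 4 0 [Dead 0 3 1, Leaf (H_tile, 0, 12, -3)]]], Dead 0 6 1], Dead
    0 3 3, Dead 0 3 3], Dead 0 4 2, Dead 0 5 1], Dead 0 3 1, Dead 0 3 1], Dead 0 6 2], Dead 0 6
    1], Dead 0 3 4, Split 4 3 [Dead 0 4 4, Dead 0 3 1, Split 3 1 [Dead 0 0 1, Leaf (P_tile, 1, 11,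
    -3), Split 4 3 [Dead 0 7 1, Dead 0 3 1, Leaf (F_tile, 1, 11, -3)]]], Dead 0 1 9]]], Dead 0 4
    6]], Split 7 5 [Split 6 2 [Split 11 2 [Dead 0 3 1, Split 7 2 [Split 11 2 [Dead 0 3 1, Split 12
    4 [Dead 0 5 1, Split 14 7 [Split 15 0 [Split 1 8 [Split 2 7 [Split 3 6 [Dead 0 0 2, Split 10 2
    [Split 10 3 [Dead 0 4 10, Split 4 4 [Dead 0 5 1, Split 3 1 [Dead 0 0 3, Dead 0 0 3, Split 6 3
    [Split 5 3 [Dead 0 7 2, Dead 0 3 2, Leaf (H_tile, 0, 3, 9)], Dead 0 4 9, Dead 0 5 6]]], Dead 0
    6 5], Dead 0 3 5, Dead 0 6 1], Dead 0 0 1, Dead 0 3 2], Dead 0 0 1, Dead 0 1 2], Dead 0 5 1,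
    Dead 0 1 1], Dead 0 3 6, Split 1 7 [Dead 1 4 0, Dead 1 4 0, Split 1 4 [Split 2 5 [Split 10 2
    [Split 5 6 [Dead 5 4 0, Dead 5 4 0, Split 12 1 [Split 13 0 [Dead 0 1 9, Dead 0 3 1, Split 2 5
    [Split 2 3 [Dead 0 7 2, Dead 0 3 2, Leaf (F_tile, 0, 9, 4)]], Dead 0 1 3], Dead 0 2 2, Dead 0
    5 2, Dead 0 1 2], Dead 0 6 1], Dead 0 3 5, Split 5 6 [Dead 5 4 0, Dead 5 4 0, Dead 0 3 1,
    Split 3 7 [Dead 0 1 1, Dead 0 2 1, Leaf (F_tile, 5, 2, 9)]]]], Dead 0 8 1]], Dead 0 1 13],
    Split 6 2 [Dead 0 7 1, Split 16 0 [Dead 0 1 2, Dead 0 3 7, Split 2 1 [Dead 1 4 0, Split 3 0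
    [Dead 2 4 0, Dead 0 3 3, Dead 0 7 3, Split 10 1 [Dead 0 8 4, Dead 0 0 1, Split 11 0 [Dead 0 1
    7, Split 2 5 [Leaf (P_tile, 3, 7, 8)], Dead 0 8 1, Dead 0 1 5], Dead 0 1 4]], Dead 0 6 8],
    Dead 0 1 14], Dead 0 8 1]]], Dead 0 4 9]], Dead 0 4 8]]], Split 5 2 [Split 10 2 [Dead 0 3 1,
    Split 11 4 [Dead 0 5 1, Split 12 5 [Split 12 0 [Leaf (T_tile, 2, 2, 6), Dead 0 3 4, Split 4 3
    [Dead 0 4 4, Dead 0 3 1, Split 3 1 [Dead 0 0 1, Leaf (P_tile, 3, -5, 11), Split 4 3 [Dead 0 7
    1, Dead 0 3 1, Leaf (F_tile, 3, -5, 11)]]], Dead 0 1 10]]], Dead 0 4 7]], Split 5 2 [Split 10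
    2 [Dead 0 3 1, Split 11 4 [Dead 0 5 1, Split 12 5 [Split 12 0 [Split 3 1 [Split 3 1 [Split 6 3
    [Dead 0 4 6, Split 5 3 [Split 6 2 [Split 4 4 [Split 5 3 [Dead 0 7 7, Dead 0 4 7, Split 2 1
    [Dead 0 0 2, Dead 0 0 2, Split 4 0 [Dead 0 3 1, Leaf (H_tile, 2, -6, 12)]]], Dead 0 6 1], Dead
    0 3 4, Dead 0 3 4], Dead 0 4 3, Dead 0 5 2], Dead 0 6 3], Dead 0 3 1, Dead 0 3 1], Dead 0 6
    1], Dead 0 3 4, Split 4 3 [Dead 0 4 4, Dead 0 3 1, Split 3 1 [Dead 0 0 1, Leaf (P_tile, 3, -5,
    11), Split 4 3 [Dead 0 7 1, Dead 0 3 1, Leaf (F_tile, 3, -5, 11)]]], Dead 0 1 10]]], Dead 0 4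
    7]], Split 9 5 [Split 6 2 [Split 11 2 [Dead 0 3 1, Split 12 4 [Dead 0 5 1, Split 14 7 [Split 4
    2 [Split 5 1 [Split 6 0 [Dead 0 1 4, Dead 0 3 1, Split 1 3 [Dead 0 7 1, Dead 0 3 1, Split 3 4
    [Split 0 6 [Split 6 6 [Split 7 7 [Dead 0 1 1, Split 8 8 [Dead 0 2 2, Split 24 0 [Dead 0 3 1,
    Split 0 1 [Dead 27 4 0, Split 2 1 [Dead 1 5 0, Dead 0 5 1, Split 6 2 [Dead 0 7 6, Leaf
    (H_tile, 0, -12, 3), Dead 0 8 6]]], Dead 0 4 3, Dead 0 1 21], Dead 0 7 2], Dead 0 7 1], Split
    7 7 [Split 8 8 [Split 24 0 [Split 0 5 [Dead 27 4 0, Dead 27 4 0, Split 2 4 [Dead 0 5 1, Split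
    6 2 [Leaf (H_tile, 2, -9, 3), Dead 0 3 6, Dead 0 6 4]]], Dead 0 7 1, Dead 0 4 3, Dead 0 1 21],
    Dead 0 7 1, Dead 0 7 2], Dead 0 2 1, Dead 0 7 1], Clash 2, Dead 0 6 6]], Split 5 7 [Dead 0 1
    1, Dead 0 2 1, Split 4 4 [Dead 0 5 2, Leaf (F_tile, 2, -10, 9)]]]], Dead 0 1 2], Dead 0 2 1,
    Dead 0 5 1, Dead 0 1 1], Dead 0 3 1, Split 1 6 [Dead 0 3 1, Dead 0 0 1, Dead 0 3 1, Split 2 7
    [Dead 0 1 1, Dead 0 2 1, Split 18 0 [Dead 0 3 1, Dead 0 7 1, Split 2 1 [Dead 0 8 2, Dead 0 0
    1, Split 1 5 [Split 4 0 [Dead 0 7 2, Leaf (F_tile, 1, -8, 2), Dead 0 8 2, Dead 0 1 4]], Dead 0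
    1 2], Dead 0 1 15]]]], Split 4 2 [Dead 0 7 1, Split 16 0 [Dead 0 1 2, Split 2 1 [Split 1 1
    [Dead 20 4 0, Split 4 2 [Split 5 0 [Split 5 0 [Split 3 5 [Split 3 0 [Dead 0 0 3, Dead 0 3 3,
    Split 3 3 [Dead 0 7 3, Dead 0 3 3, Leaf (H_tile, 4, -12, 6)], Dead 0 4 9]], Dead 0 0 4], Dead
    0 3 5, Dead 0 7 5, Dead 0 0 3], Dead 0 5 3, Dead 0 6 3]], Dead 0 5 1, Dead 0 6 1], Split 2 1
    [Dead 1 4 0, Split 3 0 [Dead 2 4 0, Dead 0 3 3, Dead 0 7 3, Split 8 1 [Dead 0 8 4, Dead 0 0 1,
    Split 9 0 [Dead 0 1 7, Split 2 5 [Leaf (P_tile, 5, -12, 7)], Dead 0 8 1, Dead 0 1 5], Dead 0 1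
    4]], Dead 0 6 1], Dead 0 1 13], Dead 0 8 1]]], Dead 0 4 8]]]]"
| "arc_certs P_tile =
    [Split 7 0 [Dead 0 3 10, Dead 0 7 10, Split 7 6 [Split 1 6 [Split 10 2 [Split 11 1 [Split 12 4
    [Split 2 4 [Split 4 2 [Split 5 1 [Split 2 5 [Split 7 0 [Leaf (P_tile, 3, -14, 7), Dead 0 3 2,
    Split 2 3 [Dead 0 7 1, Dead 0 3 1, Leaf (F_tile, 3, -14, 7)], Dead 4 4 0]], Dead 0 0 2, Dead 0
    5 1, Dead 2 4 0], Dead 0 3 3, Dead 0 6 1], Split 1 7 [Dead 0 1 1, Dead 0 2 1, Split 5 2 [Dead
    0 5 2, Dead 0 3 4, Leaf (F_tile, 2, -7, 2)]]], Dead 0 8 2], Dead 0 2 1, Dead 0 8 4, Dead 0 4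
    13], Split 11 1 [Dead 0 8 1, Split 2 2 [Dead 0 7 1, Split 2 0 [Split 4 1 [Dead 0 8 2, Dead 0 0
    1, Split 5 0 [Dead 0 7 1, Split 2 5 [Leaf (P_tile, 0, -12, 3)], Dead 0 8 1, Dead 0 1 3], Dead
    0 1 2], Dead 0 4 2], Dead 0 8 1], Dead 0 8 4, Dead 0 4 13], Dead 0 4 3]]], Dead 0 4 9], Split
    7 0 [Dead 0 3 10, Dead 0 7 10, Split 7 6 [Split 1 6 [Split 7 2 [Split 8 1 [Split 1 2 [Split 4
    2 [Split 5 1 [Split 0 4 [Split 16 2 [Split 17 1 [Split 18 4 [Split 2 4 [Split 0 6 [Split 12 0
    [Split 3 8 [Split 4 7 [Split 7 5 [Split 4 2 [Split 11 3 [Dead 0 4 11, Split 4 4 [Dead 0 0 2,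
    Leaf (H_tile, 2, -6, -4)], Dead 0 6 5], Dead 0 1 3, Dead 0 6 3], Dead 0 0 2, Clash 5], Dead 0
    0 1, Dead 0 1 2], Dead 0 5 1, Dead 0 1 1], Dead 0 3 7, Split 5 5 [Dead 1 4 0, Dead 1 4 0,
    Clash 3], Dead 0 1 8]], Split 1 7 [Dead 0 1 1, Dead 0 2 1, Split 11 2 [Dead 0 5 2, Dead 0 3 4,
    Leaf (F_tile, 2, -7, 2)]]], Dead 0 8 2], Dead 0 2 1, Dead 0 8 10, Dead 0 4 19], Split 17 1
    [Dead 0 8 1, Split 18 4 [Dead 0 5 2, Split 10 0 [Dead 0 1 1, Dead 0 3 5, Split 3 1 [Dead 1 4
    0, Dead 0 4 3], Dead 0 1 6]], Dead 0 8 10, Dead 0 4 19], Dead 0 4 9], Dead 0 6 3], Dead 0 2 1,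
    Dead 0 5 1, Dead 0 1 1], Dead 0 3 2, Dead 0 6 1], Dead 0 3 1, Dead 0 3 1], Dead 0 4 5]]]],
    Dead 0 4 9], Split 4 2 [Split 5 1 [Split 2 3 [Dead 0 7 7, Split 2 1 [Split 10 6 [Split 4 4
    [Dead 0 5 3, Split 5 3 [Split 6 2 [Split 6 4 [Split 1 1 [Dead 0 0 1, Dead 0 0 1, Split 3 0
    [Dead 0 3 1, Leaf (H_tile, 4, 3, -4)]], Dead 0 6 1], Dead 0 3 6, Dead 0 3 6], Dead 0 4 5, Dead
    0 5 3]]], Dead 0 3 2, Dead 0 3 2], Dead 0 6 7], Dead 0 4 2]], Split 4 2 [Split 5 1 [Split 2 3
    [Dead 0 7 7, Split 2 1 [Split 10 6 [Split 4 4 [Dead 0 5 3, Split 5 3 [Split 6 2 [Split 6 4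
    [Split 1 1 [Dead 0 0 1, Dead 0 0 1, Split 3 0 [Dead 0 3 1, Leaf (H_tile, 4, 3, -4)]], Dead 0 6
    1], Dead 0 3 6, Dead 0 3 6], Dead 0 4 5, Dead 0 5 3]]], Dead 0 3 2, Dead 0 3 2], Dead 0 6 7],
    Dead 0 4 2]], Split 0 3 [Dead 0 7 5, Split 4 5 [Split 1 6 [Split 7 2 [Split 8 1 [Split 1 1
    [Split 5 5 [Split 3 3 [Split 1 1 [Dead 0 2 1, Dead 0 5 1, Split 2 2 [Dead 0 3 1, Split 7 7
    [Dead 0 5 1, Split 14 2 [Split 15 1 [Split 16 4 [Split 2 4 [Split 12 2 [Split 13 1 [Split 14 0
    [Dead 0 1 7, Dead 0 3 1, Split 3 5 [Split 2 3 [Dead 0 7 2, Dead 0 3 2, Leaf (F_tile, 0, 12,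
    -3)]], Dead 3 4 0], Dead 0 0 2, Dead 0 5 1, Dead 2 4 0], Dead 0 3 3, Dead 0 6 1], Split 1 7
    [Dead 0 1 1, Dead 0 2 1, Split 13 2 [Dead 0 5 2, Dead 0 3 4, Leaf (F_tile, 5, 5, 2)]]], Dead 0
    8 2], Dead 0 2 1, Dead 0 8 12, Dead 0 6 17], Split 15 1 [Dead 0 8 1, Split 10 2 [Dead 0 7 1,
    Split 2 0 [Split 12 1 [Dead 0 8 2, Dead 0 0 1, Split 13 0 [Dead 0 1 6, Split 2 5 [Leaf
    (P_tile, 3, 10, 1)], Dead 0 8 1, Dead 0 1 3], Dead 0 1 2], Dead 0 4 2], Dead 0 8 1], Dead 0 8
    12, Dead 0 6 17], Dead 0 4 11]], Dead 0 4 2], Dead 0 5 3], Dead 0 4 3, Dead 0 5 2]], Dead 0 3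
    1, Dead 0 3 1], Dead 0 4 5]]]], Dead 0 6 5], Split 0 3 [Dead 0 7 5, Split 4 5 [Split 1 6
    [Split 6 2 [Split 7 1 [Split 8 4 [Split 2 4 [Split 0 6 [Split 4 5 [Split 3 7 [Split 4 8 [Split
    9 0 [Split 4 2 [Split 2 4 [Dead 0 0 1, Split 3 6 [Dead 0 1 3, Dead 0 7 3, Dead 0 3 1, Leaf
    (H_tile, 5, 4, 8)]], Dead 0 3 4, Dead 0 6 2], Dead 0 7 1, Dead 0 4 3, Dead 0 4 6], Dead 0 7 1,
    Dead 0 7 2], Dead 0 2 1, Dead 0 7 1], Split 3 7 [Dead 0 1 1, Split 4 8 [Dead 0 2 2, Split 9 0
    [Dead 0 3 1, Split 4 2 [Dead 0 7 4, Split 2 1 [Dead 0 0 1, Dead 0 0 1, Split 3 3 [Dead 0 4 3,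
    Dead 0 3 1, Leaf (H_tile, 3, 7, 8)]], Dead 0 8 4], Dead 0 4 3, Dead 0 4 6], Dead 0 7 2], Dead
    0 7 1], Clash 2]], Split 1 7 [Dead 0 1 1, Dead 0 2 1, Split 5 2 [Dead 0 5 2, Dead 0 3 4, Leaf
    (F_tile, 5, 5, 2)]]], Dead 0 8 2], Dead 0 2 1, Dead 0 8 4, Dead 0 6 9], Split 7 4 [Dead 0 5 1,
    Split 8 1 [Dead 0 8 2, Split 2 0 [Split 3 1 [Split 3 1 [Split 7 0 [Dead 0 1 5, Split 5 2
    [Split 3 4 [Split 1 1 [Dead 0 0 1, Dead 0 0 1, Split 3 0 [Dead 0 3 1, Split 7 6 [Leaf (H_tile,
    1, 7, 5)]]], Dead 0 6 1], Dead 0 3 3, Dead 0 3 3], Dead 0 4 2, Dead 0 5 1], Dead 0 3 1, Dead 0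
    3 1], Dead 0 4 2], Dead 0 4 1], Dead 0 8 5, Dead 0 6 10]], Dead 0 4 3]]], Dead 0 6 5], Split 7
    0 [Dead 0 3 10, Dead 0 7 10, Split 10 6 [Dead 0 0 1, Split 5 5 [Split 2 5 [Split 9 7 [Split 3
    7 [Split 4 8 [Split 4 2 [Split 6 0 [Dead 0 7 5, Split 2 4 [Dead 0 0 2, Split 3 6 [Dead 0 1 2,
    Dead 0 7 2, Dead 0 3 1, Leaf (H_tile, 5, -8, 11)]], Dead 0 7 2, Dead 0 4 4], Dead 0 3 3, Dead
    0 6 1], Dead 0 7 1, Dead 0 7 2], Dead 0 2 1, Dead 0 7 1], Split 3 7 [Dead 0 1 1, Split 3 2
    [Dead 0 7 2, Split 5 8 [Dead 0 2 3, Split 6 0 [Dead 0 7 5, Dead 0 3 1, Split 2 0 [Split 2 3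
    [Dead 0 4 2, Dead 0 3 1, Leaf (H_tile, 3, -5, 11)], Dead 0 0 4], Dead 0 4 4], Dead 0 7 3],
    Dead 0 8 2], Dead 0 7 1]]]]], Dead 0 4 9], Split 7 0 [Dead 0 3 10, Dead 0 7 10, Split 10 6
    [Dead 0 0 1, Split 5 5 [Split 2 5 [Split 9 7 [Split 3 7 [Split 4 8 [Split 4 2 [Split 6 0 [Dead
    0 7 5, Split 2 4 [Dead 0 0 2, Split 3 6 [Dead 0 1 2, Dead 0 7 2, Dead 0 3 1, Leaf (H_tile, 5,
    -8, 11)]], Dead 0 7 2, Dead 0 4 4], Dead 0 3 3, Dead 0 6 1], Dead 0 7 1, Dead 0 7 2], Dead 0 2
    1, Dead 0 7 1], Split 3 7 [Dead 0 1 1, Split 3 2 [Dead 0 7 2, Split 5 8 [Dead 0 2 3, Split 6 0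
    [Dead 0 7 5, Dead 0 3 1, Split 2 0 [Split 2 3 [Dead 0 4 2, Dead 0 3 1, Leaf (H_tile, 3, -5,
    11)], Dead 0 0 4], Dead 0 4 4], Dead 0 7 3], Dead 0 8 2], Dead 0 7 1]]]]], Dead 0 4 9]]"
| "arc_certs F_tile =
    [Split 8 0 [Dead 0 3 11, Dead 0 7 11, Split 8 6 [Split 1 6 [Split 11 2 [Split 12 1 [Split 13 4
    [Split 2 4 [Split 4 2 [Split 5 1 [Split 2 5 [Split 7 0 [Leaf (P_tile, 3, -14, 7), Dead 0 3 2,
    Split 2 3 [Dead 0 7 1, Dead 0 3 1, Leaf (F_tile, 3, -14, 7)], Dead 4 4 0]], Dead 0 0 2, Dead 0
    5 1, Dead 2 4 0], Dead 0 3 3, Dead 0 6 1], Split 1 7 [Dead 0 1 1, Dead 0 2 1, Split 5 2 [Dead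
    0 5 2, Dead 0 3 4, Leaf (F_tile, 2, -7, 2)]]], Dead 0 8 2], Dead 0 2 1, Dead 0 8 4, Dead 0 4
    14], Split 12 1 [Dead 0 8 1, Split 2 2 [Dead 0 7 1, Split 2 0 [Split 4 1 [Dead 0 8 2, Dead 0 0
    1, Split 5 0 [Dead 0 7 1, Split 2 5 [Leaf (P_tile, 0, -12, 3)], Dead 0 8 1, Dead 0 1 3], Dead
    0 1 2], Dead 0 4 2], Dead 0 8 1], Dead 0 8 4, Dead 0 4 14], Dead 0 4 3]]], Dead 0 4 10], Split
    8 0 [Dead 0 3 11, Dead 0 7 11, Split 8 6 [Split 1 6 [Split 11 2 [Split 12 1 [Split 13 4 [Split
    2 4 [Split 0 6 [Split 4 5 [Split 3 7 [Split 4 8 [Split 9 0 [Split 4 2 [Split 2 4 [Dead 0 0 1,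
    Split 3 6 [Dead 0 1 3, Dead 0 7 3, Dead 0 3 1, Leaf (H_tile, 2, -6, -4)]], Dead 0 3 4, Dead 0
    6 2], Dead 0 7 1, Dead 0 4 3, Dead 0 4 6], Dead 0 7 1, Dead 0 7 2], Dead 0 2 1, Dead 0 7 1],
    Split 3 7 [Dead 0 1 1, Split 4 8 [Dead 0 2 2, Split 9 0 [Dead 0 3 1, Split 4 2 [Dead 0 7 4,
    Split 2 1 [Dead 0 0 1, Dead 0 0 1, Split 3 3 [Dead 0 4 3, Dead 0 3 1, Leaf (H_tile, 0, -9,
    -4)]], Dead 0 8 4], Dead 0 4 3, Dead 0 4 6], Dead 0 7 2], Dead 0 7 1], Clash 2]], Split 1 7
    [Dead 0 1 1, Dead 0 2 1, Split 5 2 [Dead 0 5 2, Dead 0 3 4, Leaf (F_tile, 2, -7, 2)]]], Dead 0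
    8 2], Dead 0 2 1, Dead 0 8 4, Dead 0 4 14], Split 12 4 [Dead 0 5 1, Split 13 1 [Dead 0 8 2,
    Split 2 0 [Split 3 1 [Split 3 1 [Split 7 0 [Dead 0 1 5, Split 5 2 [Split 3 4 [Split 1 1 [Dead
    0 0 1, Dead 0 0 1, Split 3 0 [Dead 0 3 1, Split 7 6 [Leaf (H_tile, 4, -9, -1)]]], Dead 0 6 1],
    Dead 0 3 3, Dead 0 3 3], Dead 0 4 2, Dead 0 5 1], Dead 0 3 1, Dead 0 3 1], Dead 0 4 2], Dead 0
    4 1], Dead 0 8 5, Dead 0 4 15]], Dead 0 4 3]]], Dead 0 4 10], Split 4 5 [Split 8 6 [Split 5 2
    [Dead 0 3 8, Dead 0 7 8, Split 8 7 [Dead 0 0 1, Split 1 5 [Split 4 2 [Dead 0 7 2, Split 2 0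
    [Dead 0 7 2, Dead 0 3 1, Dead 0 7 1, Split 6 1 [Dead 0 8 2, Dead 0 0 1, Split 7 0 [Dead 0 7 1,
    Split 2 5 [Split 2 0 [Dead 0 7 1, Dead 0 3 2, Dead 0 7 2, Split 2 6 [Dead 0 0 1, Split 16 2
    [Split 17 1 [Split 18 4 [Split 3 7 [Split 3 4 [Split 15 2 [Split 16 1 [Split 2 5 [Split 18 0
    [Leaf (P_tile, 4, -2, -5), Dead 0 3 2, Split 2 3 [Dead 0 7 1, Dead 0 3 1, Leaf (F_tile, 4, -2,
    -5)], Dead 4 4 0]], Dead 0 0 2, Dead 0 5 1, Dead 2 4 0], Dead 0 3 4, Dead 0 6 1], Dead 0 0 1],
    Dead 0 2 1, Dead 0 7 1], Dead 0 8 2], Dead 0 2 1, Dead 0 8 21, Dead 0 4 14], Split 17 1 [Dead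
    0 8 1, Split 12 2 [Dead 0 7 1, Split 2 0 [Split 14 1 [Dead 0 8 2, Dead 0 0 1, Split 15 0 [Dead
    0 7 1, Split 2 5 [Leaf (P_tile, 1, 2, -7)], Dead 0 8 1, Dead 0 1 3], Dead 0 1 2], Dead 0 4 2],
    Dead 0 8 1], Dead 0 8 21, Dead 0 4 14], Dead 0 4 20]]]], Dead 0 8 1, Dead 0 1 3], Dead 0 1
    2]], Dead 0 8 2]]]]]], Split 4 5 [Split 8 6 [Split 5 2 [Dead 0 3 8, Dead 0 7 8, Split 8 7
    [Dead 0 0 1, Split 1 5 [Split 4 2 [Dead 0 7 2, Split 2 0 [Dead 0 7 2, Dead 0 3 1, Dead 0 7 1,
    Split 6 1 [Dead 0 8 2, Dead 0 0 1, Split 7 0 [Dead 0 7 1, Split 2 5 [Split 2 0 [Dead 0 7 1,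
    Dead 0 3 2, Dead 0 7 2, Split 2 6 [Dead 0 0 1, Split 16 2 [Split 17 1 [Split 18 4 [Split 3 7
    [Split 3 4 [Split 15 2 [Split 16 1 [Split 2 5 [Split 18 0 [Leaf (P_tile, 4, -2, -5), Dead 0 3
    2, Split 2 3 [Dead 0 7 1, Dead 0 3 1, Leaf (F_tile, 4, -2, -5)], Dead 4 4 0]], Dead 0 0 2,
    Dead 0 5 1, Dead 2 4 0], Dead 0 3 4, Dead 0 6 1], Dead 0 0 1], Dead 0 2 1, Dead 0 7 1], Dead 0
    8 2], Dead 0 2 1, Dead 0 8 21, Dead 0 4 14], Split 17 1 [Dead 0 8 1, Split 12 2 [Dead 0 7 1,
    Split 2 0 [Split 14 1 [Dead 0 8 2, Dead 0 0 1, Split 15 0 [Dead 0 7 1, Split 2 5 [Leaf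
    (P_tile, 1, 2, -7)], Dead 0 8 1, Dead 0 1 3], Dead 0 1 2], Dead 0 4 2], Dead 0 8 1], Dead 0 8
    21, Dead 0 4 14], Dead 0 4 20]]]], Dead 0 8 1, Dead 0 1 3], Dead 0 1 2]], Dead 0 8 2]]]]]],
    Split 4 5 [Split 4 2 [Dead 0 3 7, Dead 0 7 7, Split 7 7 [Dead 0 0 1, Split 1 5 [Split 3 2
    [Dead 0 7 2, Split 2 0 [Dead 0 7 2, Dead 0 3 1, Dead 0 7 1, Split 5 1 [Dead 0 8 2, Dead 0 0 1,
    Split 6 0 [Dead 0 7 1, Split 2 5 [Split 2 0 [Dead 0 7 1, Dead 0 3 2, Dead 0 7 2, Split 2 6
    [Dead 0 0 1, Split 1 5 [Split 16 2 [Split 17 4 [Split 3 7 [Split 4 8 [Split 3 4 [Split 6 0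
    [Dead 0 7 6, Split 2 6 [Dead 0 3 2, Dead 0 0 2, Dead 0 3 2, Leaf (H_tile, 1, 9, -11)], Dead 0
    7 2, Dead 0 4 4], Dead 0 0 2], Dead 0 7 1, Dead 0 7 2], Dead 0 2 1, Dead 0 7 1], Dead 0 8 1],
    Split 17 4 [Dead 0 5 1, Split 3 7 [Dead 0 1 1, Split 4 8 [Dead 0 3 3, Split 3 0 [Split 6 0
    [Dead 0 7 6, Dead 0 3 2, Split 2 3 [Dead 0 7 2, Dead 0 3 2, Leaf (H_tile, 5, 6, -8)], Dead 0 4
    4], Dead 0 0 2], Dead 0 7 2], Dead 0 7 1]], Dead 0 4 20]]]]], Dead 0 8 1, Dead 0 1 3], Dead 0
    1 2]], Dead 0 8 2]]]]], Split 3 2 [Dead 0 3 6, Dead 0 7 6, Split 6 7 [Dead 0 0 1, Split 6 5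
    [Split 2 5 [Split 2 7 [Dead 0 1 2, Dead 0 2 2, Split 3 0 [Dead 0 7 2, Dead 0 3 1, Dead 0 7 1,
    Split 3 1 [Dead 0 8 2, Dead 0 0 1, Split 4 0 [Dead 0 7 1, Split 2 5 [Leaf (F_tile, 2, 12,
    -3)], Dead 0 8 1, Dead 0 1 3], Dead 0 1 2]]]]]]], Split 3 2 [Dead 0 3 6, Dead 0 7 6, Split 4 5
    [Split 5 4 [Split 2 6 [Split 1 7 [Dead 0 1 1, Dead 0 2 1, Split 3 0 [Dead 0 3 1, Dead 0 7 1,
    Split 2 1 [Dead 0 8 2, Dead 0 0 1, Split 3 0 [Dead 0 7 1, Split 2 5 [Leaf (F_tile, 4, 3, 9)],
    Dead 0 8 1, Dead 0 1 3], Dead 0 1 2], Dead 0 4 3]]], Dead 0 8 2]]], Split 8 0 [Dead 0 3 11,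
    Dead 0 7 11, Split 11 6 [Dead 0 0 1, Split 5 5 [Split 2 5 [Split 7 2 [Dead 0 3 10, Dead 0 7
    10, Split 8 4 [Split 1 6 [Split 1 7 [Dead 0 1 1, Dead 0 2 1, Split 5 0 [Dead 0 3 1, Dead 0 7
    1, Split 15 7 [Split 8 7 [Split 8 2 [Split 10 8 [Split 11 0 [Dead 0 7 10, Split 2 4 [Split 2 6
    [Dead 0 1 2, Dead 0 7 2, Dead 0 3 1, Leaf (H_tile, 5, -8, 11)], Dead 0 0 4], Dead 0 7 1, Dead
    0 4 4], Dead 0 7 2, Dead 0 7 3], Dead 0 3 2, Dead 0 4 3], Dead 0 2 1, Dead 0 7 1], Split 8 7
    [Dead 0 1 1, Split 8 2 [Dead 0 7 2, Split 10 8 [Dead 0 2 3, Split 11 0 [Dead 0 7 10, Dead 0 3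
    1, Split 2 0 [Split 2 3 [Dead 0 4 2, Dead 0 3 1, Leaf (H_tile, 3, -5, 11)], Dead 0 0 4], Dead
    0 4 4], Dead 0 7 3], Dead 0 4 3], Dead 0 7 1]], Dead 0 4 3]]], Dead 0 8 1]]]]], Dead 0 4 10],
    Split 8 0 [Dead 0 3 11, Dead 0 7 11, Split 11 6 [Dead 0 0 1, Split 5 5 [Split 2 5 [Split 7 2
    [Dead 0 3 10, Dead 0 7 10, Split 8 4 [Split 1 6 [Split 1 7 [Dead 0 1 1, Dead 0 2 1, Split 5 0
    [Dead 0 3 1, Dead 0 7 1, Split 15 7 [Split 8 7 [Split 8 2 [Split 10 8 [Split 11 0 [Dead 0 7
    10, Split 2 4 [Split 2 6 [Dead 0 1 2, Dead 0 7 2, Dead 0 3 1, Leaf (H_tile, 5, -8, 11)], Dead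
    0 0 4], Dead 0 7 1, Dead 0 4 4], Dead 0 7 2, Dead 0 7 3], Dead 0 3 2, Dead 0 4 3], Dead 0 2 1,
    Dead 0 7 1], Split 8 7 [Dead 0 1 1, Split 8 2 [Dead 0 7 2, Split 10 8 [Dead 0 2 3, Split 11 0
    [Dead 0 7 10, Dead 0 3 1, Split 2 0 [Split 2 3 [Dead 0 4 2, Dead 0 3 1, Leaf (H_tile, 3, -5,
    11)], Dead 0 0 4], Dead 0 4 4], Dead 0 7 3], Dead 0 4 3], Dead 0 7 1]], Dead 0 4 3]]], Dead 0
    8 1]]]]], Dead 0 4 10]]"

definition check_cover :: "piece \<Rightarrow> bool" where
  "check_cover q \<longleftrightarrow> check neighbours (covers q) [(tile_of q, 0, 0, 0)] (cover_certificate q)"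

definition check_arcs :: "metatile \<Rightarrow> bool" where
  "check_arcs k \<longleftrightarrow> list_all (\<lambda>j. check neighbours (meets_arc k j) (group_tiles (k, 0, 0, 0))
     (arc_certs k ! j)) [0..<length (arc_list k)]"

lemma check_cover:
  "check_cover T_piece" "check_cover H_piece" "check_cover P_upper"
  "check_cover P_lower" "check_cover F_upper" "check_cover F_lower"
  by code_simp+

lemma check_arcs:
  "check_arcs T_tile" "check_arcs H_tile" "check_arcs P_tile" "check_arcs F_tile"
  by code_simp+

section \<open>Lattice coordinates\<close>

definition coord_x :: "complex \<Rightarrow> real" where "coord_x z = 2 / sqrt 3 * Re z"
definition coord_y :: "complex \<Rightarrow> real" where "coord_y z = Im z - Re z / sqrt 3"

lemma pt_altdef: "pt x y = Complex (x * sqrt 3 / 2) (x / 2 + y)"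
  by (simp add: pt_def complex_eq_iff)

lemma coord_pt [simp]: "coord_x (pt x y) = x" "coord_y (pt x y) = y"
  by (simp_all add: coord_x_def coord_y_def pt_altdef)

lemma pt_coord [simp]: "pt (coord_x z) (coord_y z) = z"
  by (simp add: coord_x_def coord_y_def pt_altdef complex_eq_iff)

lemma pt_eq_iff [simp]: "pt x y = pt u v \<longleftrightarrow> x = u \<and> y = v"
  by (metis coord_pt)

lemma complex_eq_coord_iff: "z = w \<longleftrightarrow> coord_x z = coord_x w \<and> coord_y z = coord_y w"
  by (metis pt_coord)

lemma pt_arith: "pt x y + pt u v = pt (x + u) (y + v)" "pt x y - pt u v = pt (x - u) (y - v)"
  "of_real a * pt x y = pt (a * x) (a * y)" "- pt x y = pt (- x) (- y)"
  by (simp_all add: pt_altdef complex_eq_iff field_simps)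

lemma pt_0 [simp]: "pt 0 0 = 0"
  by (simp add: pt_altdef complex_eq_iff)

lemma coord_arith [simp]:
  "coord_x (z + w) = coord_x z + coord_x w" "coord_y (z + w) = coord_y z + coord_y w"
  "coord_x (z - w) = coord_x z - coord_x w" "coord_y (z - w) = coord_y z - coord_y w"
  "coord_x (of_real a * z) = a * coord_x z" "coord_y (of_real a * z) = a * coord_y z"
  "coord_x (a *\<^sub>R z) = a * coord_x z" "coord_y (a *\<^sub>R z) = a * coord_y z"
  by (simp_all add: coord_x_def coord_y_def field_simps)

lemma continuous_coord [continuous_intros]:
  "continuous_on S coord_x" "continuous_on S coord_y"
  unfolding coord_x_def coord_y_def by (intro continuous_intros; simp)+

lemma rot60_pt: "rot60 (pt x y) = pt (- y) (x + y)"
  by (simp add: rot60_def pt_altdef complex_eq_iff cos_60 sin_60 algebra_simps)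

lemma coord_rot60 [simp]: "coord_x (rot60 z) = - coord_y z"
    "coord_y (rot60 z) = coord_x z + coord_y z"
  by (metis coord_pt pt_coord rot60_pt)+

lemma rot60_power: "(rot60 ^^ k) z = cis (of_nat k * (pi / 3)) * z"
proof (induction k)
  case (Suc k)
  have "cis (of_nat (Suc k) * (pi / 3)) = cis (pi / 3) * cis (of_nat k * (pi / 3))"
    by (simp add: cis_mult add_divide_distrib algebra_simps)
  then show ?case using Suc by (simp add: rot60_def mult.assoc)
qed simp

lemma rot60_power_6: "(rot60 ^^ 6) z = z"
  by (simp add: rot60_power)

lemma rot60_power_shift: "n \<ge> 6 \<Longrightarrow> (rot60 ^^ n) z = (rot60 ^^ (n - 6)) z"
  using funpow_add[of "n - 6" 6 rot60] by (simp add: fun_eq_iff rot60_power_6)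

lemma rot60_power_add: "(rot60 ^^ k) (z + w) = (rot60 ^^ k) z + (rot60 ^^ k) w"
  by (simp add: rot60_power algebra_simps)

definition lattice_pt :: "int \<times> int \<Rightarrow> complex" where
  "lattice_pt = (\<lambda>(x, y). pt (of_int x) (of_int y))"

definition placed :: "placement \<Rightarrow> complex \<Rightarrow> complex" where
  "placed = (\<lambda>(r, x, y). place r (of_int x) (of_int y))"

lemma lattice_pt_eq_iff [simp]: "lattice_pt p = lattice_pt q \<longleftrightarrow> p = q"
  by (cases p; cases q) (simp add: lattice_pt_def)

lemma rot60_power_lattice_pt: "(rot60 ^^ k) (lattice_pt p) = lattice_pt (turn k p)"
proof (induction k arbitrary: p)
  case (Suc k)
  obtain x y where p: "p = (x, y)" by (cases p) auto
  have "rot60 (lattice_pt p) = lattice_pt (- y, x + y)" by (simp add: p lattice_pt_def rot60_pt)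
  then show ?case using Suc[of "(- y, x + y)"] by (simp add: p funpow_swap1)
qed simp

lemma placed_altdef: "placed (r, p) z = (rot60 ^^ r) z + lattice_pt p"
  by (cases p) (simp add: placed_def place_def lattice_pt_def)

lemma lattice_pt_add: "lattice_pt (x, y) + lattice_pt (u, v) = lattice_pt (x + u, y + v)"
  and lattice_pt_diff: "lattice_pt (x, y) - lattice_pt (u, v) = lattice_pt (x - u, y - v)"
  by (simp_all add: lattice_pt_def pt_arith)

lemma placed_lattice_pt [simp]: "placed a (lattice_pt p) = lattice_pt (move a p)"
proof (cases a)
  case (fields r x y)
  then show ?thesis
    by (cases "turn r p")
      (simp add: placed_altdef rot60_power_lattice_pt lattice_pt_add add.commute)
qed

lemma placed_composite: "placed (composite a b) = placed a \<circ> placed b"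
proof (rule ext)
  fix z
  obtain r x y where a: "a = (r, x, y)" by (cases a) auto
  obtain s p where b: "b = (s, p)" by (cases b) auto
  have "(rot60 ^^ r) (lattice_pt p) + lattice_pt (x, y) = lattice_pt (move a p)"
    using placed_lattice_pt[of a p] unfolding a placed_altdef .
  then have "placed a (placed b z) = (rot60 ^^ (r + s)) z + lattice_pt (move a p)"
    by (simp add: a b placed_altdef rot60_power_add funpow_add add.assoc)
  then show "placed (composite a b) z = (placed a \<circ> placed b) z"
    by (cases "move a p") (simp add: a b placed_altdef rot60_power_shift)
qed

lemma placed_0 [simp]: "placed (0, 0, 0) = id"
  by (simp add: placed_def place_def fun_eq_iff)

lemma turn_unit_inj: "turn r (1, 0) = turn s (1, 0) \<Longrightarrow> r < 6 \<Longrightarrow> s < 6 \<Longrightarrow> r = s"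
  by (auto simp: less_Suc_eq eval_nat_numeral)

text \<open>The image of the origin gives the translation, and the image of \<open>[1,0]\<close>
  then distinguishes the six rotations.\<close>

lemma placed_inj:
  assumes "placed a = placed b" "fst a < 6" "fst b < 6"
  shows "a = b"
proof -
  obtain r p s q where ab: "a = (r, p)" "b = (s, q)" by (cases a; cases b) auto
  have "placed a 0 = placed b 0" "placed a (lattice_pt (1, 0)) = placed b (lattice_pt (1, 0))"
    using assms by auto
  then have "lattice_pt p = lattice_pt q"
      "lattice_pt (turn r (1, 0)) + lattice_pt p = lattice_pt (turn s (1, 0)) + lattice_pt q"
    by (simp_all only: ab placed_altdef rot60_power_lattice_pt) (simp_all add: rot60_power)
  then show ?thesis using turn_unit_inj[of r s] assms by (simp add: ab)
qed

lemma fst_composite: "fst a < 6 \<Longrightarrow> fst b < 6 \<Longrightarrow> fst (composite a b) < 6"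
  by (cases a; cases b) auto

section \<open>Isometries\<close>

lemma direct_isometry_placed: "direct_isometry (placed a)"
proof (cases a)
  case (fields r x y)
  then show ?thesis unfolding direct_isometry_def
    by (intro exI[of _ "cis (of_nat r * (pi / 3))"] exI[of _ "lattice_pt (x, y)"])
      (simp add: placed_altdef rot60_power fun_eq_iff)
qed

lemma direct_isometry_comp:
  assumes "direct_isometry f" "direct_isometry g" shows "direct_isometry (f \<circ> g)"
proof -
  obtain a b c d where *: "norm a = 1" "f = (\<lambda>z. a * z + b)" "norm c = 1" "g = (\<lambda>z. c * z + d)"
    using assms unfolding direct_isometry_def by auto
  then show ?thesis unfolding direct_isometry_def
    by (intro exI[of _ "a * c"] exI[of _ "a * d + b"]) (auto simp: norm_mult algebra_simps)
qed

lemma direct_isometry_inverse: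
  assumes "direct_isometry f"
  obtains g where "direct_isometry g" "f \<circ> g = id" "g \<circ> f = id"
proof -
  obtain a b where *: "norm a = 1" "f = (\<lambda>z. a * z + b)"
    using assms unfolding direct_isometry_def by auto
  then have "a \<noteq> 0" by auto
  show thesis
  proof (rule that[of "\<lambda>z. inverse a * z + (- inverse a * b)"])
    show "direct_isometry (\<lambda>z. inverse a * z + (- inverse a * b))"
      unfolding direct_isometry_def using * by (metis inverse_1 norm_inverse)
  qed (use \<open>a \<noteq> 0\<close> in \<open>auto simp: * fun_eq_iff field_simps\<close>)
qed

lemma direct_isometry_cancel:
  assumes "direct_isometry f" "f \<circ> g = f \<circ> h" shows "g = h"
proof -
  obtain f' where "f' \<circ> f = id" using assms(1) by (rule direct_isometry_inverse)
  then show ?thesis using assms(2) by (metis comp_assoc id_comp)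
qed

lemma direct_isometry_isometry:
  assumes "direct_isometry f" shows "isometry f"
proof -
  obtain a b where "norm a = 1" and f: "f = (\<lambda>z. a * z + b)"
    using assms unfolding direct_isometry_def by auto
  then have "f z - f w = a * (z - w)" for z w by (simp add: f algebra_simps)
  then show ?thesis using \<open>norm a = 1\<close> by (simp add: isometry_def dist_norm norm_mult)
qed

lemma direct_isometry_open:
  assumes "direct_isometry f" "open U" shows "open (f ` U)"
proof -
  obtain g where g: "direct_isometry g" "f \<circ> g = id" "g \<circ> f = id"
    using assms(1) by (rule direct_isometry_inverse)
  have "f ` U = g -` U" using g(2,3) by (auto simp: fun_eq_iff) (metis image_eqI)
  moreover have "continuous_on UNIV g"
    using g(1) unfolding direct_isometry_def by (auto intro!: continuous_intros)
  ultimately show ?thesis using assms(2) by (simp add: continuous_on_open_vimage)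
qed

lemma direct_isometry_closed:
  assumes "direct_isometry f" "closed U" shows "closed (f ` U)"
proof -
  obtain g where g: "direct_isometry g" "f \<circ> g = id" "g \<circ> f = id"
    using assms(1) by (rule direct_isometry_inverse)
  have "f ` U = g -` U" using g(2,3) by (auto simp: fun_eq_iff) (metis image_eqI)
  moreover have "continuous_on UNIV g"
    using g(1) unfolding direct_isometry_def by (auto intro!: continuous_intros)
  ultimately show ?thesis using assms(2) by (simp add: continuous_on_closed_vimage)
qed

lemma direct_isometry_segment:
  assumes "direct_isometry f" shows "f ` closed_segment v w = closed_segment (f v) (f w)"
proof -
  obtain a b where f: "f = (\<lambda>z. a * z + b)"
    using assms unfolding direct_isometry_def by auto
  have "f ((1 - u) *\<^sub>R v + u *\<^sub>R w) = (1 - u) *\<^sub>R f v + u *\<^sub>R f w" for u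
    by (simp add: f algebra_simps scaleR_conv_of_real)
  then show ?thesis by (auto simp: closed_segment_def image_iff) metis
qed

section \<open>Hexagons\<close>

definition hexagon_set :: "hexagon \<Rightarrow> complex set" where
  "hexagon_set = (\<lambda>(a, a', b, b', c, c').
     {z. of_int a \<le> coord_x z \<and> coord_x z \<le> of_int a' \<and> of_int b \<le> coord_y z \<and>
       coord_y z \<le> of_int b' \<and> of_int c \<le> coord_x z + coord_y z \<and>
       coord_x z + coord_y z \<le> of_int c'})"

definition hexagon_interior :: "hexagon \<Rightarrow> complex set" where
  "hexagon_interior = (\<lambda>(a, a', b, b', c, c').
     {z. of_int a < coord_x z \<and> coord_x z < of_int a' \<and> of_int b < coord_y z \<and>
       coord_y z < of_int b' \<and> of_int c < coord_x z + coord_y z \<and>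
       coord_x z + coord_y z < of_int c'})"

lemma open_hexagon_interior: "open (hexagon_interior h)"
  by (cases h) (auto simp: hexagon_interior_def intro!: open_Collect_conj open_Collect_less
      continuous_intros)

lemma closed_hexagon_set: "closed (hexagon_set h)"
  by (cases h) (auto simp: hexagon_set_def intro!: closed_Collect_conj closed_Collect_le
      continuous_intros)

lemma hexagon_interior_subset: "hexagon_interior h \<subseteq> hexagon_set h"
  by (cases h) (auto simp: hexagon_interior_def hexagon_set_def)

lemma rot60_hexagon: "rot60 ` hexagon_set (a, a', b, b', c, c') =
    hexagon_set (- b', - b, c, c', a, a')"
proof (intro equalityI subsetI)
  fix z assume *: "z \<in> hexagon_set (- b', - b, c, c', a, a')"
  have "z = rot60 (pt (coord_x z + coord_y z) (- coord_x z))"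
    by (simp add: complex_eq_coord_iff)
  moreover have "pt (coord_x z + coord_y z) (- coord_x z) \<in> hexagon_set (a, a', b, b', c, c')"
    using * by (auto simp: hexagon_set_def)
  ultimately show "z \<in> rot60 ` hexagon_set (a, a', b, b', c, c')" by blast
qed (auto simp: hexagon_set_def)

lemma rot60_power_hexagon: "(rot60 ^^ k) ` hexagon_set h = hexagon_set (turn_hexagon k h)"
proof (induction k h rule: turn_hexagon.induct)
  case (2 k a a' b b' c c')
  have "(rot60 ^^ Suc k) ` hexagon_set (a, a', b, b', c, c') =
      (rot60 ^^ k) ` rot60 ` hexagon_set (a, a', b, b', c, c')"
    by (simp only: funpow_Suc_right image_comp)
  then show ?case using 2 by (simp add: rot60_hexagon del: funpow.simps)
qed simp

lemma placed_hexagon: "placed a ` hexagon_set h = hexagon_set (move_hexagon a h)"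
proof -
  obtain r x y where a: "a = (r, x, y)" by (cases a) auto
  obtain b b' c c' d d' where h: "turn_hexagon r h = (b, b', c, c', d, d')"
    by (cases "turn_hexagon r h") auto
  have "placed a ` hexagon_set h = (\<lambda>z. z + lattice_pt (x, y)) ` (rot60 ^^ r) ` hexagon_set h"
    by (simp add: a placed_altdef image_image)
  also have "\<dots> = hexagon_set (move_hexagon a h)"
  proof (intro equalityI subsetI)
    fix z assume "z \<in> hexagon_set (move_hexagon a h)"
    then have "z - lattice_pt (x, y) \<in> hexagon_set (b, b', c, c', d, d')"
      by (auto simp: a h hexagon_set_def lattice_pt_def)
    then show "z \<in> (\<lambda>z. z + lattice_pt (x, y)) ` (rot60 ^^ r) ` hexagon_set h"
      unfolding rot60_power_hexagon h by (metis diff_add_cancel image_eqI)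
  qed (unfold rot60_power_hexagon h, auto simp: a h hexagon_set_def lattice_pt_def)
  finally show ?thesis .
qed

text \<open>A common interior point is found by choosing s = x + y first and then x. The five
  inequalities make the interval for s nonempty, and the choice of s makes the one for x
  nonempty.\<close>

lemma overlap_interior:
  assumes "overlap h h'" shows "hexagon_interior h \<inter> hexagon_interior h' \<noteq> {}"
proof -
  obtain a a' b b' c c' where h: "h = (a, a', b, b', c, c')" by (cases h) auto
  obtain d d' e e' f f' where h': "h' = (d, d', e, e', f, f')" by (cases h') auto
  define p p' q q' r r' where defs: "p = max a d" "p' = min a' d'" "q = max b e"
    "q' = min b' e'" "r = max c f" "r' = min c' f'"
  have *: "p < p'" "q < q'" "r < r'" "p + q < r'" "r < p' + q'"
    using assms by (auto simp: h h' Let_def defs)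
  obtain s where s: "real_of_int (max r (p + q)) < s" "s < real_of_int (min r' (p' + q'))"
    using dense[of "real_of_int (max r (p + q))" "real_of_int (min r' (p' + q'))"] * by auto
  have s': "of_int r < s" "of_int p + of_int q < s" "s < of_int r'" "s < of_int p' + of_int q'"
    using s by (simp_all add: max_def min_def split: if_splits)
  have "max (of_int p) (s - of_int q') < min (real_of_int p') (s - of_int q)"
    using s' * by auto
  then obtain x where x: "max (of_int p) (s - of_int q') < x" "x < min (of_int p') (s - of_int q)"
    using dense by blast
  have "of_int p < x" "x < of_int p'" "of_int q < s - x" "s - x < of_int q'" using x by auto
  then have "pt x (s - x) \<in> hexagon_interior h \<inter> hexagon_interior h'"
    using s' unfolding defs by (auto simp: h h' hexagon_interior_def)
  then show ?thesis by blast
qed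

lemma convex_hexagon_set: "convex (hexagon_set h)"
proof -
  obtain a a' b b' c c' where h: "h = (a, a', b, b', c, c')" by (cases h) auto
  have "hexagon_set h = {z. of_int a \<le> coord_x z} \<inter> {z. coord_x z \<le> of_int a'} \<inter>
     {z. of_int b \<le> coord_y z} \<inter> {z. coord_y z \<le> of_int b'} \<inter>
     {z. of_int c \<le> coord_x z + coord_y z} \<inter> {z. coord_x z + coord_y z \<le> of_int c'}"
    by (auto simp: h hexagon_set_def)
  moreover have "linear coord_x" "linear coord_y" "linear (\<lambda>z. coord_x z + coord_y z)"
    by (auto intro!: linearI simp: algebra_simps)
  then have "convex {z. k \<le> coord_x z}" "convex {z. coord_x z \<le> k}"
      "convex {z. k \<le> coord_y z}" "convex {z. coord_y z \<le> k}"
      "convex {z. k \<le> coord_x z + coord_y z}" "convex {z. coord_x z + coord_y z \<le> k}" for k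
    using convex_linear_vimage[of coord_x "{k..}"] convex_linear_vimage[of coord_x "{..k}"]
      convex_linear_vimage[of coord_y "{k..}"] convex_linear_vimage[of coord_y "{..k}"]
      convex_linear_vimage[of "\<lambda>z. coord_x z + coord_y z" "{k..}"]
      convex_linear_vimage[of "\<lambda>z. coord_x z + coord_y z" "{..k}"]
    by (simp_all add: vimage_def)
  ultimately show ?thesis by (simp only: convex_Int)
qed

lemma rot60_power_opposite: "(rot60 ^^ (d + 3)) z = - (rot60 ^^ d) z"
proof -
  have "cis (of_nat (d + 3) * (pi / 3)) = cis (of_nat d * (pi / 3) + pi)"
    by (simp add: field_simps)
  also have "\<dots> = - cis (of_nat d * (pi / 3))"
    by (simp only: cis_mult[symmetric] cis_pi) simp
  finally show ?thesis by (simp only: rot60_power) simp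
qed

section \<open>Tiles and pieces as hexagons\<close>

lemma convex_pt:
  assumes "convex S" "pt x1 y1 \<in> S" "pt x2 y2 \<in> S" "0 \<le> t" "t \<le> 1"
    "x = x1 + t * (x2 - x1)" "y = y1 + t * (y2 - y1)"
  shows "pt x y \<in> S"
proof -
  have "(1 - t) *\<^sub>R pt x1 y1 + t *\<^sub>R pt x2 y2 \<in> S"
    using assms by (intro convexD) auto
  then show ?thesis
    by (simp add: assms scaleR_conv_of_real pt_arith algebra_simps)
qed

lemma convex_pt_horizontal:
  assumes "convex S" "pt x1 y \<in> S" "pt x2 y \<in> S" "x1 \<le> x" "x \<le> x2"
  shows "pt x y \<in> S"
proof (cases "x1 = x2")
  case False
  then have "x1 < x2" using assms by simp
  then show ?thesis
    by (intro convex_pt[OF assms(1-3), of "(x - x1) / (x2 - x1)"]) (use assms(4,5) in simp_all)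
qed (use assms in auto)

text \<open>For the harder inclusion the hexagon is swept by lines of constant y: each point lies on
  a chord whose ends are convex combinations of corners. For \<open>H_tile\<close> and
  \<open>F_tile\<close> the edges carrying these ends change at y = 0 and y = -1, whence the case
  distinctions.\<close>

lemma region_metatile: "region (metatile_shape k) = hexagon_set (tile_hexagon k)"
proof -
  define V where "V = fst ` set (metatile_marks k)"
  have "convex hull V \<subseteq> hexagon_set (tile_hexagon k)"
  proof (rule hull_minimal)
    show "V \<subseteq> hexagon_set (tile_hexagon k)"
      by (cases k) (simp_all add: V_def hexagon_set_def del: pt_0)
  qed (rule convex_hexagon_set)
  moreover have "hexagon_set (tile_hexagon k) \<subseteq> convex hull V"
  proof
    fix z assume z: "z \<in> hexagon_set (tile_hexagon k)"
    define x y where "x = coord_x z" "y = coord_y z"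
    then have zxy: "z = pt x y" by simp
    have V: "v \<in> V \<Longrightarrow> v \<in> convex hull V" for v by (rule hull_inc)
    note C = convex_convex_hull[of V]
    show "z \<in> convex hull V"
    proof (cases k)
      case T_tile
      have *: "0 \<le> x" "0 \<le> y" "x + y \<le> 3"
        using z by (auto simp: hexagon_set_def T_tile x_y_def)
      have "pt 0 0 \<in> V" "pt 3 0 \<in> V" "pt 0 3 \<in> V" by (auto simp: V_def T_tile)
      note V = this[THEN V]
      have "pt 0 y \<in> convex hull V"
        by (rule convex_pt[OF C V(1,3), of "y / 3"]) (use * in auto)
      moreover have "pt (3 - y) y \<in> convex hull V"
        by (rule convex_pt[OF C V(2,3), of "y / 3"]) (use * in auto)
      ultimately show ?thesis
        unfolding zxy by (rule convex_pt_horizontal[OF C]) (use * in auto)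
    next
      case H_tile
      have *: "0 \<le> x" "x \<le> 5" "- 1 \<le> y" "y \<le> 4" "0 \<le> x + y" "x + y \<le> 5"
        using z by (auto simp: hexagon_set_def H_tile x_y_def)
      have "pt 0 0 \<in> V" "pt 1 (-1) \<in> V" "pt 5 (-1) \<in> V" "pt 5 0 \<in> V" "pt 1 4 \<in> V" "pt 0 4 \<in> V"
        by (auto simp: V_def H_tile)
      note V = this[THEN V]
      show ?thesis
      proof (cases "y \<le> 0")
        case True
        have "pt (- y) y \<in> convex hull V"
          by (rule convex_pt[OF C V(1,2), of "- y"]) (use * True in auto)
        moreover have "pt 5 y \<in> convex hull V"
          by (rule convex_pt[OF C V(4,3), of "- y"]) (use * True in auto)
        ultimately show ?thesis
          unfolding zxy by (rule convex_pt_horizontal[OF C]) (use * in auto)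
      next
        case False
        have "pt 0 y \<in> convex hull V"
          by (rule convex_pt[OF C V(1,6), of "y / 4"]) (use * False in auto)
        moreover have "pt (5 - y) y \<in> convex hull V"
          by (rule convex_pt[OF C V(4,5), of "y / 4"]) (use * False in auto)
        ultimately show ?thesis
          unfolding zxy by (rule convex_pt_horizontal[OF C]) (use * in auto)
      qed
    next
      case P_tile
      have *: "- 2 \<le> y" "y \<le> 0" "0 \<le> x + y" "x + y \<le> 4"
        using z by (auto simp: hexagon_set_def P_tile x_y_def)
      have "pt 0 0 \<in> V" "pt 2 (-2) \<in> V" "pt 6 (-2) \<in> V" "pt 4 0 \<in> V"
        by (auto simp: V_def P_tile)
      note V = this[THEN V]
      have "pt (- y) y \<in> convex hull V"
        by (rule convex_pt[OF C V(1,2), of "- y / 2"]) (use * in auto)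
      moreover have "pt (4 - y) y \<in> convex hull V"
        by (rule convex_pt[OF C V(4,3), of "- y / 2"]) (use * in auto)
      ultimately show ?thesis
        unfolding zxy by (rule convex_pt_horizontal[OF C]) (use * in auto)
    next
      case F_tile
      have *: "x \<le> 5" "- 2 \<le> y" "y \<le> 0" "0 \<le> x + y" "x + y \<le> 4"
        using z by (auto simp: hexagon_set_def F_tile x_y_def)
      have "pt 0 0 \<in> V" "pt 2 (-2) \<in> V" "pt 5 (-2) \<in> V" "pt 5 (-1) \<in> V" "pt 4 0 \<in> V"
        by (auto simp: V_def F_tile)
      note V = this[THEN V]
      have left: "pt (- y) y \<in> convex hull V"
        by (rule convex_pt[OF C V(1,2), of "- y / 2"]) (use * in auto)
      show ?thesis
      proof (cases "y \<le> - 1")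
        case True
        have "pt 5 y \<in> convex hull V"
          by (rule convex_pt[OF C V(4,3), of "- y - 1"]) (use * True in auto)
        with left show ?thesis
          unfolding zxy by (rule convex_pt_horizontal[OF C]) (use * in auto)
      next
        case False
        have "pt (4 - y) y \<in> convex hull V"
          by (rule convex_pt[OF C V(5,4), of "- y"]) (use * False in auto)
        with left show ?thesis
          unfolding zxy by (rule convex_pt_horizontal[OF C]) (use * in auto)
      qed
    qed
  qed
  ultimately show ?thesis by (simp add: metatile_shape_def Let_def V_def)
qed

lemma piece_region_eq: "piece_region q = hexagon_set (piece_hexagon q)"
proof -
  have "{pt x y |x y. y \<ge> -1} = {z. coord_y z \<ge> -1}" "{pt x y |x y. y \<le> -1} = {z. coord_y z \<le> -1}"
    by (auto intro: pt_coord[symmetric])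
  then show ?thesis by (cases q) (auto simp: region_metatile hexagon_set_def)
qed

section \<open>Segments of metatiles and the tiles across them\<close>

lemma arcs_metatile:
  assumes "i < length (mark_list k)"
  shows "length (arcs (metatile_shape k)) = length (mark_list k)"
    "arcs (metatile_shape k) ! i =
      ([lattice_pt (fst (mark_list k ! i)),
        lattice_pt (fst (mark_list k ! (if Suc i < length (mark_list k) then Suc i else 0)))],
       snd (mark_list k ! i))"
proof -
  have m: "metatile_marks k = map (\<lambda>(p, l). (lattice_pt p, l)) (mark_list k)"
    by (cases k) (simp_all add: lattice_pt_def)
  show "length (arcs (metatile_shape k)) = length (mark_list k)"
    by (simp add: metatile_shape_def Let_def m)
  have "0 < length (mark_list k)" by (cases k) simp_all
  have "Suc i mod length (mark_list k) = (if Suc i < length (mark_list k) then Suc i else 0)"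
    using assms by (auto simp: le_less dest: Suc_leI not_less_eq[THEN iffD1])
  then show "arcs (metatile_shape k) ! i =
      ([lattice_pt (fst (mark_list k ! i)),
        lattice_pt (fst (mark_list k ! (if Suc i < length (mark_list k) then Suc i else 0)))],
       snd (mark_list k ! i))"
    using assms nth_map[of 0 "mark_list k" "\<lambda>(p, l). (lattice_pt p, l)"] \<open>0 < length (mark_list k)\<close>
    by (auto simp: metatile_shape_def Let_def m nth_rotate1 case_prod_beta)
qed

definition side :: "metatile \<Rightarrow> nat \<Rightarrow> (int \<times> int) \<times> (int \<times> int)" where
  "side k i = (fst (mark_list k ! i),
     fst (mark_list k ! (if Suc i < length (mark_list k) then Suc i else 0)))"

text \<open>The tiles of \<open>M\<close> that lie on the lattice of the frame \<open>f\<close>, in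
  the coordinates of that frame. Tiles off this lattice are simply absent; every search stays among
  tiles reached by crossing segments.\<close>

definition local_tiles :: "(metatile \<times> (complex \<Rightarrow> complex)) set \<Rightarrow> (complex \<Rightarrow> complex) \<Rightarrow> tile set" where
  "local_tiles M f = {(k, a). fst a < 6 \<and> (k, f \<circ> placed a) \<in> M}"

text \<open>Segments labelled A or B have length 3 and all others have length 1; each runs in one of
  the six lattice directions.\<close>

definition straight_side :: "metatile \<Rightarrow> nat \<Rightarrow> bool" where
  "straight_side k i \<longleftrightarrow> (case side k i of ((x, y), (u, v)) \<Rightarrow>
     list_ex (\<lambda>d. list_ex (\<lambda>l. (u - x, v - y) = turn d (l, 0)) [1, 3]) [0..<6])"

lemma straight_side:
  assumes "i < length (mark_list k)" shows "straight_side k i"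
proof -
  have "list_all (\<lambda>k. list_all (straight_side k) [0..<length (mark_list k)])
      [T_tile, H_tile, P_tile, F_tile]"
    by code_simp
  moreover have "k \<in> set [T_tile, H_tile, P_tile, F_tile]" by (cases k) auto
  ultimately show ?thesis using assms unfolding list_all_iff by auto
qed

lemma is_side_vector:
  assumes "i < length (mark_list k)"
  obtains d l where "d < 6" "0 < l"
    "lattice_pt (snd (side k i)) - lattice_pt (fst (side k i)) = of_real l * (rot60 ^^ d) (pt 1 0)"
proof -
  obtain x y u v where s: "side k i = ((x, y), (u, v))" by (metis surj_pair)
  then have "\<exists>d\<in>set [0..<6]. \<exists>l\<in>set [1, 3]. (u - x, v - y) = turn d (l, 0)"
    using straight_side[OF assms] by (simp only: straight_side_def list_ex_iff prod.case)
  then obtain d l where "d \<in> set [0..<6]" "l \<in> set [1, 3 :: int]" and "(u - x, v - y) = turn d (l, 0)"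
    by blast
  then have *: "d < 6" "l \<in> {1, 3}" "(u - x, v - y) = turn d (l, 0)"
    by (simp_all only: set_upt atLeastLessThan_iff list.set)
  have "(rot60 ^^ d) (lattice_pt (l, 0)) = of_real (of_int l) * (rot60 ^^ d) (pt 1 0)"
    by (simp add: lattice_pt_def rot60_power pt_def)
  then have "lattice_pt (u, v) - lattice_pt (x, y) = of_real (of_int l) * (rot60 ^^ d) (pt 1 0)"
    by (simp only: rot60_power_lattice_pt lattice_pt_diff *)
  then show thesis using that[of d "of_int l"] * s by auto
qed

text \<open>The linear part carries one lattice direction to another, so it is a rotation by a
  multiple of 60 degrees; the translation is then a difference of lattice points. An isometry
  preserves lengths, which forces \<open>l = l'\<close>.\<close>

lemma placed_exists:
  assumes "direct_isometry g" "g (lattice_pt p) = lattice_pt q" "g (lattice_pt p') = lattice_pt q'"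
    and "lattice_pt p' - lattice_pt p = of_real l * (rot60 ^^ d) (pt 1 0)" "0 < l" "d < 6"
    and "lattice_pt q' - lattice_pt q = of_real l' * (rot60 ^^ d') (pt 1 0)" "0 < l'" "d' < 6"
  obtains r x y where "r < 6" "g = placed (r, x, y)" "(x, y) = (fst q - fst (turn r p), snd q - snd (turn r p))"
    "move (r, x, y) p = q" "move (r, x, y) p' = q'"
proof -
  obtain a b where a: "norm a = 1" and g: "g = (\<lambda>z. a * z + b)"
    using assms(1) unfolding direct_isometry_def by auto
  have e: "norm (pt 1 0) = 1" "pt 1 0 \<noteq> 0"
    by (simp_all add: pt_def cmod_def power2_eq_square complex_eq_iff)
  have *: "a * (of_real l * (rot60 ^^ d) (pt 1 0)) = of_real l' * (rot60 ^^ d') (pt 1 0)"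
    using assms unfolding g by (metis add_diff_cancel_right right_diff_distrib)
  then have "norm (a * (of_real l * (rot60 ^^ d) (pt 1 0))) = norm (of_real l' * (rot60 ^^ d') (pt 1 0))"
    by simp
  then have "l = l'"
    using a e assms(5,8) by (simp add: norm_mult rot60_power)
  then have c: "a * cis (of_nat d * (pi / 3)) = cis (of_nat d' * (pi / 3))"
    using * e assms(5) by (simp add: rot60_power mult.assoc[symmetric])
  \<comment> \<open>This is \<open>d' - d\<close> reduced modulo 6.\<close>
  define r where "r = (if d \<le> d' then d' - d else d' + 6 - d)"
  have "r < 6" using assms by (auto simp: r_def)
  have "cis (of_nat r * (pi / 3)) * cis (of_nat d * (pi / 3)) = cis (of_nat d' * (pi / 3))"
  proof (cases "d \<le> d'")
    case False
    then have "cis (of_nat r * (pi / 3)) * cis (of_nat d * (pi / 3)) =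
        cis (of_nat d' * (pi / 3) + 2 * pi)"
      using assms(6,9) by (simp add: r_def cis_mult of_nat_diff field_simps)
    also have "\<dots> = cis (of_nat d' * (pi / 3)) * cis (2 * pi)" by (simp only: cis_mult)
    finally show ?thesis by simp
  qed (simp add: r_def cis_mult of_nat_diff field_simps)
  then have "a = cis (of_nat r * (pi / 3))"
    using c by (metis cis_neq_zero mult_right_cancel)
  then have g': "g z = (rot60 ^^ r) z + b" for z by (simp add: g rot60_power)
  then have b: "b = lattice_pt q - lattice_pt (turn r p)"
    using assms(2) by (simp add: rot60_power_lattice_pt algebra_simps)
  define x y where "x = fst q - fst (turn r p)" "y = snd q - snd (turn r p)"
  have "b = lattice_pt (x, y)"
    unfolding b x_y_def using lattice_pt_diff[of "fst q" "snd q" "fst (turn r p)" "snd (turn r p)"] by simp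
  then have "g = placed (r, x, y)" by (auto simp: fun_eq_iff g' placed_altdef)
  moreover from this have "move (r, x, y) p = q" "move (r, x, y) p' = q'"
    using assms(2,3) by simp_all
  ultimately show thesis using that[of r x y] \<open>r < 6\<close> by (simp add: x_y_def)
qed

text \<open>Candidates whose segment runs in the same direction as the given one are on its wrong side;
  they are all refuted by overlap.\<close>

definition candidate :: "metatile \<Rightarrow> nat \<Rightarrow> nat \<Rightarrow> int \<times> int \<Rightarrow> placement" where
  "candidate l j r q = (case (q, turn r (fst (side l j))) of ((x, y), (u, v)) \<Rightarrow> (r, x - u, y - v))"

definition candidate_listed :: "metatile \<Rightarrow> nat \<Rightarrow> metatile \<Rightarrow> nat \<Rightarrow> nat \<Rightarrow> int \<times> int \<Rightarrow> int \<times> int \<Rightarrow> bool" where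
  "candidate_listed k i l j r q q' \<longleftrightarrow>
     (if move (candidate l j r q) (snd (side l j)) = q' then
        (l, candidate l j r q) = (k, 0, 0, 0) \<or> clash (k, 0, 0, 0) (l, candidate l j r q) \<or>
        List.member (with_excluded excluded_neighbours k i) (l, candidate l j r q)
      else True)"

text \<open>Both orders of the end points are tried because the matching rules identify segments
  only as point sets.\<close>

definition candidates_listed :: "metatile \<Rightarrow> nat \<Rightarrow> metatile \<Rightarrow> bool" where
  "candidates_listed k i l \<longleftrightarrow> list_all (\<lambda>j.
     if snd (mark_list l ! j) = opposite (snd (mark_list k ! i)) then list_all (\<lambda>r.
       candidate_listed k i l j r (fst (side k i)) (snd (side k i)) \<and>
       candidate_listed k i l j r (snd (side k i)) (fst (side k i))) [0..<6]
     else True) [0..<length (mark_list l)]"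

lemma all_candidates_listed:
  assumes "i < length (mark_list k)" shows "candidates_listed k i l"
proof -
  have "list_all (\<lambda>k. list_all (\<lambda>i. list_all (candidates_listed k i)
      [T_tile, H_tile, P_tile, F_tile]) [0..<length (mark_list k)]) [T_tile, H_tile, P_tile, F_tile]"
    by code_simp
  moreover have "k \<in> set [T_tile, H_tile, P_tile, F_tile]" "l \<in> set [T_tile, H_tile, P_tile, F_tile]"
    by (cases k; cases l; simp)+
  ultimately show ?thesis using assms unfolding list_all_iff by auto
qed

lemma candidates_complete:
  assumes "i < length (mark_list k)" "j < length (mark_list l)"
    and "snd (mark_list l ! j) = opposite (snd (mark_list k ! i))"
    and "(q, q') = side k i \<or> (q', q) = side k i" "r < 6"
    and "move (candidate l j r q) (snd (side l j)) = q'"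
  shows "(l, candidate l j r q) = (k, 0, 0, 0) \<or> clash (k, 0, 0, 0) (l, candidate l j r q) \<or>
    (l, candidate l j r q) \<in> set (with_excluded excluded_neighbours k i)"
proof -
  have "j \<in> set [0..<length (mark_list l)]" using assms(2) by simp
  from bspec[OF all_candidates_listed[OF assms(1), unfolded candidates_listed_def list_all_iff] this]
  have "\<forall>r\<in>set [0..<6]. candidate_listed k i l j r (fst (side k i)) (snd (side k i)) \<and>
      candidate_listed k i l j r (snd (side k i)) (fst (side k i))"
    by (simp only: assms(3) if_True simp_thms)
  moreover have "r \<in> set [0..<6]" using assms(5) by simp
  ultimately have "candidate_listed k i l j r (fst (side k i)) (snd (side k i)) \<and>
      candidate_listed k i l j r (snd (side k i)) (fst (side k i))"
    by (rule bspec)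
  then have "candidate_listed k i l j r q q'" using assms(4) by (metis fst_conv snd_conv)
  then show ?thesis unfolding candidate_listed_def by (simp only: assms(6) if_True List.member_iff)
qed


lemma tiling_direct: "is_tiling G M \<Longrightarrow> (k, f) \<in> M \<Longrightarrow> direct_isometry f"
  unfolding is_tiling_def by blast

lemma tiling_interior_disjoint:
  assumes "is_tiling G M" "(k, f) \<in> M" "(l, g) \<in> M" "(k, f) \<noteq> (l, g)"
  shows "interior (f ` region (G k)) \<inter> interior (g ` region (G l)) = {}"
  using assms unfolding is_tiling_def by blast

text \<open>Overlapping hexagons share a nonempty open set, and its image under \<open>f\<close>
  would lie in the interiors of two different tiles of \<open>M\<close>.\<close>

lemma local_no_clash:
  assumes "is_tiling metatile_shape M" "direct_isometry f"
    and "t \<in> local_tiles M f" "u \<in> local_tiles M f"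
  shows "\<not> clash t u"
proof
  assume clash: "clash t u"
  obtain k a l b where tu: "t = (k, a)" "u = (l, b)" by (cases t; cases u) auto
  have M: "(k, f \<circ> placed a) \<in> M" "(l, f \<circ> placed b) \<in> M" "fst a < 6" "fst b < 6"
    using assms(3,4) by (auto simp: local_tiles_def tu)
  have "(k, f \<circ> placed a) \<noteq> (l, f \<circ> placed b)"
    using clash placed_inj[of a b] direct_isometry_cancel[OF assms(2)] M
    by (auto simp: clash_def tu)
  from tiling_interior_disjoint[OF assms(1) M(1,2) this]
  have disj: "interior (f ` hexagon_set (move_hexagon a (tile_hexagon k))) \<inter>
      interior (f ` hexagon_set (move_hexagon b (tile_hexagon l))) = {}"
    by (simp only: region_metatile image_comp[symmetric] placed_hexagon)
  define U where "U = hexagon_interior (move_hexagon a (tile_hexagon k)) \<inter>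
    hexagon_interior (move_hexagon b (tile_hexagon l))"
  have "U \<noteq> {}"
    using clash overlap_interior unfolding U_def by (auto simp: clash_def tu simp del: move_hexagon.simps)
  moreover have "open (f ` U)"
    unfolding U_def by (intro direct_isometry_open[OF assms(2)] open_Int open_hexagon_interior)
  moreover have "f ` U \<subseteq> f ` hexagon_set (move_hexagon a (tile_hexagon k))"
      "f ` U \<subseteq> f ` hexagon_set (move_hexagon b (tile_hexagon l))"
    unfolding U_def using hexagon_interior_subset by blast+
  ultimately show False
    using disj interior_maximal[of "f ` U"] by blast
qed

lemma polyline_pair [simp]: "polyline [v, w] = closed_segment v w"
  by (auto simp: polyline_def)

text \<open>Seen from the tile itself, the tile across the segment is placed by a map
  \<open>\<phi>\<close> that takes one lattice segment onto another. So \<open>\<phi>\<close> is a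
  lattice placement and the finite list of candidates applies; the tile itself and the overlapping
  candidates cannot occur.\<close>

lemma local_neighbour:
  assumes "is_tiling metatile_shape M" "obeys_matching_rules metatile_shape M" "direct_isometry f"
    and "t \<in> local_tiles M f" "i < length (mark_list (fst t))"
  shows "\<exists>u\<in>set (neighbours_of (with_excluded excluded_neighbours) t i). u \<in> local_tiles M f"
proof -
  obtain k a where t: "t = (k, a)" by (cases t)
  define h where "h = f \<circ> placed a"
  have M: "(k, h) \<in> M" "fst a < 6" using assms(4) by (auto simp: t local_tiles_def h_def)
  have i: "i < length (mark_list k)" using assms(5) t by simp
  have h: "direct_isometry h"
    unfolding h_def by (intro direct_isometry_comp assms direct_isometry_placed)
  define v w where "v = fst (side k i)" "w = snd (side k i)"
  have "([lattice_pt v, lattice_pt w], snd (mark_list k ! i)) \<in> set (arcs (metatile_shape k))"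
    using arcs_metatile[OF i] nth_mem[of i "arcs (metatile_shape k)"] i by (simp add: v_w_def side_def)
  then obtain l g vs z where g: "(l, g) \<in> M" "(l, g) \<noteq> (k, h)" "(vs, z) \<in> set (arcs (metatile_shape l))"
      "g ` polyline vs = h ` closed_segment (lattice_pt v) (lattice_pt w)"
      "z = opposite (snd (mark_list k ! i))"
    using assms(2) M(1) unfolding obeys_matching_rules_def by (fastforce simp del: set_simps)
  obtain j where "j < length (arcs (metatile_shape l))" "arcs (metatile_shape l) ! j = (vs, z)"
    using g(3) by (metis in_set_conv_nth)
  moreover have "0 < length (mark_list l)" by (cases l) auto
  ultimately have j: "j < length (mark_list l)" using arcs_metatile(1)[of 0 l] by simp
  define v' w' where "v' = fst (side l j)" "w' = snd (side l j)"
  have vs: "vs = [lattice_pt v', lattice_pt w']" "z = snd (mark_list l ! j)"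
    using arcs_metatile(2)[OF j] \<open>arcs (metatile_shape l) ! j = (vs, z)\<close> by (simp_all add: v'_w'_def side_def)
  obtain h' where h': "direct_isometry h'" "h \<circ> h' = id" "h' \<circ> h = id"
    using h by (rule direct_isometry_inverse)
  define \<phi> where "\<phi> = h' \<circ> g"
  have \<phi>: "direct_isometry \<phi>"
    unfolding \<phi>_def using h' tiling_direct[OF assms(1) g(1)] by (intro direct_isometry_comp)
  have "\<phi> ` closed_segment (lattice_pt v') (lattice_pt w') =
      (h' \<circ> h) ` closed_segment (lattice_pt v) (lattice_pt w)"
    using g(4) by (simp only: \<phi>_def vs polyline_pair image_comp[symmetric])
  then have "closed_segment (\<phi> (lattice_pt v')) (\<phi> (lattice_pt w')) =
      closed_segment (lattice_pt v) (lattice_pt w)"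
    by (simp add: direct_isometry_segment[OF \<phi>] h'(3))
  then have "{\<phi> (lattice_pt v'), \<phi> (lattice_pt w')} = {lattice_pt v, lattice_pt w}"
    by (simp add: closed_segment_eq)
  then obtain q q' where q: "\<phi> (lattice_pt v') = lattice_pt q" "\<phi> (lattice_pt w') = lattice_pt q'"
      "(q, q') = (v, w) \<or> (q', q) = (v, w)"
    by (metis doubleton_eq_iff)
  obtain d m where d: "d < 6" "0 < m" "lattice_pt w' - lattice_pt v' = of_real m * (rot60 ^^ d) (pt 1 0)"
    using is_side_vector[OF j] unfolding v'_w'_def by metis
  obtain d' m' where d': "d' < 6" "0 < m'"
      "lattice_pt q' - lattice_pt q = of_real m' * (rot60 ^^ d') (pt 1 0)"
  proof -
    obtain d' m' where *: "d' < 6" "0 < m'"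
      "lattice_pt w - lattice_pt v = of_real m' * (rot60 ^^ d') (pt 1 0)"
      using is_side_vector[OF i] unfolding v_w_def by metis
    show thesis
    proof (cases "(q, q') = (v, w)")
      case True
      then show thesis using that * by blast
    next
      case False
      \<comment> \<open>Reversing a segment adds 3 to its direction, again reduced modulo 6.\<close>
      then have "lattice_pt q' - lattice_pt q = - (lattice_pt w - lattice_pt v)" using q(3) by auto
      also have "\<dots> = of_real m' * (rot60 ^^ (d' + 3)) (pt 1 0)"
        unfolding * by (simp add: rot60_power_opposite)
      also have "\<dots> = of_real m' * (rot60 ^^ (if d' + 3 < 6 then d' + 3 else d' - 3)) (pt 1 0)"
        using rot60_power_shift[of "d' + 3" "pt 1 0"] by simp
      finally have "lattice_pt q' - lattice_pt q =
        of_real m' * (rot60 ^^ (if d' + 3 < 6 then d' + 3 else d' - 3)) (pt 1 0)" .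
      moreover have "(if d' + 3 < 6 then d' + 3 else d' - 3) < 6" using *(1) by auto
      ultimately show thesis using that *(2) by blast
    qed
  qed
  obtain r x y where r: "r < 6" "\<phi> = placed (r, x, y)"
      "(x, y) = (fst q - fst (turn r v'), snd q - snd (turn r v'))" "move (r, x, y) w' = q'"
    using placed_exists[OF \<phi> q(1,2) d(3,2,1) d'(3,2,1)] by metis
  define b where "b = candidate l j r q"
  have b: "b = (r, x, y)"
    unfolding b_def candidate_def using r(3) by (auto simp: v'_w'_def split: prod.splits)
  have "g = h \<circ> placed b"
    unfolding b r(2)[symmetric] \<phi>_def using h'(2) by (metis comp_assoc id_comp)
  then have "(l, composite a b) \<in> local_tiles M f"
    using g(1) M(2) r(1) fst_composite[of a b]
    by (simp add: local_tiles_def placed_composite h_def comp_assoc b del: composite.simps)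
  moreover have "(l, b) \<noteq> (k, 0, 0, 0)"
    using g(2) \<open>g = h \<circ> placed b\<close> by auto
  moreover have "\<not> clash (k, 0, 0, 0) (l, b)"
  proof (rule local_no_clash[OF assms(1) h])
    show "(k, 0, 0, 0) \<in> local_tiles M h" using M by (simp add: local_tiles_def)
    show "(l, b) \<in> local_tiles M h"
      using g(1) r(1) \<open>g = h \<circ> placed b\<close> by (simp add: local_tiles_def b)
  qed
  ultimately have "(l, b) \<in> set (with_excluded excluded_neighbours k i)"
    using candidates_complete[OF i j _ _ r(1), of q q'] g(5) q(3) r(4) vs(2)
    by (auto simp: b_def[symmetric] b v_w_def v'_w'_def simp del: move.simps)
  then have "(l, composite a b) \<in> set (neighbours_of (with_excluded excluded_neighbours) t i)"
    by (force simp: neighbours_of_def t)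
  then show ?thesis using \<open>(l, composite a b) \<in> local_tiles M f\<close> by blast
qed

lemma local_tiles_rebase:
  assumes "fst a < 6" "(l, composite a b) \<in> local_tiles M f" "fst b < 6"
  shows "(l, b) \<in> local_tiles M (f \<circ> placed a)"
  using assms by (auto simp: local_tiles_def placed_composite comp_assoc)

text \<open>Each excluded neighbour is refuted with the help of the later ones in the list only.\<close>

lemma exclude_neighbours:
  assumes "check_excluded es"
    and "\<And>f. direct_isometry f \<Longrightarrow> consistent (with_excluded es) (local_tiles M f)"
    and "\<And>k i u c. (k, i, u, c) \<in> set es \<Longrightarrow> fst (snd u) < 6" "direct_isometry f"
  shows "consistent neighbours (local_tiles M f)"
  using assms
proof (induction es arbitrary: f)
  case Nil
  then show ?case by (simp add: with_excluded_def[abs_def])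
next
  case (Cons e es)
  obtain k i u c where e: "e = (k, i, u, c)" by (cases e)
  have "consistent (with_excluded es) (local_tiles M f)" if f: "direct_isometry f" for f
    unfolding consistent_def
  proof (intro conjI ballI allI impI)
    fix t j assume t: "t \<in> local_tiles M f" "j < length (mark_list (fst t))"
    obtain k' a where ta: "t = (k', a)" by (cases t)
    obtain v where v: "v \<in> set (neighbours_of (with_excluded (e # es)) t j)" "v \<in> local_tiles M f"
      using consistent_neighbour[OF Cons.prems(2)[OF f] t] .
    then obtain l b where "(l, b) \<in> set (with_excluded (e # es) k' j)" "v = (l, composite a b)"
      by (auto simp: neighbours_of_def ta)
    with v have b: "(l, b) \<in> set (with_excluded (e # es) k' j)"
        "(l, composite a b) \<in> local_tiles M f" by simp_all
    have "(l, b) \<in> set (with_excluded es k' j)"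
    proof (rule ccontr)
      assume "\<not> ?thesis"
      then have eq: "k' = k" "j = i" "u = (l, b)"
        using b(1) by (auto simp: with_excluded_def e split: if_splits)
      have "fst b < 6" using Cons.prems(3)[of k i u c] by (simp add: e eq)
      moreover have a: "fst a < 6" "(k, f \<circ> placed a) \<in> M"
        using t(1) by (simp_all add: ta local_tiles_def eq)
      \<comment> \<open>Moving the frame onto the tile brings the pair into the position from which
        the certificate starts; this is why consistency is assumed for every frame.\<close>
      ultimately have "{u, (k, 0, 0, 0)} \<subseteq> local_tiles M (f \<circ> placed a)"
        using local_tiles_rebase[OF _ b(2)] by (simp add: eq local_tiles_def)
      moreover have "consistent (with_excluded (e # es)) (local_tiles M (f \<circ> placed a))"
        by (intro Cons.prems direct_isometry_comp f direct_isometry_placed)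
      ultimately show False
        using check_sound(1)[of "with_excluded (e # es)" _ "[u, (k, 0, 0, 0)]" "\<lambda>_. False" c]
          Cons.prems(1) by (simp add: e)
    qed
    then show "\<exists>u\<in>set (neighbours_of (with_excluded es) t j). u \<in> local_tiles M f"
      using b(2) by (force simp: neighbours_of_def ta)
  next
    fix t u assume "t \<in> local_tiles M f" "u \<in> local_tiles M f"
    then show "\<not> clash t u" using consistent_no_clash[OF Cons.prems(2)[OF f]] by blast
  qed
  moreover have "check_excluded es" using Cons.prems(1) by (simp add: e)
  moreover have "fst (snd u) < 6" if "(k, i, u, c) \<in> set es" for k i u c
    using that Cons.prems(3)[of k i u c] by simp
  ultimately show ?case using Cons.IH[OF _ _ _ Cons.prems(4)] by blast
qed

lemma consistent_local_tiles:
  assumes "is_tiling metatile_shape M" "obeys_matching_rules metatile_shape M" "direct_isometry f"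
  shows "consistent neighbours (local_tiles M f)"
proof (rule exclude_neighbours[OF check_excluded_neighbours _ _ assms(3)])
  show "consistent (with_excluded excluded_neighbours) (local_tiles M g)" if "direct_isometry g" for g
    unfolding consistent_def
    using local_neighbour[OF assms(1,2) that] local_no_clash[OF assms(1) that] by blast
  have "list_all (\<lambda>(k, i, u, c). fst (snd u) < 6) excluded_neighbours"
    by code_simp
  then show "(k, i, u, c) \<in> set excluded_neighbours \<Longrightarrow> fst (snd u) < 6" for k i u c
    by (auto simp: list_all_iff)
qed

section \<open>Boundaries of supertiles\<close>

text \<open>The points where the floors of \<open>x\<close>, \<open>y\<close> and \<open>x + y\<close> take given values form an open unit triangle,
  or no cell at all. A lattice step is a boundary edge iff the triangle on its left belongs to the
  region and the one on its right does not.\<close>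

definition cell_set :: "int \<times> int \<times> int \<Rightarrow> complex set" where
  "cell_set = (\<lambda>(a, b, c). hexagon_interior (a, a + 1, b, b + 1, c, c + 1))"

fun hexagon_has_cell :: "int \<times> int \<times> int \<Rightarrow> hexagon \<Rightarrow> bool" where
  "hexagon_has_cell (u, v, w) (a, a', b, b', c, c') \<longleftrightarrow>
     a \<le> u \<and> u < a' \<and> b \<le> v \<and> v < b' \<and> c \<le> w \<and> w < c'"

text \<open>The six unit triangles around \<open>p\<close> in counterclockwise order, each given by
  the floors of x, y and x + y. Number \<open>k\<close> lies to the left of the edge that leaves
  \<open>p\<close> in direction \<open>k\<close>.\<close>

definition left_cell :: "nat \<Rightarrow> int \<times> int \<Rightarrow> int \<times> int \<times> int" where
  "left_cell k p = (case p of (x, y) \<Rightarrow>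
     [(x, y, x + y), (x - 1, y, x + y), (x - 1, y, x + y - 1), (x - 1, y - 1, x + y - 1),
      (x, y - 1, x + y - 1), (x, y - 1, x + y)] ! k)"

definition step :: "nat \<Rightarrow> int \<times> int \<Rightarrow> int \<times> int" where
  "step k p = (case (p, turn k (1, 0)) of ((x, y), (u, v)) \<Rightarrow> (x + u, y + v))"

definition supertile_hexagons :: "metatile \<Rightarrow> hexagon list" where
  "supertile_hexagons k = map (\<lambda>(q, b). move_hexagon b (piece_hexagon q)) (piece_list k)"

text \<open>The triangle to the right of an edge is the one to the left of the reversed
  edge.\<close>

definition is_boundary_step :: "hexagon list \<Rightarrow> int \<times> int \<Rightarrow> nat \<Rightarrow> bool" where
  "is_boundary_step hs p k \<longleftrightarrow> list_ex (hexagon_has_cell (left_cell k p)) hs \<and>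
     \<not> list_ex (hexagon_has_cell (left_cell (if k < 3 then k + 3 else k - 3) (step k p))) hs"

text \<open>Equality with a one-element list contains two facts: the step to the next vertex is a
  boundary step, and it is the only one leaving the vertex.\<close>

definition is_boundary_path :: "hexagon list \<Rightarrow> (int \<times> int) list \<Rightarrow> bool" where
  "is_boundary_path hs p \<longleftrightarrow> distinct p \<and> length p > 1 \<and>
     list_all (\<lambda>(u, v). map (\<lambda>k. step k u) (filter (is_boundary_step hs u) [0..<6]) = [v])
       (zip p (tl p))"

lemma supertile_pieces_eq:
  "supertile_pieces k = (\<lambda>(q, b). (q, placed b)) ` set (piece_list k)"
  by (cases k) (simp_all add: placed_def)

lemma supertile_region_eq:
  "supertile_region k = (\<Union>h\<in>set (supertile_hexagons k). hexagon_set h)"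
  by (simp add: supertile_region_def supertile_pieces_eq supertile_hexagons_def piece_region_eq
      placed_hexagon case_prod_beta)

text \<open>The bounds are integers and no integer lies strictly between two consecutive ones, so a
  cell lies either inside a hexagon or outside it.\<close>

lemma mem_hexagon_cell:
  assumes "z \<in> cell_set c" shows "z \<in> hexagon_set h \<longleftrightarrow> hexagon_has_cell c h"
proof -
  have *: "of_int a \<le> t \<longleftrightarrow> a \<le> u" "t \<le> of_int a \<longleftrightarrow> u < a"
    if "of_int u < t" "t < of_int (u + 1)" for a u :: int and t :: real
    using that by linarith+
  show ?thesis
    using assms by (cases c; cases h)
      (auto simp: cell_set_def hexagon_interior_def hexagon_set_def * simp del: of_int_add)
qed

lemma mem_supertile_cell:
  assumes "z \<in> cell_set c"
  shows "z \<in> supertile_region k \<longleftrightarrow> list_ex (hexagon_has_cell c) (supertile_hexagons k)"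
  using mem_hexagon_cell[OF assms] by (auto simp: supertile_region_eq list_ex_iff)

lemma coord_i [simp]:
  "coord_x (\<i> * z) = (- coord_x z - 2 * coord_y z) / sqrt 3"
  "coord_y (\<i> * z) = (2 * coord_x z + coord_y z) / sqrt 3"
proof -
  have "sqrt 3 * (sqrt 3 * t) = 3 * t" for t by (simp add: mult.assoc[symmetric])
  then show "coord_x (\<i> * z) = (- coord_x z - 2 * coord_y z) / sqrt 3"
      "coord_y (\<i> * z) = (2 * coord_x z + coord_y z) / sqrt 3"
    by (simp_all add: coord_x_def coord_y_def field_simps)
qed

lemma lattice_pt_coord [simp]:
  "coord_x (lattice_pt p) = of_int (fst p)" "coord_y (lattice_pt p) = of_int (snd p)"
  by (cases p; simp add: lattice_pt_def)+

lemma step_eq: "lattice_pt (step k p) = lattice_pt p + (rot60 ^^ k) (pt 1 0)"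
proof -
  have "(rot60 ^^ k) (pt 1 0) = lattice_pt (turn k (1, 0))"
    using rot60_power_lattice_pt[of k "(1, 0)"] by (simp add: lattice_pt_def)
  then show ?thesis
    by (cases p; cases "turn k (1, 0)") (simp add: step_def lattice_pt_add)
qed

text \<open>A small displacement to the left of an interior point of the edge cannot leave the
  adjacent triangle, provided that it is small compared with the distances to both end
  points.\<close>

lemma eventually_left_cell:
  assumes "k < 6" "0 < s" "s < 1"
    and "z = lattice_pt p + of_real s * (lattice_pt (step k p) - lattice_pt p)"
  shows "eventually (\<lambda>\<epsilon>. z + of_real \<epsilon> * \<i> * (lattice_pt (step k p) - lattice_pt p)
    \<in> cell_set (left_cell k p)) (at_right 0)"
proof -
  have "z + of_real \<epsilon> * \<i> * (lattice_pt (step k p) - lattice_pt p) \<in> cell_set (left_cell k p)"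
    if \<epsilon>: "0 < \<epsilon>" "\<epsilon> < min s (1 - s) / 2" for \<epsilon>
  proof -
    \<comment> \<open>In lattice coordinates the displacement is \<open>\<eta>\<close> times an
      integer vector, and each of x, y, x + y changes by at most 2 \<open>\<eta>\<close>.\<close>
    define \<eta> where "\<eta> = \<epsilon> / sqrt 3"
    have "\<eta> \<le> \<epsilon>" using \<epsilon> by (simp add: \<eta>_def divide_le_eq)
    then have \<eta>: "0 < \<eta>" "2 * \<eta> < s" "2 * \<eta> < 1 - s"
      using \<epsilon> by (auto simp: \<eta>_def)
    obtain x y where p: "p = (x, y)" by (cases p)
    obtain u v where t: "turn k (1, 0) = (u, v)" by (cases "turn k (1, 0)")
    define w where "w = z + of_real \<epsilon> * \<i> * (lattice_pt (step k p) - lattice_pt p)"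
    have w: "coord_x w = x + s * u + \<eta> * (- u - 2 * v)" "coord_y w = y + s * v + \<eta> * (2 * u + v)"
      by (simp_all add: w_def assms(4) p t step_def \<eta>_def mult.assoc)
    have "w \<in> cell_set (left_cell k p)"
      using assms(1) t \<eta> w unfolding less_Suc_eq numeral_eq_Suc pred_numeral_simps BitM.simps
      by (auto simp: cell_set_def hexagon_interior_def left_cell_def p)
    then show ?thesis by (simp add: w_def)
  qed
  then show ?thesis
    using assms(2,3) by (auto simp: eventually_at_right intro!: exI[of _ "min s (1 - s) / 2"])
qed

text \<open>Close to the edge both test points stay in fixed cells, so the limit condition is
  eventually constant and equals the combinatorial test, independently of the point on the
  edge.\<close>

lemma boundary_edge_step:
  assumes "k < 6"
  shows "boundary_edge (supertile_region t) (lattice_pt p) (lattice_pt (step k p)) \<longleftrightarrow>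
    is_boundary_step (supertile_hexagons t) p k"
proof -
  define q k' where "q = step k p" "k' = (if k < 3 then k + 3 else k - 3)"
  have k': "k' < 6" using assms by (auto simp: q_k'_def)
  have opp: "(rot60 ^^ k') z = - (rot60 ^^ k) z" for z
    using rot60_power_opposite[of k z] rot60_power_opposite[of "k - 3" z] by (auto simp: q_k'_def)
  then have bk: "step k' q = p"
    using step_eq[of k' q] step_eq[of k p] by (simp add: q_k'_def(1)[symmetric])
  define d where "d = lattice_pt q - lattice_pt p"
  have d: "d = (rot60 ^^ k) (pt 1 0)" using step_eq[of k p] by (simp add: d_def q_k'_def)
  have "pt 1 0 \<noteq> 0" by (simp add: pt_def complex_eq_iff)
  then have "d \<noteq> 0" by (simp add: d rot60_power)
  have inside: "eventually (\<lambda>\<epsilon>. (z + of_real \<epsilon> * \<i> * d \<in> supertile_region t \<and>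
        z - of_real \<epsilon> * \<i> * d \<notin> supertile_region t) \<longleftrightarrow>
        is_boundary_step (supertile_hexagons t) p k) (at_right 0)"
    if z: "z \<in> open_segment (lattice_pt p) (lattice_pt q)" for z
  proof -
    obtain s where s: "0 < s" "s < 1" "z = (1 - s) *\<^sub>R lattice_pt p + s *\<^sub>R lattice_pt q"
      using z by (auto simp: in_segment)
    have "z = lattice_pt p + of_real s * (lattice_pt (step k p) - lattice_pt p)"
      by (simp add: s q_k'_def scaleR_conv_of_real algebra_simps)
    from eventually_left_cell[OF assms s(1,2) this]
    have "eventually (\<lambda>\<epsilon>. z + of_real \<epsilon> * \<i> * d \<in> cell_set (left_cell k p)) (at_right 0)"
      by (simp add: d_def q_k'_def)
    moreover have "z = lattice_pt q + of_real (1 - s) * (lattice_pt (step k' q) - lattice_pt q)"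
      by (simp add: s bk scaleR_conv_of_real algebra_simps)
    from eventually_left_cell[OF k' _ _ this] s(1,2)
    have "eventually (\<lambda>\<epsilon>. z - of_real \<epsilon> * \<i> * d \<in> cell_set (left_cell k' q)) (at_right 0)"
      by (simp add: d_def bk algebra_simps)
    ultimately show ?thesis
    proof eventually_elim
      case (elim \<epsilon>)
      then show ?case
        by (simp add: mem_supertile_cell is_boundary_step_def q_k'_def)
    qed
  qed
  have edge: "boundary_edge (supertile_region t) (lattice_pt p) (lattice_pt q) \<longleftrightarrow>
    (\<forall>z\<in>open_segment (lattice_pt p) (lattice_pt q). eventually (\<lambda>\<epsilon>.
        z + of_real \<epsilon> * \<i> * d \<in> supertile_region t \<and>
        z - of_real \<epsilon> * \<i> * d \<notin> supertile_region t) (at_right 0))"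
    unfolding boundary_edge_def d_def[symmetric] using d by blast
  show ?thesis
  proof
    assume "boundary_edge (supertile_region t) (lattice_pt p) (lattice_pt (step k p))"
    \<comment> \<open>The condition quantifies over the points of the open segment; one such point
      is needed to extract the test.\<close>
    moreover have mid: "midpoint (lattice_pt p) (lattice_pt q) \<in> open_segment (lattice_pt p) (lattice_pt q)"
      using \<open>d \<noteq> 0\<close> by (simp add: d_def)
    ultimately have "eventually (\<lambda>\<epsilon>.
        midpoint (lattice_pt p) (lattice_pt q) + of_real \<epsilon> * \<i> * d \<in> supertile_region t \<and>
        midpoint (lattice_pt p) (lattice_pt q) - of_real \<epsilon> * \<i> * d \<notin> supertile_region t) (at_right 0)"
      using edge by (simp add: q_k'_def)
    then have "eventually (\<lambda>\<epsilon>. is_boundary_step (supertile_hexagons t) p k) (at_right (0 :: real))"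
      using inside[OF mid] by eventually_elim blast
    then show "is_boundary_step (supertile_hexagons t) p k"
      by (simp add: eventually_const)
  next
    assume *: "is_boundary_step (supertile_hexagons t) p k"
    show "boundary_edge (supertile_region t) (lattice_pt p) (lattice_pt (step k p))"
      unfolding q_k'_def(1)[symmetric] edge
    proof
      fix z assume "z \<in> open_segment (lattice_pt p) (lattice_pt q)"
      from inside[OF this] show "eventually (\<lambda>\<epsilon>. z + of_real \<epsilon> * \<i> * d \<in> supertile_region t \<and>
        z - of_real \<epsilon> * \<i> * d \<notin> supertile_region t) (at_right 0)"
        by eventually_elim (use * in blast)
    qed
  qed
qed

lemma boundary_edge_lattice_pt:
  assumes "boundary_edge M (lattice_pt p) b"
  obtains k where "k < 6" "b = lattice_pt (step k p)"
proof -
  obtain k where k: "b - lattice_pt p = (rot60 ^^ k) (pt 1 0)"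
    using assms unfolding boundary_edge_def by auto
  have "(rot60 ^^ (k mod 6)) (pt 1 0) = (rot60 ^^ k) (pt 1 0)"
    by (rule funpow_mod_eq) (rule rot60_power_6)
  then have "b = lattice_pt (step (k mod 6) p)"
    using k by (simp add: step_eq algebra_simps)
  then show thesis using that[of "k mod 6"] by simp
qed

text \<open>Each step of \<open>vs\<close> is forced as long as \<open>p\<close> has a next vertex.
  Having no repeated vertex, \<open>vs\<close> can neither stop before the common last vertex nor
  pass through it and return.\<close>

lemma path_unique:
  assumes "\<And>i b. Suc i < length p \<Longrightarrow> E (p ! i) b \<Longrightarrow> b = p ! Suc i" "p \<noteq> []"
    and "vs \<noteq> []" "hd vs = hd p" "last vs = last p" "distinct vs" "distinct p" "successively E vs"
  shows "vs = p"
  using assms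
proof (induction p arbitrary: vs)
  case (Cons x p)
  obtain ws where vs: "vs = x # ws" using Cons.prems by (cases vs) auto
  show ?case
  proof (cases p)
    case Nil
    then have "ws = []" using Cons.prems vs by (cases ws rule: rev_cases) auto
    then show ?thesis by (simp add: vs Nil)
  next
    case (Cons y q)
    have "ws \<noteq> []"
    proof
      assume "ws = []"
      then have "x = last p" using Cons.prems(5) vs \<open>p = y # q\<close> by simp
      then have "x \<in> set p" using \<open>p = y # q\<close> last_in_set[of p] by simp
      then show False using Cons.prems(7) by simp
    qed
    then have "E x (hd ws)" using Cons.prems(8) vs by (cases ws) auto
    then have "hd ws = y" using Cons.prems(1)[of 0] Cons by simp
    have "ws = p"
    proof (rule Cons.IH)
      show "b = p ! Suc i" if "Suc i < length p" "E (p ! i) b" for i b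
        using Cons.prems(1)[of "Suc i"] that by simp
    qed (use Cons.prems vs \<open>ws \<noteq> []\<close> \<open>hd ws = y\<close> \<open>p = y # q\<close> in \<open>auto simp: successively_Cons\<close>)
    then show ?thesis by (simp add: vs)
  qed
qed simp

lemma boundary_path_eq:
  assumes "is_boundary_path (supertile_hexagons t) p"
  shows "boundary_path (supertile_region t) (lattice_pt (hd p)) (lattice_pt (last p)) = map lattice_pt p"
proof -
  let ?E = "boundary_edge (supertile_region t)"
  have "p \<noteq> []" "distinct p" using assms by (auto simp: is_boundary_path_def)
  have steps: "map (\<lambda>k. step k (p ! i)) (filter (is_boundary_step (supertile_hexagons t) (p ! i)) [0..<6])
      = [p ! Suc i]" if "Suc i < length p" for i
  proof -
    have "(p ! i, p ! Suc i) \<in> set (zip p (tl p))"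
      using that by (auto simp: set_zip nth_tl intro!: exI[of _ i])
    then show ?thesis using assms by (auto simp: is_boundary_path_def list_all_iff)
  qed
  have "?E (lattice_pt (p ! i)) (lattice_pt (p ! Suc i))" if i: "Suc i < length p" for i
  proof -
    have "p ! Suc i \<in> set (map (\<lambda>k. step k (p ! i))
        (filter (is_boundary_step (supertile_hexagons t) (p ! i)) [0..<6]))"
      unfolding steps[OF i] by simp
    then obtain k where "k < 6" "is_boundary_step (supertile_hexagons t) (p ! i) k"
        "p ! Suc i = step k (p ! i)"
      by auto
    then show ?thesis by (simp add: boundary_edge_step)
  qed
  then have succ: "successively ?E (map lattice_pt p)"
    by (auto simp: successively_conv_nth)
  have unique: "b = lattice_pt (p ! Suc i)" if i: "Suc i < length p" "?E (lattice_pt (p ! i)) b" for i b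
  proof -
    obtain k where k: "k < 6" "b = lattice_pt (step k (p ! i))"
      using boundary_edge_lattice_pt[OF i(2)] .
    then have "step k (p ! i) \<in> set (map (\<lambda>k. step k (p ! i))
        (filter (is_boundary_step (supertile_hexagons t) (p ! i)) [0..<6]))"
      using i(2) by (auto simp: boundary_edge_step)
    then show ?thesis unfolding steps[OF i(1)] k by simp
  qed
  show ?thesis unfolding boundary_path_def
  proof (rule the_equality)
    show "map lattice_pt p \<noteq> [] \<and> hd (map lattice_pt p) = lattice_pt (hd p) \<and>
        last (map lattice_pt p) = lattice_pt (last p) \<and> distinct (map lattice_pt p) \<and>
        successively ?E (map lattice_pt p)"
      using \<open>p \<noteq> []\<close> \<open>distinct p\<close> succ
      by (simp add: hd_map last_map distinct_map inj_on_def)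
  next
    fix vs assume vs: "vs \<noteq> [] \<and> hd vs = lattice_pt (hd p) \<and> last vs = lattice_pt (last p) \<and>
        distinct vs \<and> successively ?E vs"
    show "vs = map lattice_pt p"
      by (rule path_unique[of _ ?E])
        (use vs unique \<open>p \<noteq> []\<close> \<open>distinct p\<close> in
          \<open>auto simp: hd_map last_map distinct_map inj_on_def\<close>)
  qed
qed

definition check_boundary :: "metatile \<Rightarrow> bool" where
  "check_boundary k \<longleftrightarrow> (let hs = supertile_hexagons k in
     list_all (\<lambda>(p, z). is_boundary_path hs p) (arc_list k) \<and>
     map (\<lambda>(p, z). last p) (arc_list k) = map (\<lambda>(p, z). hd p) (rotate1 (arc_list k)))"

lemma check_boundary: "check_boundary k"
proof -
  have "check_boundary T_tile" "check_boundary H_tile" "check_boundary P_tile" "check_boundary F_tile"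
    by code_simp+
  then show ?thesis by (cases k) simp_all
qed

lemma arcs_supertile: "arcs (supertile_shape k) = map (\<lambda>(p, z). (map lattice_pt p, z)) (arc_list k)"
proof -
  let ?l = "arc_list k"
  have m: "supertile_marks k = map (\<lambda>(p, z). (lattice_pt (hd p), z)) ?l"
    by (cases k) (simp_all add: lattice_pt_def)
  show ?thesis
  proof (rule nth_equalityI)
    show "length (arcs (supertile_shape k)) = length (map (\<lambda>(p, z). (map lattice_pt p, z)) ?l)"
      by (simp add: supertile_shape_def Let_def m)
  next
    fix i assume "i < length (arcs (supertile_shape k))"
    then have i: "i < length ?l" by (simp add: supertile_shape_def Let_def m)
    obtain p z where pz: "?l ! i = (p, z)" by (cases "?l ! i")
    have "is_boundary_path (supertile_hexagons k) p"
      using check_boundary[of k] nth_mem[OF i] by (auto simp: check_boundary_def Let_def list_all_iff pz)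
    note bp = boundary_path_eq[OF this]
    have "map (\<lambda>(p, z). last p) ?l ! i = map (\<lambda>(p, z). hd p) (rotate1 ?l) ! i"
      using check_boundary[of k] by (simp add: check_boundary_def Let_def)
    then have "fst (rotate1 (supertile_marks k) ! i) = lattice_pt (last p)"
      using i by (simp add: m rotate1_map pz case_prod_beta)
    then show "arcs (supertile_shape k) ! i = map (\<lambda>(p, z). (map lattice_pt p, z)) ?l ! i"
      using i bp by (simp add: supertile_shape_def Let_def m pz case_prod_beta)
  qed
qed

section \<open>Interior angles\<close>

text \<open>The positive factor \<open>c\<close> does not affect the argument, and
  \<open>n < 6\<close> keeps the angle in the range of \<open>Arg2pi\<close>.\<close>

lemma interior_angle_eq:
  assumes "fst (outgoing_arc s j) = vs" "fst (incoming_arc s j) = us" "vs ! 1 \<noteq> hd vs"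
    and "last (butlast us) - hd vs = of_real c * (rot60 ^^ n) (vs ! 1 - hd vs)" "0 < c" "n < 6"
  shows "interior_angle s j = of_nat n * (pi / 3)"
proof -
  have "(last (butlast us) - hd vs) / (vs ! 1 - hd vs) = of_real c * cis (of_nat n * (pi / 3))"
    using assms(3) by (simp add: assms(4) rot60_power)
  moreover have "of_nat n * (pi / 3) < 2 * pi" using assms(6) by simp
  ultimately have "Arg2pi ((last (butlast us) - hd vs) / (vs ! 1 - hd vs)) = of_nat n * (pi / 3)"
    using assms(5) by (intro Arg2pi_unique[of c]) (simp_all add: cis_conv_exp)
  then show ?thesis using assms(1,2) by (simp add: interior_angle_def Let_def)
qed

definition metatile_arc_list :: "metatile \<Rightarrow> ((int \<times> int) list \<times> label) list" where
  "metatile_arc_list k =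
     map (\<lambda>i. ([fst (side k i), snd (side k i)], snd (mark_list k ! i))) [0..<length (mark_list k)]"

lemma arcs_metatile_list:
  "arcs (metatile_shape k) = map (\<lambda>(p, z). (map lattice_pt p, z)) (metatile_arc_list k)"
proof (rule nth_equalityI)
  have "0 < length (mark_list k)" by (cases k) simp_all
  then show len: "length (arcs (metatile_shape k)) =
      length (map (\<lambda>(p, z). (map lattice_pt p, z)) (metatile_arc_list k))"
    using arcs_metatile(1)[of 0 k] by (simp add: metatile_arc_list_def)
  show "arcs (metatile_shape k) ! i = map (\<lambda>(p, z). (map lattice_pt p, z)) (metatile_arc_list k) ! i"
    if "i < length (arcs (metatile_shape k))" for i
    using that arcs_metatile(2)[of i k] by (simp add: len metatile_arc_list_def side_def)
qed

text \<open>Angles are counted in units of \<open>pi / 3\<close>; edges have length \<open>1\<close> or \<open>3\<close>.\<close>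

definition has_angle :: "((int \<times> int) list \<times> label) list \<Rightarrow> nat \<Rightarrow> nat \<Rightarrow> bool" where
  "has_angle al j n \<longleftrightarrow> (case (fst (al ! j) ! 0, fst (al ! j) ! 1,
       last (butlast (fst (al ! (if j = 0 then length al - 1 else j - 1))))) of
     ((x, y), (u, v), (s, t)) \<Rightarrow> n < 6 \<and> (u, v) \<noteq> (x, y) \<and> length (fst (al ! j)) > 1 \<and>
       length (fst (al ! (if j = 0 then length al - 1 else j - 1))) > 1 \<and>
       list_ex (\<lambda>m. list_ex (\<lambda>m'. (m * (s - x), m * (t - y)) = turn n (m' * (u - x), m' * (v - y)))
         [1, 3]) [1, 3])"

lemma incoming_arc_eq:
  assumes "j < length (arcs s)"
  shows "incoming_arc s j = arcs s ! (if j = 0 then length (arcs s) - 1 else j - 1)"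
  using assms by (auto simp: incoming_arc_def mod_if)

lemma interior_angle_has_angle:
  assumes "arcs s = map (\<lambda>(p, z). (map lattice_pt p, z)) al" "j < length al" "has_angle al j n"
  shows "interior_angle s j = of_nat n * (pi / 3)"
proof -
  define i where "i = (if j = 0 then length al - 1 else j - 1)"
  define p q where "p = fst (al ! j)" "q = fst (al ! i)"
  have "i < length al" using assms(2) by (auto simp: i_def)
  obtain x y u v a b where xy: "p ! 0 = (x, y)" "p ! 1 = (u, v)" "last (butlast q) = (a, b)"
    by (metis surj_pair)
  have *: "n < 6" "(u, v) \<noteq> (x, y)" "length p > 1" "length q > 1"
      "\<exists>m\<in>set [1, 3]. \<exists>m'\<in>set [1, 3]. (m * (a - x), m * (b - y)) = turn n (m' * (u - x), m' * (v - y))"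
    using assms(3) unfolding has_angle_def i_def[symmetric] p_q_def[symmetric] xy prod.case list_ex_iff
    by blast+
  then obtain m m' where m: "m \<in> set [1, 3]" "m' \<in> set [1, 3]"
      and eq: "(m * (a - x), m * (b - y)) = turn n (m' * (u - x), m' * (v - y))"
    by blast
  have pos: "0 < m" "0 < m'" using m by auto
  have scale: "lattice_pt (k * (c - d), k * (e - f)) = of_int k * (lattice_pt (c, e) - lattice_pt (d, f))" for k c d e f
    using pt_arith(3)[of "of_int k" "of_int (c - d)" "of_int (e - f)"]
    by (simp add: lattice_pt_diff) (simp add: lattice_pt_def)
  have "of_int m * (lattice_pt (a, b) - lattice_pt (x, y)) =
      (rot60 ^^ n) (of_int m' * (lattice_pt (u, v) - lattice_pt (x, y)))"
    unfolding scale[symmetric] rot60_power_lattice_pt eq ..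
  then have main: "lattice_pt (a, b) - lattice_pt (x, y) =
      of_real (of_int m' / of_int m) * (rot60 ^^ n) (lattice_pt (u, v) - lattice_pt (x, y))"
    using pos by (simp add: rot60_power field_simps)
  have "p \<noteq> []" "butlast q \<noteq> []" using *(3,4) by (auto simp flip: length_greater_0_conv)
  then have hd: "hd (map lattice_pt p) = lattice_pt (x, y)"
      "last (butlast (map lattice_pt q)) = lattice_pt (a, b)" "map lattice_pt p ! 1 = lattice_pt (u, v)"
    using xy *(3) by (simp_all add: hd_map hd_conv_nth last_map flip: map_butlast)
  show ?thesis
  proof (rule interior_angle_eq)
    show "fst (outgoing_arc s j) = map lattice_pt p"
      using assms(2) by (simp add: outgoing_arc_def assms(1) p_q_def case_prod_beta)
    show "fst (incoming_arc s j) = map lattice_pt q"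
      using assms(2) \<open>i < length al\<close> incoming_arc_eq[of j s]
      by (simp add: assms(1) p_q_def i_def case_prod_beta)
    show "map lattice_pt p ! 1 \<noteq> hd (map lattice_pt p)" unfolding hd using *(2) by simp
    show "last (butlast (map lattice_pt q)) - hd (map lattice_pt p) =
        of_real (of_int m' / of_int m) * (rot60 ^^ n) (map lattice_pt p ! 1 - hd (map lattice_pt p))"
      unfolding hd by (rule main)
  qed (use pos *(1) in auto)
qed

fun supertile_angles :: "metatile \<Rightarrow> nat list" where
  "supertile_angles T_tile = [3, 3, 3]"
| "supertile_angles H_tile = [1, 2, 2, 1, 2, 2, 1, 2, 2]"
| "supertile_angles P_tile = [3, 2, 2, 4, 3, 2, 2, 4]"
| "supertile_angles F_tile = [3, 2, 2, 4, 2, 2, 2, 2, 4]"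

fun metatile_angles :: "metatile \<Rightarrow> nat list" where
  "metatile_angles T_tile = [1, 1, 1]"
| "metatile_angles H_tile = [2, 2, 3, 2, 2, 3, 2, 2, 3]"
| "metatile_angles P_tile = [1, 3, 2, 3, 1, 3, 2, 3]"
| "metatile_angles F_tile = [1, 3, 2, 3, 3, 2, 2, 2, 3]"

text \<open>Passing from a metatile to its supertile changes the angle between two arcs by the weight of
  the outgoing label minus the weight of the label matching the incoming one, so that the changes
  cancel around a cycle.\<close>

fun weight :: "label \<Rightarrow> int" where
  "weight A_minus = 2" | "weight B_plus = 2" | "weight L_label = 2" | "weight X_minus = 1"
| "weight A_plus = 0" | "weight B_minus = 0" | "weight X_plus = 0" | "weight F_plus = 0"
| "weight F_minus = 0"

definition check_angles :: "metatile \<Rightarrow> nat \<Rightarrow> bool" where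
  "check_angles k i \<longleftrightarrow> has_angle (arc_list k) i (supertile_angles k ! i) \<and>
     corresponding_mark k i < length (metatile_arc_list k) \<and>
     has_angle (metatile_arc_list k) (corresponding_mark k i)
       (metatile_angles k ! corresponding_mark k i) \<and>
     int (supertile_angles k ! i) - int (metatile_angles k ! corresponding_mark k i) =
       weight (snd (arc_list k ! i)) -
       weight (opposite (snd (arc_list k ! (if i = 0 then length (arc_list k) - 1 else i - 1))))"

lemma check_angles:
  assumes "i < length (arc_list k)" shows "check_angles k i"
proof -
  have "list_all (\<lambda>k. list_all (check_angles k) [0..<length (arc_list k)])
      [T_tile, H_tile, P_tile, F_tile]"
    by code_simp
  moreover have "k \<in> set [T_tile, H_tile, P_tile, F_tile]" by (cases k) auto
  ultimately show ?thesis using assms unfolding list_all_iff by auto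
qed

lemma interior_angle_difference:
  assumes "i < length (arcs (supertile_shape k))"
  shows "interior_angle (supertile_shape k) i =
    interior_angle (metatile_shape k) (corresponding_mark k i) +
    pi / 3 * (of_int (weight (snd (outgoing_arc (supertile_shape k) i))) -
      of_int (weight (opposite (snd (incoming_arc (supertile_shape k) i)))))"
proof -
  have i: "i < length (arc_list k)" using assms by (simp add: arcs_supertile)
  note c = check_angles[OF i, unfolded check_angles_def]
  define s m where "s = supertile_angles k ! i" "m = metatile_angles k ! corresponding_mark k i"
  have super: "interior_angle (supertile_shape k) i = of_nat s * (pi / 3)"
    unfolding s_m_def by (rule interior_angle_has_angle[OF arcs_supertile i]) (use c in blast)
  have meta: "interior_angle (metatile_shape k) (corresponding_mark k i) = of_nat m * (pi / 3)"
    unfolding s_m_def by (rule interior_angle_has_angle[OF arcs_metatile_list]) (use c in blast)+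
  have out: "snd (outgoing_arc (supertile_shape k) i) = snd (arc_list k ! i)"
    using i by (simp add: outgoing_arc_def arcs_supertile case_prod_beta)
  have inc: "snd (incoming_arc (supertile_shape k) i) =
      snd (arc_list k ! (if i = 0 then length (arc_list k) - 1 else i - 1))"
    using i incoming_arc_eq[OF assms] by (auto simp: arcs_supertile case_prod_beta)
  have "real s - real m = of_int (int s - int m)" by simp
  also have "\<dots> = of_int (weight (snd (arc_list k ! i))) -
      of_int (weight (opposite (snd (arc_list k ! (if i = 0 then length (arc_list k) - 1 else i - 1)))))"
    using c by (simp only: s_m_def of_int_diff)
  finally have *: "real s - real m = of_int (weight (snd (arc_list k ! i))) -
      of_int (weight (opposite (snd (arc_list k ! (if i = 0 then length (arc_list k) - 1 else i - 1)))))" .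
  show ?thesis unfolding super meta out inc *[symmetric] by (simp add: field_simps)
qed

lemma sum_list_rotate1: "sum_list (map f (rotate1 xs)) = sum_list (map f xs)"
  for f :: "'a \<Rightarrow> 'b::comm_monoid_add"
  by (cases xs) (simp_all add: add.commute)

text \<open>Matching of consecutive labels says that the label opposite to each incoming one is the
  next outgoing one. So both families of weights have the same sum, and the changes of angle
  cancel.\<close>

lemma vertex_angle_sums:
  assumes "\<forall>(k, i)\<in>set cs. i < length (arcs (supertile_shape k))" "consecutive_labels_match cs"
  shows "(\<Sum>(k, i)\<leftarrow>cs. interior_angle (supertile_shape k) i) =
    (\<Sum>(k, i)\<leftarrow>cs. interior_angle (metatile_shape k) (corresponding_mark k i))"
proof -
  define out inc where "out = (\<lambda>(k, i). snd (outgoing_arc (supertile_shape k) i))"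
    "inc = (\<lambda>(k, i). opposite (snd (incoming_arc (supertile_shape k) i)))"
  \<comment> \<open>The shift by one is cyclic, just as \<open>Suc j\<close> is taken modulo the
    length.\<close>
  have "map inc cs = map out (rotate1 cs)"
  proof (rule nth_equalityI)
    fix j assume "j < length (map inc cs)"
    then have "j < length cs" by simp
    then show "map inc cs ! j = map out (rotate1 cs) ! j"
      using assms(2) unfolding consecutive_labels_match_def
      by (auto simp: nth_rotate1 out_inc_def case_prod_beta Let_def)
  qed simp
  then have "sum_list (map (\<lambda>l. real_of_int (weight l)) (map inc cs)) =
      sum_list (map (\<lambda>l. real_of_int (weight l)) (map out (rotate1 cs)))"
    by (simp only:)
  then have w: "sum_list (map (\<lambda>c. real_of_int (weight (inc c))) cs) =
      sum_list (map (\<lambda>c. real_of_int (weight (out c))) cs)"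
    by (simp add: sum_list_rotate1 comp_def)
  have "(\<Sum>(k, i)\<leftarrow>cs. interior_angle (supertile_shape k) i) =
      (\<Sum>c\<leftarrow>cs. interior_angle (metatile_shape (fst c)) (corresponding_mark (fst c) (snd c)) +
        pi / 3 * (of_int (weight (out c)) - of_int (weight (inc c))))"
    using assms(1) interior_angle_difference
    by (intro arg_cong[of _ _ sum_list] map_cong) (auto simp: out_inc_def)
  also have "\<dots> = (\<Sum>(k, i)\<leftarrow>cs. interior_angle (metatile_shape k) (corresponding_mark k i)) +
      pi / 3 * ((\<Sum>c\<leftarrow>cs. of_int (weight (out c))) - (\<Sum>c\<leftarrow>cs. of_int (weight (inc c))))"
    by (induction cs) (simp_all add: case_prod_beta field_simps)
  finally show ?thesis by (simp add: w)
qed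

section \<open>The tiling by supertiles\<close>

definition supertiles ::
    "(metatile \<times> (complex \<Rightarrow> complex)) set \<Rightarrow> (metatile \<times> (complex \<Rightarrow> complex)) set" where
  "supertiles M = {(k, h). direct_isometry h \<and> group_of (k, h) \<subseteq> bisect M}"

lemma mem_bisect: "(q, f) \<in> bisect M \<longleftrightarrow> (tile_of q, f) \<in> M"
proof -
  have "q \<in> pieces_of k \<longleftrightarrow> k = tile_of q" for k by (cases k; cases q) simp_all
  then show ?thesis by (auto simp: bisect_def)
qed

lemma group_of_eq: "group_of (k, h) = (\<lambda>(q, b). (q, h \<circ> placed b)) ` set (piece_list k)"
  by (auto simp: group_of_def supertile_pieces_eq)

lemma piece_list_rotation: "(q, b) \<in> set (piece_list k) \<Longrightarrow> fst b < 6"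
  by (cases k) auto

text \<open>Together with \<open>group_tiles_of_supertile\<close> this translates between the leaves
  and starting configurations of certificates and the supertiles of the tiling.\<close>

lemma supertile_of_group_tiles:
  assumes "direct_isometry h" "set (group_tiles (k, a)) \<subseteq> local_tiles M h"
  shows "(k, h \<circ> placed a) \<in> supertiles M"
proof -
  have "(tile_of q, h \<circ> placed a \<circ> placed b) \<in> M" if "(q, b) \<in> set (piece_list k)" for q b
  proof -
    have "(tile_of q, composite a b) \<in> set (group_tiles (k, a))"
      using that by (force simp: group_tiles_def)
    then show ?thesis using assms(2) by (auto simp: local_tiles_def placed_composite comp_assoc)
  qed
  then show ?thesis
    using assms(1) direct_isometry_comp direct_isometry_placed
    by (auto simp: supertiles_def group_of_eq mem_bisect)
qed

lemma group_tiles_of_supertile: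
  assumes "(k, h \<circ> placed a) \<in> supertiles M" "fst a < 6"
  shows "set (group_tiles (k, a)) \<subseteq> local_tiles M h"
proof -
  have "(tile_of q, composite a b) \<in> local_tiles M h" if "(q, b) \<in> set (piece_list k)" for q b
  proof -
    have "(q, h \<circ> placed a \<circ> placed b) \<in> group_of (k, h \<circ> placed a)"
      using that by (force simp: group_of_eq)
    then have "(tile_of q, h \<circ> placed a \<circ> placed b) \<in> M"
      using assms(1) by (auto simp: supertiles_def mem_bisect)
    then show ?thesis
      using fst_composite[OF assms(2) piece_list_rotation[OF that]]
      by (simp add: local_tiles_def placed_composite comp_assoc)
  qed
  then show ?thesis by (auto simp: group_tiles_def)
qed

text \<open>Rotation number 0 is treated apart because 6 is not an admissible number.\<close>

definition inverse_placement :: "placement \<Rightarrow> placement" where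
  "inverse_placement a = (case a of (r, x, y) \<Rightarrow>
     let s = (if r = 0 then 0 else 6 - r) in (s, turn s (- x, - y)))"

fun any_clash :: "tile list \<Rightarrow> tile list \<Rightarrow> bool" where
  "any_clash [] us \<longleftrightarrow> False"
| "any_clash (t # ts) us \<longleftrightarrow> (if list_ex (clash t) us then True else any_clash ts us)"

lemma any_clash_iff: "any_clash ts us \<longleftrightarrow> (\<exists>t\<in>set ts. \<exists>u\<in>set us. clash t u)"
  by (induction ts) (auto simp: list_ex_iff)

text \<open>In the frame of a shared piece, a supertile is placed by the inverse of the position of
  that piece in it. Up to the frame there are thus finitely many pairs of groups sharing a piece,
  and two different ones always contain clashing tiles.\<close>

definition check_disjoint :: "metatile \<Rightarrow> metatile \<Rightarrow> bool" where
  "check_disjoint k l \<longleftrightarrow> list_all (\<lambda>(q, b). list_all (\<lambda>(q', b').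
     if q = q' then
       (if (k, inverse_placement b) = (l, inverse_placement b') then True
        else any_clash (group_tiles (k, inverse_placement b)) (group_tiles (l, inverse_placement b')))
     else True) (piece_list l)) (piece_list k)"

lemma check_disjoint: "check_disjoint k l"
proof -
  have "list_all (\<lambda>k. list_all (check_disjoint k) [T_tile, H_tile, P_tile, F_tile])
      [T_tile, H_tile, P_tile, F_tile]"
    by code_simp
  then show ?thesis by (cases k; cases l) simp_all
qed

lemma placed_inverse_placement:
  assumes "(q, b) \<in> set (piece_list k)"
  shows "placed b \<circ> placed (inverse_placement b) = id" "fst (inverse_placement b) < 6"
proof -
  have "list_all (\<lambda>k. list_all (\<lambda>(q, b). composite b (inverse_placement b) = (0, 0, 0) \<and>
      fst (inverse_placement b) < 6) (piece_list k)) [T_tile, H_tile, P_tile, F_tile]"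
    by code_simp
  moreover have "k \<in> set [T_tile, H_tile, P_tile, F_tile]" by (cases k) auto
  ultimately have "composite b (inverse_placement b) = (0, 0, 0)" "fst (inverse_placement b) < 6"
    using assms unfolding list_all_iff by fast+
  then show "placed b \<circ> placed (inverse_placement b) = id" "fst (inverse_placement b) < 6"
    by (simp_all flip: placed_composite)
qed

lemma supertile_region_pieces: "h ` supertile_region k = (\<Union>(q, f)\<in>group_of (k, h). f ` piece_region q)"
  by (simp add: supertile_region_def group_of_def case_prod_beta image_UN image_comp)

lemma region_eq_pieces: "region (metatile_shape k) = (\<Union>q\<in>pieces_of k. piece_region q)"
  by (cases k) (auto simp: region_metatile piece_region_eq hexagon_set_def)

text \<open>Pulled back by \<open>f\<close>, a common interior would be an open set inside the line
  y = -1.\<close>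

lemma interior_halves_disjoint:
  assumes "direct_isometry f" "A \<subseteq> {z. coord_y z \<ge> -1}" "B \<subseteq> {z. coord_y z \<le> -1}"
  shows "interior (f ` A) \<inter> interior (f ` B) = {}"
proof (rule ccontr)
  assume *: "interior (f ` A) \<inter> interior (f ` B) \<noteq> {}"
  obtain g where g: "direct_isometry g" "f \<circ> g = id" "g \<circ> f = id"
    using assms(1) by (rule direct_isometry_inverse)
  define V where "V = g ` (interior (f ` A) \<inter> interior (f ` B))"
  have "open V" unfolding V_def by (intro direct_isometry_open[OF g(1)] open_Int open_interior)
  have "V \<subseteq> g ` f ` A" "V \<subseteq> g ` f ` B"
    unfolding V_def using interior_subset by blast+
  then have V: "coord_y z = -1" if "z \<in> V" for z
    using that assms(2,3) unfolding image_comp g(3) by fastforce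
  obtain z where "z \<in> V" using * unfolding V_def by blast
  then obtain e where "e > 0" "ball z e \<subseteq> V"
    using \<open>open V\<close> open_contains_ball by blast
  \<comment> \<open>A short move along e2 stays in the ball but changes y.\<close>
  define w where "w = z + of_real (e / 2) * pt 0 1"
  have "dist z w = e / 2" using \<open>e > 0\<close> by (simp add: w_def dist_norm norm_mult pt_def complex_norm)
  then have "w \<in> V" using \<open>e > 0\<close> \<open>ball z e \<subseteq> V\<close> by auto
  then have "coord_y w = coord_y z" using V \<open>z \<in> V\<close> by simp
  moreover have "coord_y w = coord_y z + e / 2"
    unfolding w_def coord_arith coord_pt by simp
  ultimately show False using \<open>e > 0\<close> by simp
qed

lemma interior_finite_Union_empty:
  assumes "finite \<A>" "\<And>A. A \<in> \<A> \<Longrightarrow> closed A \<and> interior A = {}"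
  shows "interior (\<Union>\<A>) = {}"
  using assms
proof (induction \<A>)
  case (insert A \<A>)
  then show ?case using interior_closed_Un_empty_interior[of A "\<Union>\<A>"] by simp
qed simp

lemma supertile_region_shape [simp]: "region (supertile_shape k) = supertile_region k"
  by (simp add: supertile_shape_def Let_def)

lemma polyline_direct:
  assumes "direct_isometry f" shows "polyline (map f vs) = f ` polyline vs"
  unfolding polyline_def by (auto simp: direct_isometry_segment[OF assms, symmetric] image_UN)

lemma polyline_rev: "polyline (rev vs) = polyline vs"
proof -
  have "polyline (rev vs) \<subseteq> polyline vs" for vs :: "complex list"
  proof
    fix z assume "z \<in> polyline (rev vs)"
    then obtain i where i: "i < length vs - 1" "z \<in> closed_segment (rev vs ! i) (rev vs ! Suc i)"
      by (auto simp: polyline_def)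
    define j where "j = length vs - Suc (Suc i)"
    have "rev vs ! i = vs ! Suc j" "rev vs ! Suc i = vs ! j" "j < length vs - 1"
      using i(1) by (simp_all add: rev_nth j_def Suc_diff_Suc)
    then show "z \<in> polyline vs"
      using i(2) unfolding polyline_def by (auto simp: closed_segment_commute)
  qed
  from this[of vs] this[of "rev vs"] show ?thesis by simp
qed

locale metatile_tiling =
  fixes M :: "(metatile \<times> (complex \<Rightarrow> complex)) set"
  assumes tiling: "is_tiling metatile_shape M"
    and matching: "obeys_matching_rules metatile_shape M"
begin

abbreviation "S \<equiv> supertiles M"

lemma consistent: "direct_isometry f \<Longrightarrow> consistent neighbours (local_tiles M f)"
  by (rule consistent_local_tiles[OF tiling matching])

text \<open>The search runs in the frame of the piece, with its metatile as the only tile known at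
  the start.\<close>

lemma piece_covered:
  assumes "(q, f) \<in> bisect M"
  obtains s where "s \<in> S" "(q, f) \<in> group_of s"
proof -
  have M: "(tile_of q, f) \<in> M" using assms by (simp add: mem_bisect)
  then have f: "direct_isometry f" by (rule tiling_direct[OF tiling])
  have "set [(tile_of q, 0, 0, 0)] \<subseteq> local_tiles M f" using M by (simp add: local_tiles_def)
  moreover have "check neighbours (covers q) [(tile_of q, 0, 0, 0)] (cover_certificate q)"
    using check_cover unfolding check_cover_def by (cases q) simp_all
  ultimately obtain k a where ka: "covers q (k, a)" "set (group_tiles (k, a)) \<subseteq> local_tiles M f"
    using check_sound(1)[OF consistent[OF f]] by (metis surj_pair)
  then obtain b where b: "(q, b) \<in> set (piece_list k)" "composite a b = (0, 0, 0)"
    by (auto simp: covers_def list_ex_iff)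
  have "placed a \<circ> placed b = id" using b(2) by (metis placed_0 placed_composite)
  then have "f = f \<circ> placed a \<circ> placed b" by (simp add: comp_assoc)
  then have "(q, f) \<in> group_of (k, f \<circ> placed a)"
    using b(1) by (force simp: group_of_eq)
  then show thesis using that supertile_of_group_tiles[OF f ka(2)] by blast
qed

text \<open>In the frame of the common piece both groups consist of tiles of \<open>M\<close>, and
  these cannot clash; the finite check leaves only equality.\<close>

lemma groups_disjoint:
  assumes "s \<in> S" "t \<in> S" "(q, f) \<in> group_of s" "(q, f) \<in> group_of t"
  shows "s = t"
proof -
  obtain k h l g where st: "s = (k, h)" "t = (l, g)" by (cases s; cases t)
  obtain b where b: "(q, b) \<in> set (piece_list k)" "f = h \<circ> placed b"
    using assms(3) by (auto simp: st group_of_eq)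
  obtain c where c: "(q, c) \<in> set (piece_list l)" "f = g \<circ> placed c"
    using assms(4) by (auto simp: st group_of_eq)
  have f: "direct_isometry f"
    using assms(1) b(2) by (auto simp: st supertiles_def intro!: direct_isometry_comp direct_isometry_placed)
  note ib = placed_inverse_placement[OF b(1)] and ic = placed_inverse_placement[OF c(1)]
  have h: "h = f \<circ> placed (inverse_placement b)" using b(2) ib(1) by (simp add: comp_assoc)
  have g: "g = f \<circ> placed (inverse_placement c)" using c(2) ic(1) by (simp add: comp_assoc)
  have "set (group_tiles (k, inverse_placement b)) \<subseteq> local_tiles M f"
      "set (group_tiles (l, inverse_placement c)) \<subseteq> local_tiles M f"
    using assms(1,2) ib(2) ic(2) unfolding st h g by (intro group_tiles_of_supertile; simp)+
  then have "\<not> any_clash (group_tiles (k, inverse_placement b)) (group_tiles (l, inverse_placement c))"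
    using local_no_clash[OF tiling f] unfolding any_clash_iff by blast
  moreover have "if (k, inverse_placement b) = (l, inverse_placement c) then True
      else any_clash (group_tiles (k, inverse_placement b)) (group_tiles (l, inverse_placement c))"
    using bspec[OF bspec[OF check_disjoint[of k l, unfolded check_disjoint_def list_all_iff] b(1),
        unfolded prod.case list_all_iff] c(1), unfolded prod.case]
    by (simp only: if_True simp_thms)
  ultimately have "(k, inverse_placement b) = (l, inverse_placement c)" by argo
  then show ?thesis by (simp add: st h g)
qed

lemma supertile_direct: "(k, h) \<in> S \<Longrightarrow> direct_isometry h"
  by (simp add: supertiles_def)

lemma Union_group_of: "(\<Union>s\<in>S. group_of s) = bisect M"
proof (intro equalityI subsetI)
  fix x assume "x \<in> bisect M"
  then show "x \<in> (\<Union>s\<in>S. group_of s)" by (metis UN_I piece_covered surj_pair)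
qed (auto simp: supertiles_def)

lemma supertiles_cover: "(\<Union>(k, h)\<in>S. h ` supertile_region k) = UNIV"
proof -
  have "z \<in> (\<Union>(k, h)\<in>S. h ` supertile_region k)" for z
  proof -
    obtain k f where "(k, f) \<in> M" "z \<in> f ` region (metatile_shape k)"
      using tiling unfolding is_tiling_def by blast
    then obtain q where "q \<in> pieces_of k" "z \<in> f ` piece_region q"
      by (auto simp: region_eq_pieces)
    then have "(q, f) \<in> bisect M" using \<open>(k, f) \<in> M\<close> by (auto simp: bisect_def)
    then obtain s where "s \<in> S" "(q, f) \<in> group_of s" by (rule piece_covered)
    then have "z \<in> snd s ` supertile_region (fst s)"
      using \<open>z \<in> f ` piece_region q\<close> supertile_region_pieces[of "snd s" "fst s"] by auto
    then show ?thesis using \<open>s \<in> S\<close> by (auto simp: case_prod_beta)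
  qed
  then show ?thesis by blast
qed

lemma interior_pieces_disjoint:
  assumes "(q, f) \<in> bisect M" "(q', f') \<in> bisect M" "(q, f) \<noteq> (q', f')"
  shows "interior (f ` piece_region q) \<inter> interior (f' ` piece_region q') = {}"
proof (cases "(tile_of q, f) = (tile_of q', f')")
  case False
  have "piece_region q \<subseteq> region (metatile_shape (tile_of q))" for q
    by (cases q) auto
  then have "interior (f ` piece_region q) \<subseteq> interior (f ` region (metatile_shape (tile_of q)))" for q f
    by (intro interior_mono image_mono)
  then show ?thesis
    using tiling_interior_disjoint[OF tiling _ _ False] assms(1,2) unfolding mem_bisect by blast
next
  case True
  then have "tile_of q = tile_of q'" "q \<noteq> q'" "f' = f" using assms(3) by auto
  then have "(q, q') \<in> {(P_upper, P_lower), (P_lower, P_upper), (F_upper, F_lower), (F_lower, F_upper)}"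
    by (cases q; cases q') auto
  moreover have f: "direct_isometry f"
    using tiling_direct[OF tiling] assms(1) by (simp add: mem_bisect)
  have "interior (f ` piece_region P_upper) \<inter> interior (f ` piece_region P_lower) = {}"
      "interior (f ` piece_region F_upper) \<inter> interior (f ` piece_region F_lower) = {}"
    by (intro interior_halves_disjoint[OF f]; auto)+
  ultimately show ?thesis by (auto simp: \<open>f' = f\<close> simp del: piece_region.simps)
qed

text \<open>Disjoint interiors of the pieces do not settle this at once, since the interior of a
  union may contain points of common edges. But the intersection of two supertiles is a finite union
  of closed sets with empty interior, and such a union has empty interior.\<close>

lemma interior_supertiles_disjoint:
  assumes "(k, h) \<in> S" "(l, g) \<in> S" "(k, h) \<noteq> (l, g)"
  shows "interior (h ` supertile_region k) \<inter> interior (g ` supertile_region l) = {}"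
proof -
  define \<A> where "\<A> = (\<lambda>(x, y). snd x ` piece_region (fst x) \<inter> snd y ` piece_region (fst y)) `
    (group_of (k, h) \<times> group_of (l, g))"
  have "finite \<A>" unfolding \<A>_def by (simp add: group_of_eq)
  moreover have "closed A \<and> interior A = {}" if mem: "A \<in> \<A>" for A
  proof -
    obtain x y where xy: "x \<in> group_of (k, h)" "y \<in> group_of (l, g)"
        "A = snd x ` piece_region (fst x) \<inter> snd y ` piece_region (fst y)"
      using mem unfolding \<A>_def by auto
    obtain q f q' f' where "x = (q, f)" "y = (q', f')" by (cases x; cases y)
    with xy have A: "A = f ` piece_region q \<inter> f' ` piece_region q'"
      "(q, f) \<in> group_of (k, h)" "(q', f') \<in> group_of (l, g)"
      by simp_all
    have "(q, f) \<noteq> (q', f')" using groups_disjoint[OF assms(1,2)] A assms(3) by blast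
    moreover have b: "(q, f) \<in> bisect M" "(q', f') \<in> bisect M"
      using A assms(1,2) by (auto simp: supertiles_def)
    ultimately have "interior A = {}" unfolding A interior_Int by (rule interior_pieces_disjoint[rotated 2])
    moreover have "direct_isometry f" "direct_isometry f'"
      using b tiling_direct[OF tiling] by (auto simp: mem_bisect)
    ultimately show ?thesis
      unfolding A(1) piece_region_eq by (simp add: closed_Int direct_isometry_closed closed_hexagon_set)
  qed
  ultimately have "interior (\<Union>\<A>) = {}" by (rule interior_finite_Union_empty)
  moreover have "(\<Union>x\<in>G. B x) \<inter> (\<Union>y\<in>G'. B y) = \<Union>((\<lambda>(x, y). B x \<inter> B y) ` (G \<times> G'))"
    for G G' and B :: "piece \<times> (complex \<Rightarrow> complex) \<Rightarrow> complex set" by auto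
  then have "h ` supertile_region k \<inter> g ` supertile_region l = \<Union>\<A>"
    unfolding supertile_region_pieces \<A>_def by (simp only: case_prod_beta)
  ultimately show ?thesis by (simp flip: interior_Int)
qed

lemma supertiles_tiling: "is_tiling supertile_shape S"
  unfolding is_tiling_def supertile_region_shape
proof (intro conjI)
  show "\<forall>(k, h)\<in>S. \<forall>(l, g)\<in>S. (k, h) \<noteq> (l, g) \<longrightarrow>
      interior (h ` supertile_region k) \<inter> interior (g ` supertile_region l) = {}"
    using interior_supertiles_disjoint by blast
qed (use supertile_direct supertiles_cover in auto)

text \<open>In the frame of a supertile its own tiles form the starting configuration of the arc
  certificates, and the leaf reached is the supertile across the arc.\<close>

lemma supertiles_matching: "obeys_matching_rules supertile_shape S"
  unfolding obeys_matching_rules_def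
proof clarify
  fix k h vs z
  assume kh: "(k, h) \<in> S" and vs: "(vs, z) \<in> set (arcs (supertile_shape k))"
  note h = supertile_direct[OF kh]
  obtain j p where j: "j < length (arc_list k)" "arc_list k ! j = (p, z)" "vs = map lattice_pt p"
    using vs by (auto simp: arcs_supertile in_set_conv_nth)
  have "check_arcs k" using check_arcs by (cases k) simp_all
  then have "check neighbours (meets_arc k j) (group_tiles (k, 0, 0, 0)) (arc_certs k ! j)"
    using j(1) by (simp add: check_arcs_def list_all_iff)
  moreover have "set (group_tiles (k, 0, 0, 0)) \<subseteq> local_tiles M h"
    using group_tiles_of_supertile[of k h "(0, 0, 0)"] kh by simp
  ultimately obtain l a where la: "meets_arc k j (l, a)" "set (group_tiles (l, a)) \<subseteq> local_tiles M h"
    using check_sound(1)[OF consistent[OF h]] by (metis surj_pair)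
  then obtain p' where p': "(l, a) \<noteq> (k, 0, 0, 0)" "fst a < 6" "(p', opposite z) \<in> set (arc_list l)"
      "map (move a) p' = rev p"
    by (auto simp: meets_arc_def j list_ex_iff)
  have S: "(l, h \<circ> placed a) \<in> S" using supertile_of_group_tiles[OF h la(2)] .
  have ne: "(l, h \<circ> placed a) \<noteq> (k, h)"
  proof
    assume *: "(l, h \<circ> placed a) = (k, h)"
    then have "h \<circ> placed a = h \<circ> placed (0, 0, 0)" by simp
    then have "placed a = placed (0, 0, 0)" by (rule direct_isometry_cancel[OF h])
    then have "a = (0, 0, 0)" using p'(2) by (intro placed_inj) auto
    then show False using p'(1) * by simp
  qed
  have "map (placed a) (map lattice_pt p') = rev (map lattice_pt p)"
    using arg_cong[OF p'(4), of "map lattice_pt"] by (simp add: rev_map comp_def)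
  then have "placed a ` polyline (map lattice_pt p') = polyline vs"
    by (metis polyline_direct[OF direct_isometry_placed] polyline_rev j(3))
  then have "(h \<circ> placed a) ` polyline (map lattice_pt p') = h ` polyline vs"
    by (simp only: image_comp[symmetric])
  moreover have "(map lattice_pt p', opposite z) \<in> set (arcs (supertile_shape l))"
    using p'(3) by (force simp: arcs_supertile)
  ultimately have "\<exists>(vs', l')\<in>set (arcs (supertile_shape l)).
      (h \<circ> placed a) ` polyline vs' = h ` polyline vs \<and> l' = opposite z"
    by (intro bexI[of _ "(map lattice_pt p', opposite z)"]; simp)
  with ne have "case (l, h \<circ> placed a) of (k', f') \<Rightarrow> (k', f') \<noteq> (k, h) \<and>
      (\<exists>(vs', l')\<in>set (arcs (supertile_shape k')). f' ` polyline vs' = h ` polyline vs \<and> l' = opposite z)"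
    unfolding prod.case by (rule conjI)
  then show "\<exists>(k', f')\<in>S. (k', f') \<noteq> (k, h) \<and>
      (\<exists>(vs', l')\<in>set (arcs (supertile_shape k')). f' ` polyline vs' = h ` polyline vs \<and> l' = opposite z)"
    using S by (rule bexI)
qed

end

section \<open>Rigidity of labelled tiles\<close>

lemma isometry_comp: "isometry f \<Longrightarrow> isometry g \<Longrightarrow> isometry (f \<circ> g)"
  by (simp add: isometry_def)

lemma isometry_inj: "isometry f \<Longrightarrow> f z = f w \<Longrightarrow> z = w"
  unfolding isometry_def by (metis dist_eq_0_iff)

text \<open>Subtracting the equations for the squared distances to the three fixed points removes
  the quadratic terms. What remains are two homogeneous linear equations for \<open>f z - z\<close>,
  with nonzero determinant because the points are not collinear.\<close>

lemma isometry_fixing_three: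
  assumes "isometry f" "f a = a" "f b = b" "f c = c"
    and "Re (b - a) * Im (c - a) \<noteq> Im (b - a) * Re (c - a)"
  shows "f = id"
proof
  fix z
  define w where "w = f z"
  have d: "(Re (w - p))\<^sup>2 + (Im (w - p))\<^sup>2 = (Re (z - p))\<^sup>2 + (Im (z - p))\<^sup>2" if "f p = p" for p
  proof -
    have "dist w p = dist z p" using assms(1) that unfolding isometry_def w_def by metis
    then show ?thesis unfolding dist_norm cmod_power2[symmetric] by simp
  qed
  define p q r s x y where defs: "p = Re (b - a)" "q = Im (b - a)" "r = Re (c - a)" "s = Im (c - a)"
    "x = Re (w - z)" "y = Im (w - z)"
  have "2 * (x * p + y * q) =
      ((Re (w - a))\<^sup>2 + (Im (w - a))\<^sup>2 - ((Re (z - a))\<^sup>2 + (Im (z - a))\<^sup>2)) -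
      ((Re (w - b))\<^sup>2 + (Im (w - b))\<^sup>2 - ((Re (z - b))\<^sup>2 + (Im (z - b))\<^sup>2))"
    "2 * (x * r + y * s) =
      ((Re (w - a))\<^sup>2 + (Im (w - a))\<^sup>2 - ((Re (z - a))\<^sup>2 + (Im (z - a))\<^sup>2)) -
      ((Re (w - c))\<^sup>2 + (Im (w - c))\<^sup>2 - ((Re (z - c))\<^sup>2 + (Im (z - c))\<^sup>2))"
    by (simp_all add: defs power2_eq_square algebra_simps)
  then have 1: "x * p + y * q = 0" "x * r + y * s = 0"
    unfolding d[OF assms(2)] d[OF assms(3)] d[OF assms(4)] by simp_all
  \<comment> \<open>Elimination as in Cramer's rule.\<close>
  have "x * (p * s - q * r) = (x * p + y * q) * s - (x * r + y * s) * q"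
    "y * (p * s - q * r) = (x * r + y * s) * p - (x * p + y * q) * r"
    by (simp_all add: algebra_simps)
  then have "x * (p * s - q * r) = 0" "y * (p * s - q * r) = 0" unfolding 1 by simp_all
  moreover have "p * s - q * r \<noteq> 0" using assms(5) by (simp add: defs(1-4))
  ultimately have "x = 0" "y = 0" by simp_all
  then show "f z = id z" by (simp add: defs w_def complex_eq_iff)
qed

lemma dist_power2_coord:
  "(dist z w)\<^sup>2 = (coord_x z - coord_x w)\<^sup>2 + (coord_x z - coord_x w) * (coord_y z - coord_y w) +
    (coord_y z - coord_y w)\<^sup>2"
proof -
  have "z - w = pt (coord_x z - coord_x w) (coord_y z - coord_y w)"
    by (simp add: complex_eq_coord_iff)
  then have "(dist z w)\<^sup>2 = (cmod (pt (coord_x z - coord_x w) (coord_y z - coord_y w)))\<^sup>2"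
    by (simp add: dist_norm)
  also have "(cmod (pt x y))\<^sup>2 = x\<^sup>2 + x * y + y\<^sup>2" for x y
    by (simp add: pt_altdef cmod_power2 power_divide power_mult_distrib)
      (simp add: power2_eq_square field_simps)
  finally show ?thesis .
qed

lemma noncollinear_pt:
  assumes "(x2 - x1) * (y3 - y1) \<noteq> (y2 - y1) * (x3 - x1)"
  shows "Re (pt x2 y2 - pt x1 y1) * Im (pt x3 y3 - pt x1 y1) \<noteq>
    Im (pt x2 y2 - pt x1 y1) * Re (pt x3 y3 - pt x1 y1)"
proof -
  have "Re (pt x2 y2 - pt x1 y1) * Im (pt x3 y3 - pt x1 y1) -
      Im (pt x2 y2 - pt x1 y1) * Re (pt x3 y3 - pt x1 y1) =
      sqrt 3 / 2 * ((x2 - x1) * (y3 - y1) - (y2 - y1) * (x3 - x1))"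
    by (simp add: pt_altdef field_simps)
  then show ?thesis using assms by auto
qed

lemma figure_of_comp: "figure_of G (k, g \<circ> f) = map_figure g (figure_of G (k, f))"
  by (simp add: figure_of_def map_figure_def case_prod_beta image_image comp_def)

lemma figure_arc:
  assumes "figure_of G (k, f) = figure_of G (l, g)" "(vs, z) \<in> set (arcs (G k))"
  obtains vs' where "(vs', z) \<in> set (arcs (G l))" "f ` polyline vs = g ` polyline vs'"
proof -
  have "(f ` polyline vs, z) \<in> snd (figure_of G (k, f))"
    using assms(2) by (force simp: figure_of_def)
  then show thesis using that unfolding assms(1) by (auto simp: figure_of_def)
qed

lemma figure_region:
  "figure_of G (k, f) = figure_of G (l, g) \<Longrightarrow> f ` region (G k) = g ` region (G l)"
  by (simp add: figure_of_def)

text \<open>Figures do not record the kind of tile; for metatiles and for supertiles alike, the set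
  of labels recovers it.\<close>

definition shape_labels :: "shape \<Rightarrow> label set" where
  "shape_labels s = snd ` set (arcs s)"

lemma figure_labels:
  assumes "figure_of G (k, f) = figure_of G (l, g)"
  shows "shape_labels (G k) = shape_labels (G l)"
proof -
  have "shape_labels (G k) \<subseteq> shape_labels (G l)"
    if eq: "figure_of G (k, f) = figure_of G (l, g)" for k f l g
  proof
    fix z assume "z \<in> shape_labels (G k)"
    then obtain vs where "(vs, z) \<in> set (arcs (G k))" by (auto simp: shape_labels_def)
    then obtain vs' where "(vs', z) \<in> set (arcs (G l))" using figure_arc[OF eq] by blast
    then show "z \<in> shape_labels (G l)" unfolding shape_labels_def by (metis image_eqI snd_conv)
  qed
  from this[OF assms] this[OF assms[symmetric]] show ?thesis by (rule subset_antisym)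
qed

lemma metatile_labels: "shape_labels (metatile_shape k) = set (map snd (mark_list k))"
proof -
  have "0 < length (mark_list k)" by (cases k) simp_all
  then have l: "length (arcs (metatile_shape k)) = length (mark_list k)" using arcs_metatile(1) by blast
  then have "map snd (arcs (metatile_shape k)) = map snd (mark_list k)"
    using arcs_metatile(2) by (intro nth_equalityI) auto
  then show ?thesis unfolding shape_labels_def by (metis list.set_map)
qed

lemma supertile_labels: "shape_labels (supertile_shape k) = set (map snd (arc_list k))"
  by (force simp: shape_labels_def arcs_supertile)

lemma mark_labels_inj:
  assumes "set (map snd (mark_list k)) = set (map snd (mark_list l))" shows "k = l"
proof -
  have "A_plus \<in> set (map snd (mark_list k)) \<longleftrightarrow> k = H_tile"
    "F_plus \<in> set (map snd (mark_list k)) \<longleftrightarrow> k = F_tile"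
    "L_label \<in> set (map snd (mark_list k)) \<longleftrightarrow> k = P_tile \<or> k = F_tile" for k
    by (cases k; simp)+
  then show ?thesis using assms by (metis (full_types) metatile.exhaust)
qed

lemma arc_labels_inj:
  assumes "set (map snd (arc_list k)) = set (map snd (arc_list l))" shows "k = l"
proof -
  have "A_plus \<in> set (map snd (arc_list k)) \<longleftrightarrow> k = H_tile"
    "F_plus \<in> set (map snd (arc_list k)) \<longleftrightarrow> k = F_tile"
    "L_label \<in> set (map snd (arc_list k)) \<longleftrightarrow> k = P_tile \<or> k = F_tile" for k
    by (cases k; simp)+
  then show ?thesis using assms by (metis (full_types) metatile.exhaust)
qed

lemma metatile_arc_mem:
  "(vs, z) \<in> set (arcs (metatile_shape k)) \<longleftrightarrow> (\<exists>i<length (mark_list k).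
     vs = [lattice_pt (fst (side k i)), lattice_pt (snd (side k i))] \<and> z = snd (mark_list k ! i))"
proof -
  have "0 < length (mark_list k)" by (cases k) simp_all
  then have l: "length (arcs (metatile_shape k)) = length (mark_list k)" using arcs_metatile(1) by blast
  then show ?thesis
    using arcs_metatile(2) by (fastforce simp: in_set_conv_nth side_def)
qed

lemma segment_endpoint:
  fixes a b z :: complex
  assumes "z \<in> closed_segment a b" "dist a z = dist a b" shows "z = b"
proof -
  obtain t where t: "0 \<le> t" "t \<le> 1" "z = (1 - t) *\<^sub>R a + t *\<^sub>R b"
    using assms(1) by (auto simp: closed_segment_def)
  have "a - z = t *\<^sub>R (a - b)" by (simp add: t algebra_simps)
  then have "norm (a - z) = t * norm (a - b)" using t(1) by simp
  then have "t = 1 \<or> a = b" using assms(2) by (auto simp: dist_norm)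
  then show ?thesis by (auto simp: t algebra_simps)
qed

lemma coord_segment:
  assumes "z \<in> closed_segment (pt x1 y1) (pt x2 y2)"
  obtains t where "0 \<le> t" "t \<le> 1" "coord_x z = x1 + t * (x2 - x1)" "coord_y z = y1 + t * (y2 - y1)"
proof -
  obtain t where t: "0 \<le> t" "t \<le> 1" "z = (1 - t) *\<^sub>R pt x1 y1 + t *\<^sub>R pt x2 y2"
    using assms by (auto simp: closed_segment_def)
  have "coord_x z = x1 + t * (x2 - x1)" "coord_y z = y1 + t * (y2 - y1)"
    unfolding t(3) by (simp_all add: algebra_simps)
  then show thesis using that t(1,2) by blast
qed

text \<open>The segments with label \<open>A_plus\<close> and \<open>X_plus\<close> suffice: only one of the latter touches the
  former.\<close>

lemma H_tile_rigid:
  assumes "figure_of metatile_shape (H_tile, u) = figure_of metatile_shape (H_tile, v)"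
    and "isometry u" "direct_isometry v"
  shows "u = v"
proof -
  obtain v' where v': "direct_isometry v'" "v \<circ> v' = id" "v' \<circ> v = id"
    using assms(3) by (rule direct_isometry_inverse)
  define \<phi> where "\<phi> = v' \<circ> u"
  have \<phi>: "isometry \<phi>" unfolding \<phi>_def by (intro isometry_comp direct_isometry_isometry v' assms)
  have arc: "\<exists>vs'. (vs', z) \<in> set (arcs (metatile_shape H_tile)) \<and> \<phi> ` polyline vs = polyline vs'"
    if mem: "(vs, z) \<in> set (arcs (metatile_shape H_tile))" for vs z
  proof -
    obtain vs' where "(vs', z) \<in> set (arcs (metatile_shape H_tile))" "u ` polyline vs = v ` polyline vs'"
      using figure_arc[OF assms(1) mem] .
    moreover from this(2) have "\<phi> ` polyline vs = (v' \<circ> v) ` polyline vs'"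
      by (simp only: \<phi>_def image_comp[symmetric])
    ultimately show ?thesis by (auto simp: v'(3))
  qed
  have Aplus: "(vs, A_plus) \<in> set (arcs (metatile_shape H_tile)) \<longleftrightarrow> vs = [pt 0 4, pt 0 1]" for vs
    by (auto simp: metatile_shape_def)
  have Xplus: "(vs, X_plus) \<in> set (arcs (metatile_shape H_tile)) \<longleftrightarrow>
      vs \<in> {[pt 0 0, pt 1 (-1)], [pt 5 (-1), pt 5 0], [pt 1 4, pt 0 4]}" for vs
    by (auto simp: metatile_shape_def)
  have A: "\<phi> ` closed_segment (pt 0 4) (pt 0 1) = closed_segment (pt 0 4) (pt 0 1)"
    using arc[of "[pt 0 4, pt 0 1]" A_plus] unfolding Aplus by auto
  obtain vs where vs: "vs \<in> {[pt 0 0, pt 1 (-1)], [pt 5 (-1), pt 5 0], [pt 1 4, pt 0 4]}"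
      "\<phi> ` closed_segment (pt 1 4) (pt 0 4) = polyline vs"
    using arc[of "[pt 1 4, pt 0 4]" X_plus] unfolding Xplus by auto
  have mem: "\<phi> (pt 0 4) \<in> closed_segment (pt 0 4) (pt 0 1)" "\<phi> (pt 0 4) \<in> polyline vs"
    using A vs(2) by (blast intro: ends_in_segment)+
  obtain t where "0 \<le> t" "t \<le> 1" "coord_x (\<phi> (pt 0 4)) = 0 + t * (0 - 0)"
      "coord_y (\<phi> (pt 0 4)) = 4 + t * (1 - 4)"
    by (rule coord_segment[OF mem(1)])
  then have t: "t \<le> 1" "coord_x (\<phi> (pt 0 4)) = 0" "coord_y (\<phi> (pt 0 4)) = 4 - 3 * t"
    by simp_all
  have vs': "vs = [pt 1 4, pt 0 4]"
  proof (rule ccontr)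
    assume "vs \<noteq> [pt 1 4, pt 0 4]"
    then consider "\<phi> (pt 0 4) \<in> closed_segment (pt 0 0) (pt 1 (-1))" |
        "\<phi> (pt 0 4) \<in> closed_segment (pt 5 (-1)) (pt 5 0)"
      using vs(1) mem(2) by auto
    then show False
    proof cases
      case 1
      then obtain s where "coord_x (\<phi> (pt 0 4)) = 0 + s * (1 - 0)"
          "coord_y (\<phi> (pt 0 4)) = 0 + s * (- 1 - 0)"
        by (rule coord_segment)
      then show False using t by simp
    next
      case 2
      then obtain s where "coord_x (\<phi> (pt 0 4)) = 5 + s * (5 - 5)" by (rule coord_segment)
      then show False using t by simp
    qed
  qed
  have "\<phi> (pt 0 4) \<in> closed_segment (pt 1 4) (pt 0 4)" using mem(2) vs' by simp
  \<comment> \<open>Lying on both segments forces x = 0 and y = 4, so their common end point is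
    fixed; the other two ends are then fixed by their distance from it.\<close>
  then obtain s where "coord_y (\<phi> (pt 0 4)) = 4 + s * (4 - 4)" by (rule coord_segment)
  then have a: "\<phi> (pt 0 4) = pt 0 4" using t by (simp add: complex_eq_coord_iff)
  have "\<phi> (pt 0 1) \<in> closed_segment (pt 0 4) (pt 0 1)" using A by (blast intro: ends_in_segment)
  moreover have "dist (pt 0 4) (\<phi> (pt 0 1)) = dist (pt 0 4) (pt 0 1)"
    using \<phi> a unfolding isometry_def by metis
  ultimately have b: "\<phi> (pt 0 1) = pt 0 1" by (rule segment_endpoint)
  have "\<phi> (pt 1 4) \<in> closed_segment (pt 0 4) (pt 1 4)"
    using vs(2) vs' closed_segment_commute by (metis ends_in_segment(1) imageI polyline_pair)
  moreover have "dist (pt 0 4) (\<phi> (pt 1 4)) = dist (pt 0 4) (pt 1 4)"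
    using \<phi> a unfolding isometry_def by metis
  ultimately have c: "\<phi> (pt 1 4) = pt 1 4" by (rule segment_endpoint)
  have "\<phi> = id"
    by (rule isometry_fixing_three[OF \<phi> a b c]) (rule noncollinear_pt, simp)
  then have "v \<circ> (v' \<circ> u) = v" by (simp add: \<phi>_def)
  then show ?thesis using v'(2) by (simp add: comp_assoc[symmetric])
qed

text \<open>A segment whose label occurs only once on its tile, so that any isometry preserving the
  figure maps it to itself.\<close>

fun base_side :: "metatile \<Rightarrow> nat" where
  "base_side T_tile = 2" | "base_side H_tile = 7" | "base_side P_tile = 7" | "base_side F_tile = 8"

text \<open>A corner that the half turn about the midpoint of the base side carries out of the
  tile.\<close>

fun base_witness :: "metatile \<Rightarrow> int \<times> int" where
  "base_witness T_tile = (3, 0)" | "base_witness H_tile = (5, 0)"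
| "base_witness P_tile = (2, -2)" | "base_witness F_tile = (2, -2)"

text \<open>A direct isometry that preserves a segment is the identity or the half turn about its
  midpoint; the half turn moves the witness out of the tile. Here \<open>u\<close> has to be direct,
  since \<open>T_tile\<close> has a mirror symmetry that preserves its labels.\<close>

lemma metatile_rigid:
  assumes "figure_of metatile_shape (k, u) = figure_of metatile_shape (k, v)"
    and "direct_isometry u" "direct_isometry v"
  shows "u = v"
proof -
  obtain v' where v': "direct_isometry v'" "v \<circ> v' = id" "v' \<circ> v = id"
    using assms(3) by (rule direct_isometry_inverse)
  define \<phi> where "\<phi> = v' \<circ> u"
  have \<phi>: "direct_isometry \<phi>" unfolding \<phi>_def by (intro direct_isometry_comp v' assms)
  define a b where "a = lattice_pt (fst (side k (base_side k)))" "b = lattice_pt (snd (side k (base_side k)))"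
  have base: "base_side k < length (mark_list k)" by (cases k) simp_all
  have "([a, b], snd (mark_list k ! base_side k)) \<in> set (arcs (metatile_shape k))"
    using base by (auto simp: metatile_arc_mem a_b_def)
  then obtain vs where vs: "(vs, snd (mark_list k ! base_side k)) \<in> set (arcs (metatile_shape k))"
      "u ` polyline [a, b] = v ` polyline vs"
    using figure_arc[OF assms(1)] by blast
  have "list_all (\<lambda>k. list_all (\<lambda>i. snd (mark_list k ! i) = snd (mark_list k ! base_side k) \<longrightarrow>
      i = base_side k) [0..<length (mark_list k)]) [T_tile, H_tile, P_tile, F_tile]"
    by code_simp
  then have "i = base_side k"
    if "i < length (mark_list k)" "snd (mark_list k ! base_side k) = snd (mark_list k ! i)" for i
    using that by (cases k) (simp_all add: list_all_iff)
  then have "vs = [a, b]" using vs(1) unfolding metatile_arc_mem a_b_def by blast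
  then have "\<phi> ` closed_segment a b = (v' \<circ> v) ` closed_segment a b"
    using vs(2) by (simp only: \<phi>_def polyline_pair image_comp[symmetric])
  then have "closed_segment (\<phi> a) (\<phi> b) = closed_segment a b"
    by (simp add: direct_isometry_segment[OF \<phi>] v'(3))
  then have ab: "{\<phi> a, \<phi> b} = {a, b}" by (simp add: closed_segment_eq)
  have "a \<noteq> b" by (cases k) (simp_all add: a_b_def side_def)
  obtain c d where cd: "\<phi> = (\<lambda>z. c * z + d)" using \<phi> unfolding direct_isometry_def by auto
  have "\<phi> = id"
  proof (cases "\<phi> a = a")
    case True
    then have "\<phi> b = b" using ab \<open>a \<noteq> b\<close> by (metis doubleton_eq_iff)
    then have "c * a + d = a" "c * b + d = b" using True by (simp_all add: cd)
    moreover have "c * (a - b) = (c * a + d) - (c * b + d)" by (simp add: algebra_simps)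
    ultimately have "c * (a - b) = 1 * (a - b)" by simp
    then have "c = 1" using \<open>a \<noteq> b\<close> by (simp only: mult_cancel_right right_minus_eq) blast
    then show ?thesis using True by (auto simp: cd)
  next
    case False
    then have *: "\<phi> a = b" "\<phi> b = a" using ab by (metis doubleton_eq_iff)+
    then have "c * a + d = b" "c * b + d = a" by (simp_all add: cd)
    moreover have "c * (a - b) = (c * a + d) - (c * b + d)" by (simp add: algebra_simps)
    ultimately have "c * (a - b) = (- 1) * (a - b)" by simp
    then have "c = - 1" using \<open>a \<noteq> b\<close> by (simp only: mult_cancel_right right_minus_eq) blast
    \<comment> \<open>The half turn about the midpoint of the base side.\<close>
    then have \<phi>': "\<phi> z = a + b - z" for z using *(1) by (auto simp: cd algebra_simps)
    have "\<phi> ` hexagon_set (tile_hexagon k) = (v' \<circ> v) ` hexagon_set (tile_hexagon k)"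
      using figure_region[OF assms(1)] by (simp only: \<phi>_def region_metatile image_comp[symmetric])
    then have "\<phi> ` hexagon_set (tile_hexagon k) = hexagon_set (tile_hexagon k)"
      by (simp add: v'(3))
    moreover have "lattice_pt (base_witness k) \<in> hexagon_set (tile_hexagon k)"
      by (cases k) (simp_all add: hexagon_set_def)
    ultimately have "a + b - lattice_pt (base_witness k) \<in> hexagon_set (tile_hexagon k)"
      unfolding \<phi>'[symmetric] by blast
    then have False by (cases k) (simp_all add: hexagon_set_def a_b_def side_def)
    then show ?thesis ..
  qed
  then have "v \<circ> (v' \<circ> u) = v" by (simp add: \<phi>_def)
  then show ?thesis using v'(2) by (simp add: comp_assoc[symmetric])
qed

section \<open>Asymmetry of the long supertile arcs\<close>

text \<open>The \<open>B_plus\<close> arc of the supertile of \<open>T_tile\<close>. Its squared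
  diameter is 21, attained only between (0, 4) and each of (1, -1) and (-1, 0).\<close>

definition base_path :: "(int \<times> int) list" where
  "base_path = [(0, 4), (-1, 4), (-1, 3), (-1, 2), (-1, 1), (-1, 0), (0, 0), (1, -1)]"

text \<open>On a segment, the distance from a fixed point is strictly smaller inside than at one of
  the ends. So extremal distances on a polygonal path are attained only at vertices.\<close>

lemma polyline_far:
  assumes "z \<in> polyline vs"
  shows "z \<in> set vs \<or> (\<exists>a\<in>set vs. dist c z < dist c a)"
proof -
  obtain i where i: "i < length vs - 1" "z \<in> closed_segment (vs ! i) (vs ! Suc i)"
    using assms by (auto simp: polyline_def)
  then have "vs ! i \<in> set vs" "vs ! Suc i \<in> set vs" by auto
  moreover have "z = vs ! i \<or> z = vs ! Suc i \<or> z \<in> open_segment (vs ! i) (vs ! Suc i)"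
    using i(2) by (auto simp: open_segment_def)
  ultimately show ?thesis using dist_decreases_open_segment by metis
qed

lemma polyline_vertex:
  assumes "v \<in> set vs" "1 < length vs" shows "v \<in> polyline vs"
proof -
  obtain i where i: "i < length vs" "v = vs ! i" using assms(1) by (metis in_set_conv_nth)
  show ?thesis
  proof (cases "Suc i < length vs")
    case True
    then show ?thesis using i by (auto simp: polyline_def intro!: bexI[of _ i])
  next
    case False
    then have "i - 1 < length vs - 1" "Suc (i - 1) = i" using i(1) assms(2) by auto
    then show ?thesis using i(2) unfolding polyline_def by (metis UN_I ends_in_segment(2) lessThan_iff)
  qed
qed

lemma base_path_vertices:
  assumes "p \<in> set base_path" "q \<in> set base_path"
  shows "(dist (lattice_pt p) (lattice_pt q))\<^sup>2 \<le> 21"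
    and "(dist (lattice_pt p) (lattice_pt q))\<^sup>2 = 21 \<Longrightarrow>
      (p = (0, 4) \<and> q \<in> {(1, -1), (-1, 0)}) \<or> (q = (0, 4) \<and> p \<in> {(1, -1), (-1, 0)})"
  using assms by (auto simp: base_path_def dist_power2_coord)

text \<open>Moving a non-vertex to a suitable vertex would increase the distance beyond the maximum
  21, so both points are vertices and the finite check decides.\<close>

lemma base_path_far:
  assumes "z \<in> polyline (map lattice_pt base_path)" "w \<in> polyline (map lattice_pt base_path)"
    and "(dist z w)\<^sup>2 = 21"
  shows "(z = pt 0 4 \<and> w \<in> {pt 1 (-1), pt (-1) 0}) \<or> (w = pt 0 4 \<and> z \<in> {pt 1 (-1), pt (-1) 0})"
proof -
  let ?Q = "polyline (map lattice_pt base_path)" and ?V = "set (map lattice_pt base_path)"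
  have V: "(dist a b)\<^sup>2 \<le> 21" if "a \<in> ?V" "b \<in> ?V" for a b
    using that base_path_vertices(1) by auto
  have less: "(dist c x)\<^sup>2 < (dist c a)\<^sup>2" if "dist c x < dist c a" for a c x :: complex
    using that by (intro power_strict_mono) auto
  have VQ: "(dist a x)\<^sup>2 \<le> 21" if "a \<in> ?V" "x \<in> ?Q" for a x
    using polyline_far[OF that(2), of a] V that(1) less by (metis less_le_trans less_imp_le)
  have far: "x \<in> ?V" if xy: "x \<in> ?Q" "y \<in> ?Q" "(dist x y)\<^sup>2 = 21" for x y
  proof (rule ccontr)
    assume "x \<notin> ?V"
    then obtain a where "a \<in> ?V" "dist y x < dist y a" using polyline_far[OF xy(1), of y] by blast
    then have "(dist x y)\<^sup>2 < 21" using less[of y x a] VQ[of a y] xy(2) by (simp add: dist_commute)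
    then show False using xy(3) by simp
  qed
  have "z \<in> ?V" "w \<in> ?V"
    using far[of z w] far[of w z] assms by (simp_all add: dist_commute)
  then obtain p q where pq: "p \<in> set base_path" "q \<in> set base_path" "z = lattice_pt p" "w = lattice_pt q"
    by auto
  have "lattice_pt (x, y) = pt (of_int x) (of_int y)" for x y by (simp add: lattice_pt_def)
  from this[of 0 4] this[of 1 "-1"] this[of "-1" 0]
  show ?thesis using base_path_vertices(2)[OF pq(1,2)] assms(3) pq(3,4) by auto
qed

text \<open>The path lies on four lines; this allows its points at distance 1 from (0, 4) to be
  computed.\<close>

lemma base_path_coord:
  assumes "z \<in> polyline (map lattice_pt base_path)"
  shows "coord_y z = 4 \<and> coord_x z \<in> {-1..0} \<or> coord_x z = -1 \<and> coord_y z \<in> {0..4} \<or>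
    coord_y z = 0 \<and> coord_x z \<in> {-1..0} \<or> coord_x z \<in> {0..1} \<and> coord_y z = - coord_x z"
proof -
  have "length base_path = 8" by (simp add: base_path_def)
  then obtain i where i: "i < 7" "z \<in> closed_segment (lattice_pt (base_path ! i)) (lattice_pt (base_path ! Suc i))"
    using assms by (auto simp: polyline_def)
  then obtain t where t: "0 \<le> t" "t \<le> 1"
      "z = (1 - t) *\<^sub>R lattice_pt (base_path ! i) + t *\<^sub>R lattice_pt (base_path ! Suc i)"
    by (auto simp: closed_segment_def)
  have c: "coord_x z = (1 - t) * of_int (fst (base_path ! i)) + t * of_int (fst (base_path ! Suc i))"
      "coord_y z = (1 - t) * of_int (snd (base_path ! i)) + t * of_int (snd (base_path ! Suc i))"
    unfolding t(3) by simp_all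
  consider "i = 0" | "i = 1" | "i = 2" | "i = 3" | "i = 4" | "i = 5" | "i = 6"
    using i(1) by linarith
  then show ?thesis
    using c t(1,2) by cases (auto simp: base_path_def)
qed

text \<open>The point (0, 4) is the only one that ends two diameters, so it is fixed. So is (-1, 4),
  the only point of the path at distance 1 from it. These two and (1, -1) are not collinear, so it
  remains to fix (1, -1).\<close>

lemma base_path_rigid:
  assumes "isometry \<phi>" "\<phi> ` polyline (map lattice_pt base_path) = polyline (map lattice_pt base_path)"
  shows "\<phi> = id"
proof -
  let ?Q = "polyline (map lattice_pt base_path)"
  have d: "(dist (\<phi> z) (\<phi> w))\<^sup>2 = (dist z w)\<^sup>2" for z w
    using assms(1) by (simp add: isometry_def)
  have lp: "lattice_pt (x, y) = pt (of_int x) (of_int y)" for x y by (simp add: lattice_pt_def)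
  have vertex: "lattice_pt p \<in> ?Q" if "p \<in> set base_path" for p
    using that by (intro polyline_vertex) (auto simp: base_path_def)
  have Q: "pt 0 4 \<in> ?Q" "pt (-1) 4 \<in> ?Q" "pt 1 (-1) \<in> ?Q" "pt (-1) 0 \<in> ?Q"
    using vertex[of "(0, 4)"] vertex[of "(-1, 4)"] vertex[of "(1, -1)"] vertex[of "(-1, 0)"]
    by (simp_all add: base_path_def lp)
  then have \<phi>Q: "\<phi> (pt 0 4) \<in> ?Q" "\<phi> (pt (-1) 4) \<in> ?Q" "\<phi> (pt 1 (-1)) \<in> ?Q" "\<phi> (pt (-1) 0) \<in> ?Q"
    using assms(2) by blast+
  have far: "(dist (\<phi> (pt 0 4)) (\<phi> (pt 1 (-1))))\<^sup>2 = 21" "(dist (\<phi> (pt 0 4)) (\<phi> (pt (-1) 0)))\<^sup>2 = 21"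
    unfolding d by (simp_all add: dist_power2_coord)
  have ne: "\<phi> (pt 1 (-1)) \<noteq> \<phi> (pt (-1) 0)" using isometry_inj[OF assms(1)] by fastforce
  have a: "\<phi> (pt 0 4) = pt 0 4"
    using base_path_far[OF \<phi>Q(1,3) far(1)] base_path_far[OF \<phi>Q(1,4) far(2)] ne by auto
  have "(dist (pt 0 4) (\<phi> (pt (-1) 4)))\<^sup>2 = 1"
    using d[of "pt 0 4" "pt (-1) 4"] by (simp add: a dist_power2_coord)
  then have b: "\<phi> (pt (-1) 4) = pt (-1) 4"
  proof -
    define x y where "x = coord_x (\<phi> (pt (-1) 4))" "y = coord_y (\<phi> (pt (-1) 4))"
    have e: "x\<^sup>2 + x * (y - 4) + (y - 4)\<^sup>2 = 1"
      using \<open>(dist (pt 0 4) (\<phi> (pt (-1) 4)))\<^sup>2 = 1\<close>[unfolded dist_power2_coord]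
      by (simp add: x_y_def power2_eq_square algebra_simps)
    consider "y = 4" "-1 \<le> x" "x \<le> 0" | "x = -1" "0 \<le> y" "y \<le> 4" | "y = 0" "x \<le> 0" | "0 \<le> x" "y = - x"
      using base_path_coord[OF \<phi>Q(2)] unfolding x_y_def by auto
    then have "x = -1 \<and> y = 4"
    proof cases
      case 1
      then show ?thesis using e by (auto simp: power2_eq_1_iff)
    next
      case 2
      then have "(y - 4) * (y - 5) = 0" using e by (simp add: power2_eq_square algebra_simps)
      then show ?thesis using 2 by auto
    next
      case 3
      then have "x\<^sup>2 + 15 = 4 * x" using e by (simp add: power2_eq_square)
      then show ?thesis using 3 zero_le_power2[of x] by linarith
    next
      case 4
      then have "x\<^sup>2 + 4 * x + 15 = 0" using e by (simp add: power2_eq_square algebra_simps)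
      then show ?thesis using 4 zero_le_power2[of x] by linarith
    qed
    then show ?thesis by (simp add: complex_eq_coord_iff x_y_def)
  qed
  \<comment> \<open>The other ends (1, -1) and (-1, 0) of the two diameters are told apart by their
    squared distances 19 and 16 from (-1, 4).\<close>
  have "(dist (pt (-1) 4) (\<phi> (pt 1 (-1))))\<^sup>2 = 19"
    using d[of "pt (-1) 4" "pt 1 (-1)"] by (simp add: b dist_power2_coord)
  then have "\<phi> (pt 1 (-1)) \<noteq> pt (-1) 0" by (auto simp: dist_power2_coord)
  then have c: "\<phi> (pt 1 (-1)) = pt 1 (-1)"
    using base_path_far[OF \<phi>Q(1,3) far(1)] a by auto
  show ?thesis
    by (rule isometry_fixing_three[OF assms(1) a b c]) (rule noncollinear_pt, simp)
qed

text \<open>An arc whose label occurs only once on the supertile: \<open>A_plus\<close> for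
  \<open>H_tile\<close>, \<open>B_plus\<close> for the others.\<close>

fun base_arc :: "metatile \<Rightarrow> nat" where
  "base_arc T_tile = 2" | "base_arc H_tile = 0" | "base_arc P_tile = 7" | "base_arc F_tile = 8"

text \<open>Carries \<open>base_path\<close> onto the base arc; for \<open>H_tile\<close> the arc is
  traversed backwards, because \<open>A_plus\<close> and \<open>B_plus\<close> arcs have the same
  shape with opposite orientation.\<close>

fun base_arc_placement :: "metatile \<Rightarrow> placement" where
  "base_arc_placement T_tile = (0, 0, 0)" | "base_arc_placement H_tile = (4, -5, 2)"
| "base_arc_placement P_tile = (5, -7, 5)" | "base_arc_placement F_tile = (5, -7, 5)"

text \<open>The base arc is preserved as a set and has no symmetry, not even a reflection. So every
  kind of supertile is chiral, in contrast to \<open>T_tile\<close>.\<close>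

lemma supertile_rigid:
  assumes "figure_of supertile_shape (k, u) = figure_of supertile_shape (k, v)"
    and "isometry u" "direct_isometry v"
  shows "u = v"
proof -
  let ?Q = "polyline (map lattice_pt base_path)"
  obtain p z where pz: "arc_list k ! base_arc k = (p, z)" by (cases "arc_list k ! base_arc k")
  define a where "a = placed (base_arc_placement k)"
  have base: "base_arc k < length (arc_list k)" by (cases k) simp_all
  have "list_all (\<lambda>k. list_all (\<lambda>i. snd (arc_list k ! i) = snd (arc_list k ! base_arc k) \<longrightarrow>
      i = base_arc k) [0..<length (arc_list k)]) [T_tile, H_tile, P_tile, F_tile]"
    by code_simp
  then have "i = base_arc k"
    if "i < length (arc_list k)" "snd (arc_list k ! base_arc k) = snd (arc_list k ! i)" for i
    using that by (cases k) (simp_all add: list_all_iff)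
  then have unique: "q = p" if "(q, z) \<in> set (arc_list k)" for q
    using that pz by (metis fst_conv in_set_conv_nth snd_conv)
  have "map (move (base_arc_placement k)) base_path = (if k = H_tile then rev p else p)"
    using pz by (cases k) (auto simp: base_path_def eval_nat_numeral)
  moreover have "map a (map lattice_pt base_path) =
      map lattice_pt (map (move (base_arc_placement k)) base_path)"
    by (simp add: a_def)
  ultimately have "map a (map lattice_pt base_path) = map lattice_pt (if k = H_tile then rev p else p)"
    by (simp only:)
  then have "polyline (map a (map lattice_pt base_path)) = polyline (map lattice_pt p)"
    by (simp add: rev_map[symmetric] polyline_rev split: if_splits)
  then have Q: "polyline (map lattice_pt p) = a ` ?Q"
    by (simp only: a_def polyline_direct[OF direct_isometry_placed])
  have "(map lattice_pt p, z) \<in> set (arcs (supertile_shape k))"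
    using base nth_mem[OF base] by (force simp: arcs_supertile pz)
  then obtain vs where vs: "(vs, z) \<in> set (arcs (supertile_shape k))"
      "u ` polyline (map lattice_pt p) = v ` polyline vs"
    using figure_arc[OF assms(1)] by blast
  then have "vs = map lattice_pt p" using unique by (auto simp: arcs_supertile)
  then have uv: "(u \<circ> a) ` ?Q = (v \<circ> a) ` ?Q"
    using vs(2) by (simp only: Q image_comp[symmetric])
  have va: "direct_isometry (v \<circ> a)"
    unfolding a_def by (intro direct_isometry_comp assms direct_isometry_placed)
  obtain v' where v': "direct_isometry v'" "(v \<circ> a) \<circ> v' = id" "v' \<circ> (v \<circ> a) = id"
    using va by (rule direct_isometry_inverse)
  have "(v' \<circ> (u \<circ> a)) ` ?Q = (v' \<circ> (v \<circ> a)) ` ?Q"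
    using uv by (simp only: image_comp[symmetric])
  moreover have "isometry (v' \<circ> (u \<circ> a))"
    unfolding a_def by (intro isometry_comp direct_isometry_isometry direct_isometry_placed v' assms)
  ultimately have "v' \<circ> (u \<circ> a) = id" using base_path_rigid[of "v' \<circ> (u \<circ> a)"] by (simp add: v'(3))
  then have "(v \<circ> a) \<circ> v' \<circ> (u \<circ> a) = v \<circ> a" by (simp add: comp_assoc)
  then have ua: "u \<circ> a = v \<circ> a" by (simp add: v'(2))
  obtain a' where "a \<circ> a' = id"
    using direct_isometry_inverse[OF direct_isometry_placed] unfolding a_def by metis
  then show ?thesis using ua by (metis comp_assoc comp_id)
qed

section \<open>Symmetries\<close>

lemma is_symmetryI:
  assumes "isometry g" "g \<circ> g' = id"
    and "\<And>k f. (k, f) \<in> M \<Longrightarrow> (k, g \<circ> f) \<in> M" "\<And>k f. (k, f) \<in> M \<Longrightarrow> (k, g' \<circ> f) \<in> M"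
  shows "is_symmetry G M g"
  unfolding is_symmetry_def
proof (intro conjI equalityI subsetI assms(1))
  fix x assume "x \<in> map_figure g ` figure_of G ` M"
  then obtain k f where "(k, f) \<in> M" "x = figure_of G (k, g \<circ> f)"
    by (auto simp: figure_of_comp)
  then show "x \<in> figure_of G ` M" using assms(3) by blast
next
  fix x assume "x \<in> figure_of G ` M"
  then obtain k f where kf: "(k, f) \<in> M" "x = figure_of G (k, f)" by auto
  then have "x = map_figure g (figure_of G (k, g' \<circ> f))"
    by (simp add: figure_of_comp[symmetric] comp_assoc[symmetric] assms(2))
  then show "x \<in> map_figure g ` figure_of G ` M" using assms(4) kf(1) by blast
qed

text \<open>A symmetry is known only to permute figures. Applied to one tile that is rigid even
  under reflections, it is seen to be direct; rigidity of the remaining tiles under direct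
  isometries then turns equal figures into equal placements.\<close>

lemma symmetry_placements:
  assumes sym: "is_symmetry G M g" and direct: "\<And>k f. (k, f) \<in> M \<Longrightarrow> direct_isometry f"
    and labels: "\<And>k l. shape_labels (G k) = shape_labels (G l) \<Longrightarrow> k = l"
    and rigid: "\<And>k u v. figure_of G (k, u) = figure_of G (k, v) \<Longrightarrow> direct_isometry u \<Longrightarrow>
      direct_isometry v \<Longrightarrow> u = v"
    and chiral: "(k0, f0) \<in> M" "\<And>u v. figure_of G (k0, u) = figure_of G (k0, v) \<Longrightarrow> isometry u \<Longrightarrow>
      direct_isometry v \<Longrightarrow> u = v"
  obtains g' where "direct_isometry g" "direct_isometry g'" "g \<circ> g' = id" "g' \<circ> g = id"
    "\<And>k f. (k, f) \<in> M \<Longrightarrow> (k, g \<circ> f) \<in> M" "\<And>k f. (k, f) \<in> M \<Longrightarrow> (k, g' \<circ> f) \<in> M"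
proof -
  have g: "isometry g" and figs: "map_figure g ` figure_of G ` M = figure_of G ` M"
    using sym by (auto simp: is_symmetry_def)
  have fwd: "\<exists>f'. (k, f') \<in> M \<and> figure_of G (k, g \<circ> f) = figure_of G (k, f')" if "(k, f) \<in> M" for k f
  proof -
    have "map_figure g (figure_of G (k, f)) \<in> map_figure g ` figure_of G ` M" using that by blast
    then have "figure_of G (k, g \<circ> f) \<in> figure_of G ` M" by (simp only: figure_of_comp figs)
    then obtain l f' where "(l, f') \<in> M" "figure_of G (k, g \<circ> f) = figure_of G (l, f')" by auto
    moreover from this(2) have "k = l" by (intro labels figure_labels)
    ultimately show ?thesis by blast
  qed
  obtain f1 where f1: "(k0, f1) \<in> M" "figure_of G (k0, g \<circ> f0) = figure_of G (k0, f1)"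
    using fwd[OF chiral(1)] by blast
  then have "g \<circ> f0 = f1"
    using chiral direct by (intro chiral(2) isometry_comp g direct_isometry_isometry) auto
  obtain h where h: "direct_isometry h" "f0 \<circ> h = id"
    using direct_isometry_inverse[OF direct[OF chiral(1)]] by metis
  then have "g = f1 \<circ> h" using \<open>g \<circ> f0 = f1\<close> by (metis comp_assoc comp_id)
  then have dg: "direct_isometry g" using h(1) direct[OF f1(1)] by (simp add: direct_isometry_comp)
  obtain g' where g': "direct_isometry g'" "g \<circ> g' = id" "g' \<circ> g = id"
    using dg by (rule direct_isometry_inverse)
  have "(k, g \<circ> f) \<in> M" if "(k, f) \<in> M" for k f
    using fwd[OF that] rigid direct_isometry_comp[OF dg direct[OF that]] direct by metis
  moreover have "(k, g' \<circ> f) \<in> M" if kf: "(k, f) \<in> M" for k f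
  proof -
    have "figure_of G (k, f) \<in> map_figure g ` figure_of G ` M" unfolding figs using kf by blast
    then obtain l f' where f': "(l, f') \<in> M" "figure_of G (k, f) = figure_of G (l, g \<circ> f')"
      by (auto simp: figure_of_comp)
    from f'(2) have "k = l" by (intro labels figure_labels)
    then have "f = g \<circ> f'"
      using f' rigid direct_isometry_comp[OF dg direct[OF f'(1)]] direct[OF kf] by metis
    then have "g' \<circ> f = f'" using g'(3) by (simp add: comp_assoc[symmetric])
    then show ?thesis using f'(1) \<open>k = l\<close> by simp
  qed
  ultimately show thesis using that dg g' by blast
qed

context metatile_tiling
begin

lemma supertile_exists: obtains k h where "(k, h) \<in> S"
proof -
  obtain k f where kf: "(k, f) \<in> M" using tiling unfolding is_tiling_def by blast
  obtain q where "q \<in> pieces_of k" by (cases k) auto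
  then have "(q, f) \<in> bisect M" using kf by (auto simp: bisect_def)
  then obtain s where "s \<in> S" by (rule piece_covered)
  then show thesis using that by (cases s) blast
qed

text \<open>Every supertile contains an \<open>H_piece\<close>, so the tiling contains the chiral
  tile needed to exclude reflections.\<close>

lemma H_tile_exists: obtains f where "(H_tile, f) \<in> M"
proof -
  obtain k h where kh: "(k, h) \<in> S" by (rule supertile_exists)
  have "\<exists>b. (H_piece, b) \<in> set (piece_list k)" by (cases k) auto
  then obtain b where "(H_piece, h \<circ> placed b) \<in> group_of (k, h)" by (force simp: group_of_eq)
  then have "(H_piece, h \<circ> placed b) \<in> bisect M" using kh by (auto simp: supertiles_def)
  then show thesis using that by (simp add: mem_bisect)
qed

lemma group_of_comp: "group_of (k, g \<circ> h) = (\<lambda>(q, f). (q, g \<circ> f)) ` group_of (k, h)"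
  by (force simp: group_of_eq comp_assoc)

lemma supertiles_invariant:
  assumes "direct_isometry g" "\<And>k f. (k, f) \<in> M \<Longrightarrow> (k, g \<circ> f) \<in> M" "(k, h) \<in> S"
  shows "(k, g \<circ> h) \<in> S"
  using assms by (auto simp: supertiles_def group_of_comp mem_bisect intro!: direct_isometry_comp)

text \<open>Any half of the tile lies in some group, the moved group again belongs to the bisected
  tiling, and one half present there brings the whole tile with it.\<close>

lemma metatiles_invariant:
  assumes "\<And>k h. (k, h) \<in> S \<Longrightarrow> (k, g \<circ> h) \<in> S" "(k, f) \<in> M"
  shows "(k, g \<circ> f) \<in> M"
proof -
  obtain q where q: "tile_of q = k" by (cases k) (metis tile_of.simps)+
  then have "(q, f) \<in> bisect M" using assms(2) by (simp add: mem_bisect)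
  then obtain l h where s: "(l, h) \<in> S" "(q, f) \<in> group_of (l, h)"
    using piece_covered by (metis surj_pair)
  then have "(q, g \<circ> f) \<in> group_of (l, g \<circ> h)" by (force simp: group_of_comp)
  moreover have "group_of (l, g \<circ> h) \<subseteq> bisect M" using assms(1)[OF s(1)] by (simp add: supertiles_def)
  ultimately show ?thesis using q by (auto simp: mem_bisect)
qed

text \<open>On either side a symmetry is first turned into invariance of placements under
  \<open>g\<close> and its inverse. That form passes between tiles and supertiles, because each set
  determines the other through the groups.\<close>

lemma symmetry_iff: "is_symmetry metatile_shape M g \<longleftrightarrow> is_symmetry supertile_shape S g"
proof
  assume sym: "is_symmetry metatile_shape M g"
  obtain f0 where f0: "(H_tile, f0) \<in> M" by (rule H_tile_exists)
  obtain g' where g': "direct_isometry g" "direct_isometry g'" "g \<circ> g' = id" "g' \<circ> g = id"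
    "\<And>k f. (k, f) \<in> M \<Longrightarrow> (k, g \<circ> f) \<in> M" "\<And>k f. (k, f) \<in> M \<Longrightarrow> (k, g' \<circ> f) \<in> M"
    by (rule symmetry_placements[OF sym tiling_direct[OF tiling] _ metatile_rigid f0 H_tile_rigid])
      (auto simp: metatile_labels mark_labels_inj)
  show "is_symmetry supertile_shape S g"
    by (rule is_symmetryI[OF direct_isometry_isometry[OF g'(1)] g'(3)])
      (use g' supertiles_invariant in blast)+
next
  assume sym: "is_symmetry supertile_shape S g"
  obtain k0 h0 where s: "(k0, h0) \<in> S" by (rule supertile_exists)
  have rigid: "u = v" if "figure_of supertile_shape (k, u) = figure_of supertile_shape (k, v)"
      "direct_isometry u" "direct_isometry v" for k u v
    using that supertile_rigid direct_isometry_isometry by blast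
  obtain g' where g': "direct_isometry g" "direct_isometry g'" "g \<circ> g' = id" "g' \<circ> g = id"
    "\<And>k f. (k, f) \<in> S \<Longrightarrow> (k, g \<circ> f) \<in> S" "\<And>k f. (k, f) \<in> S \<Longrightarrow> (k, g' \<circ> f) \<in> S"
    by (rule symmetry_placements[OF sym supertile_direct _ rigid s supertile_rigid])
      (auto simp: supertile_labels arc_labels_inj)
  show "is_symmetry metatile_shape M g"
    by (rule is_symmetryI[OF direct_isometry_isometry[OF g'(1)] g'(3)])
      (use g' metatiles_invariant in blast)+
qed

end

theorem theorem5p1:
  fixes M :: "(metatile \<times> (complex \<Rightarrow> complex)) set"
  assumes "is_tiling metatile_shape M"
    and "obeys_matching_rules metatile_shape M"
  shows "(\<exists>S :: (metatile \<times> (complex \<Rightarrow> complex)) set.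
            ((\<forall>(k, h)\<in>S. direct_isometry h) \<and>
             (\<Union>s\<in>S. group_of s) = bisect M \<and>
             (\<forall>s\<in>S. \<forall>t\<in>S. s \<noteq> t \<longrightarrow> group_of s \<inter> group_of t = {})) \<and>
            is_tiling supertile_shape S \<and>
            obeys_matching_rules supertile_shape S \<and>
            (\<forall>g. isometry g \<longrightarrow>
               (is_symmetry metatile_shape M g \<longleftrightarrow> is_symmetry supertile_shape S g))) \<and>
         (\<forall>cs :: (metatile \<times> nat) list.
            (\<forall>(k, i)\<in>set cs. i < length (arcs (supertile_shape k))) \<and>
            consecutive_labels_match cs \<longrightarrow>
            (\<Sum>(k, i)\<leftarrow>cs. interior_angle (supertile_shape k) i) =
            (\<Sum>(k, i)\<leftarrow>cs. interior_angle (metatile_shape k) (corresponding_mark k i)))"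
proof (intro conjI allI impI)
  interpret metatile_tiling M using assms by unfold_locales
  have "(\<forall>(k, h)\<in>S. direct_isometry h) \<and> (\<Union>s\<in>S. group_of s) = bisect M \<and>
      (\<forall>s\<in>S. \<forall>t\<in>S. s \<noteq> t \<longrightarrow> group_of s \<inter> group_of t = {})"
    using supertile_direct Union_group_of groups_disjoint by fast
  then show "\<exists>S :: (metatile \<times> (complex \<Rightarrow> complex)) set.
      ((\<forall>(k, h)\<in>S. direct_isometry h) \<and> (\<Union>s\<in>S. group_of s) = bisect M \<and>
        (\<forall>s\<in>S. \<forall>t\<in>S. s \<noteq> t \<longrightarrow> group_of s \<inter> group_of t = {})) \<and>
      is_tiling supertile_shape S \<and> obeys_matching_rules supertile_shape S \<and>
      (\<forall>g. isometry g \<longrightarrow> (is_symmetry metatile_shape M g \<longleftrightarrow> is_symmetry supertile_shape S g))"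
    using supertiles_tiling supertiles_matching symmetry_iff by (intro exI[of _ S]) simp
qed (use vertex_angle_sums in blast)

end
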